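(* Let $n,m\ge1$, and let $X=X(n,m)$ be the competition complexity (with respect to VCG) of $n$ bidders with additive valuations over $m$ independent, regular items. Then the competition complexity with respect to $\mathrm{VCG}^{\mathrm{UD}}$ of $n$ bidders with valuations that are additive subject to randomly drawn downward-closed constraints over $m$ independent, regular items is at most $X+m-1$, where every set system in the support of the distribution of constraints is downward-closed and contains all singletons $\{j\}$, $j\in[m]$.
   Context: A one-dimensional distribution $F_j$ on $[0,\infty)$ (identified with its CDF) is taken to be continuous, with density $f_j$ positive on an interval; its virtual value function is $\varphi_j(x)=x-\frac{1-F_j(x)}{f_j(x)}$, and $F_j$ is regular if $\varphi_j$ is non-decreasing. A set system $([m],\mathcal I)$ is downward-closed if $T\subseteq S\in\mathcal I$ implies $T\in\mathcal I$. A distribution $F$ over valuations is additive over $m$ independent, regular items if there are regular $F_1,\dots,F_m$ such that $v\sim F$ is obtained by drawing $v_j\sim F_j$ independently and setting $v(S)=\sum_{j\in S}v_j$. It is additive subject to randomly drawn downward-closed constraints over $m$ independent, regular items if there are a distribution $F_0$ over downward-closed set systems on $[m]$ and regular $F_1,\dots,F_m$ such that $v\sim F$ is obtained by drawing $\mathcal I\sim F_0$ and $v_j\sim F_j$, all independently, and setting $v(S)=\max_{T\subseteq S,\,T\in\mathcal I}\sum_{j\in T}v_j$. Bidders' valuations are i.i.d. from $F$; utilities are quasi-linear. A (possibly randomized) mechanism maps bids to an allocation of the items (each item to at most one bidder) and payments. It is BIC if truth-telling maximizes each bidder's expected utility given that the others report truthfully, and BIR if each bidder's expected utility from truthful reporting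 is non-negative (expectations over the mechanism's randomness and the others' valuations). $\mathrm{OPT}(F,n)$ is the optimal (supremum) expected revenue over all BIC and BIR mechanisms for $n$ bidders with valuations i.i.d. from $F$. $\mathrm{Rev}(M,F,k)$ is the expected revenue of mechanism $M$ with $k$ bidders with valuations i.i.d. from $F$. VCG chooses a welfare-maximizing allocation and charges each bidder her externality (maximum welfare of the others without her, minus the welfare of the others in the chosen allocation). $\mathrm{VCG}^{\mathrm{UD}}$ is the maximal-in-range mechanism that runs VCG with the set of outcomes restricted to matchings (each bidder gets at most one item): it picks a welfare-maximizing matching and charges each bidder her externality computed with respect to matchings. The competition complexity with respect to a mechanism $M$ of $n$ bidders for a class $\mathcal D$ of distributions is the least integer $c\ge0$ such that $\mathrm{OPT}(F,n)\le\mathrm{Rev}(M,F,n+c)$ for all $F\in\mathcal D$. *)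

theory Defs
  imports "HOL-Probability.Probability" "HOL-Library.Extended_Nat"
begin

text \<open>
  Items are the elements of \<open>{..<m}\<close>, bidders those of \<open>{..<n}\<close>. Valuations, allocations and
  payment vectors are extensional functions on their (finite) index sets, so that they are the
  points of the library's finite product spaces.
\<close>

type_synonym valuation = "nat set \<Rightarrow> real"
type_synonym allocation = "nat \<Rightarrow> nat set"
type_synonym payments = "nat \<Rightarrow> real"

text \<open>A randomized mechanism sends a bid profile to a distribution over outcomes.\<close>

type_synonym mechanism = "(nat \<Rightarrow> valuation) \<Rightarrow> (allocation \<times> payments) measure"


section \<open>Regular one-dimensional distributions\<close>

text \<open>The density is fixed to vanish off the interval on which it is positive.\<close>

definition has_interval_density :: "real measure \<Rightarrow> (real \<Rightarrow> real) \<Rightarrow> real set \<Rightarrow> bool" where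
  "has_interval_density D f J \<longleftrightarrow>
     prob_space D \<and> f \<in> borel_measurable borel \<and> D = density lborel (\<lambda>x. ennreal (f x)) \<and>
     is_interval J \<and> J \<subseteq> {0..} \<and> (\<forall>x\<in>J. 0 < f x) \<and> (\<forall>x. x \<notin> J \<longrightarrow> f x = 0)"

definition virtual_value :: "real measure \<Rightarrow> (real \<Rightarrow> real) \<Rightarrow> real \<Rightarrow> real" where
  "virtual_value D f x = x - (1 - cdf D x) / f x"

text \<open>
  A density is determined only up to null sets; regularity asks for some version whose virtual
  value is non-decreasing on the interval where it is positive.
\<close>

definition regular_dist :: "real measure \<Rightarrow> bool" where
  "regular_dist D \<longleftrightarrow> (\<exists>f J. has_interval_density D f J \<and> mono_on J (virtual_value D f))"


section \<open>Distributions over valuations\<close>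

definition valuation_space :: "nat \<Rightarrow> valuation measure" where
  "valuation_space m = (\<Pi>\<^sub>M S\<in>Pow {..<m}. borel)"

definition additive_val :: "nat \<Rightarrow> (nat \<Rightarrow> real) \<Rightarrow> valuation" where
  "additive_val m t = (\<lambda>S\<in>Pow {..<m}. \<Sum>j\<in>S. t j)"

definition downward_closed :: "nat \<Rightarrow> nat set set \<Rightarrow> bool" where
  "downward_closed m I \<longleftrightarrow> I \<subseteq> Pow {..<m} \<and> (\<forall>S\<in>I. \<forall>T. T \<subseteq> S \<longrightarrow> T \<in> I)"

definition constrained_val :: "nat \<Rightarrow> nat set set \<Rightarrow> (nat \<Rightarrow> real) \<Rightarrow> valuation" where
  "constrained_val m I t = (\<lambda>S\<in>Pow {..<m}. Max ((\<lambda>T. \<Sum>j\<in>T. t j) ` {T. T \<subseteq> S \<and> T \<in> I}))"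

definition additive_dists :: "nat \<Rightarrow> valuation measure set" where
  "additive_dists m =
     {distr (\<Pi>\<^sub>M j\<in>{..<m}. D j) (valuation_space m) (additive_val m) | D.
        \<forall>j<m. regular_dist (D j)}"

text \<open>
  There are finitely many set systems on \<open>{..<m}\<close>, so a distribution over them is a \<open>pmf\<close>.
  The class below is the one in which every set system in the support contains all singletons.
\<close>

definition constrained_dists :: "nat \<Rightarrow> valuation measure set" where
  "constrained_dists m =
     {distr ((\<Pi>\<^sub>M j\<in>{..<m}. D j) \<Otimes>\<^sub>M measure_pmf C) (valuation_space m)
        (\<lambda>(t, I). constrained_val m I t) | D C.
        (\<forall>j<m. regular_dist (D j)) \<and>
        (\<forall>I\<in>set_pmf C. downward_closed m I \<and> (\<forall>j<m. {j} \<in> I))}"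

text \<open>The topological support of \<open>F\<close>, written with balls of the maximum metric.\<close>

definition valuation_support :: "nat \<Rightarrow> valuation measure \<Rightarrow> valuation set" where
  "valuation_support m F =
     {v \<in> space F. \<forall>e>0. 0 < measure F {w \<in> space F. \<forall>S\<in>Pow {..<m}. \<bar>w S - v S\<bar> < e}}"


section \<open>Mechanisms\<close>

definition allocations :: "nat \<Rightarrow> nat \<Rightarrow> allocation set" where
  "allocations m n = {A \<in> {..<n} \<rightarrow>\<^sub>E Pow {..<m}. disjoint_family_on A {..<n}}"

definition matchings :: "nat \<Rightarrow> nat \<Rightarrow> allocation set" where
  "matchings m n = {A \<in> allocations m n. \<forall>i<n. card (A i) \<le> 1}"

definition outcome_space :: "nat \<Rightarrow> nat \<Rightarrow> (allocation \<times> payments) measure" where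
  "outcome_space m n = count_space (allocations m n) \<Otimes>\<^sub>M (\<Pi>\<^sub>M i\<in>{..<n}. borel)"

definition is_mechanism :: "nat \<Rightarrow> nat \<Rightarrow> mechanism \<Rightarrow> bool" where
  "is_mechanism m n M \<longleftrightarrow>
     M \<in> (\<Pi>\<^sub>M i\<in>{..<n}. valuation_space m) \<rightarrow>\<^sub>M prob_algebra (outcome_space m n)"

text \<open>Outcome distribution when bidder \<open>i\<close> bids \<open>b\<close> and all other bidders bid truthfully.\<close>

definition interim_outcome ::
    "nat \<Rightarrow> mechanism \<Rightarrow> valuation measure \<Rightarrow> nat \<Rightarrow> valuation \<Rightarrow> (allocation \<times> payments) measure" where
  "interim_outcome n M F i b = (\<Pi>\<^sub>M k\<in>{..<n} - {i}. F) \<bind> (\<lambda>w. M (w(i := b)))"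

definition truthful_outcome ::
    "nat \<Rightarrow> mechanism \<Rightarrow> valuation measure \<Rightarrow> (allocation \<times> payments) measure" where
  "truthful_outcome n M F = (\<Pi>\<^sub>M i\<in>{..<n}. F) \<bind> M"

definition interim_utility ::
    "nat \<Rightarrow> mechanism \<Rightarrow> valuation measure \<Rightarrow> nat \<Rightarrow> valuation \<Rightarrow> valuation \<Rightarrow> real" where
  "interim_utility n M F i v b = (\<integral>(A, p). v (A i) - p i \<partial>interim_outcome n M F i b)"

text \<open>
  All expectations have to exist. The second condition makes the expected payment of each bidder
  well-defined in \<open>(-\<infinity>, \<infinity>]\<close>. It cannot be dropped, nor be imposed on the sum of the payments
  only: when \<open>2 \<le> n\<close>, there are functions \<open>q\<close> of two independent types whose integral over the
  second type is always \<open>0\<close> and over the first type always \<open>r > 0\<close>; selling nothing for payments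
  \<open>q\<close> and \<open>r - q\<close> is then BIC and BIR although the payments always add up to \<open>r\<close>.
\<close>

definition expectations_exist :: "nat \<Rightarrow> nat \<Rightarrow> mechanism \<Rightarrow> valuation measure \<Rightarrow> bool" where
  "expectations_exist m n M F \<longleftrightarrow>
     (\<forall>i<n. \<forall>b\<in>space (valuation_space m).
        integrable (interim_outcome n M F i b) (\<lambda>(A, p). p i)) \<and>
     (\<forall>i<n. (\<integral>\<^sup>+(A, p). ennreal (- p i) \<partial>truthful_outcome n M F) < \<infinity>)"

text \<open>Types range over the support of \<open>F\<close>, bids over all valuations.\<close>

definition BIC :: "nat \<Rightarrow> nat \<Rightarrow> mechanism \<Rightarrow> valuation measure \<Rightarrow> bool" where
  "BIC m n M F \<longleftrightarrow>
     (\<forall>i<n. \<forall>v\<in>valuation_support m F. \<forall>b\<in>space (valuation_space m).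
        interim_utility n M F i v b \<le> interim_utility n M F i v v)"

definition BIR :: "nat \<Rightarrow> nat \<Rightarrow> mechanism \<Rightarrow> valuation measure \<Rightarrow> bool" where
  "BIR m n M F \<longleftrightarrow>
     (\<forall>i<n. \<forall>v\<in>valuation_support m F. 0 \<le> interim_utility n M F i v v)"

text \<open>
  Regular distributions may have infinite mean, so revenue is extended-real valued. The difference
  is well-defined under \<^const>\<open>expectations_exist\<close>, and whenever payments are non-negative.
\<close>

definition revenue :: "nat \<Rightarrow> mechanism \<Rightarrow> valuation measure \<Rightarrow> ereal" where
  "revenue n M F =
     (\<Sum>i<n. enn2ereal (\<integral>\<^sup>+(A, p). ennreal (p i) \<partial>truthful_outcome n M F)
            - enn2ereal (\<integral>\<^sup>+(A, p). ennreal (- p i) \<partial>truthful_outcome n M F))"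

definition opt_revenue :: "nat \<Rightarrow> nat \<Rightarrow> valuation measure \<Rightarrow> ereal" where
  "opt_revenue m n F =
     (SUP M\<in>{M. is_mechanism m n M \<and> expectations_exist m n M F \<and> BIC m n M F \<and> BIR m n M F}.
        revenue n M F)"


section \<open>VCG and its restriction to matchings\<close>

definition welfare :: "nat set \<Rightarrow> (nat \<Rightarrow> valuation) \<Rightarrow> allocation \<Rightarrow> real" where
  "welfare B w A = (\<Sum>i\<in>B. w i (A i))"

definition vcg_allocation :: "allocation set \<Rightarrow> nat \<Rightarrow> (nat \<Rightarrow> valuation) \<Rightarrow> allocation" where
  "vcg_allocation R n w = arg_max_on (welfare {..<n} w) R"

definition vcg_payments :: "allocation set \<Rightarrow> nat \<Rightarrow> (nat \<Rightarrow> valuation) \<Rightarrow> payments" where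
  "vcg_payments R n w =
     (\<lambda>i\<in>{..<n}. Max (welfare ({..<n} - {i}) w ` {A \<in> R. A i = {}})
                - welfare ({..<n} - {i}) w (vcg_allocation R n w))"

definition vcg_in_range :: "(nat \<Rightarrow> nat \<Rightarrow> allocation set) \<Rightarrow> nat \<Rightarrow> nat \<Rightarrow> mechanism" where
  "vcg_in_range R m n w =
     return (outcome_space m n) (vcg_allocation (R m n) n w, vcg_payments (R m n) n w)"

definition VCG :: "nat \<Rightarrow> nat \<Rightarrow> mechanism" where
  "VCG = vcg_in_range allocations"

definition VCG_UD :: "nat \<Rightarrow> nat \<Rightarrow> mechanism" where
  "VCG_UD = vcg_in_range matchings"


section \<open>Competition complexity\<close>

text \<open>
  For \<open>enat\<close>, the infimum of a non-empty set is its least element and \<open>Inf {} = \<infinity>\<close>, which is the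
  value when no number of additional bidders suffices.
\<close>

definition competition_complexity ::
    "(nat \<Rightarrow> nat \<Rightarrow> mechanism) \<Rightarrow> nat \<Rightarrow> nat \<Rightarrow> valuation measure set \<Rightarrow> enat" where
  "competition_complexity M m n \<D> =
     Inf (enat ` {c. \<forall>F\<in>\<D>. opt_revenue m n F \<le> revenue (n + c) (M m (n + c)) F})"

end

(*
  Let F be the distribution of a constrained bidder and F+ that of the additive bidder with the same
  item distributions.

  A mechanism for F also serves bidders from F+: the seller draws a constraint for every bidder, runs
  the mechanism on the constrained bids and hands over only the favourite feasible part of each
  bundle. Hence the optimal revenue for F is at most the one for F+.

  For F+, VCG with k bidders sells every item at its second-highest value. With k + m - 1 bidders,
  fix an optimal matching of the items other than j. It leaves at least k bidders free, and who they
  are is independent of the values for j. Adding item j to the market matches at most one of them,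
  so the price of j in VCG on matchings is at least the second-highest value among them, which in
  expectation is at least the second-highest value of k fresh bidders.
*)

theory Submission
  imports Defs
begin


section \<open>Welfare-maximizing outcomes\<close>

text \<open>The m - 1 extra bidders make up for those that are not free: matching the other m - 1
  items occupies at most m - 1 bidders. Given the values for those items the free set is fixed, and
  the values for j remain i.i.d. The price bound needs a matching that keeps j with its winner, is
  at least as good as the chosen one and leaves one of any two free bidders unmatched; an exchange
  along an alternating path provides it. On matchings, only the values of the empty bundle and of
  singletons matter, and feasible singletons make these agree almost surely with the additive
  values. Means may be infinite, so revenues are compared through nonnegative integrals, pointwise
  inequalities and equality of laws.

  For the reduction, the obstacle is that BIC and BIR constrain a mechanism only at types in the
  topological support. So every constrained version of an additive support point must be shown to
  lie in the support, and additive support points must be shown to be additive. Only the favourite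
  part of a bundle is handed over because an additive bidder could value the whole bundle more than
  the constrained type in whose name it was allocated, which could make lies attractive.\<close>

lemma arg_max_on_finite:
  fixes f :: "'a \<Rightarrow> 'b::linorder"
  assumes "finite S" "S \<noteq> {}"
  shows arg_max_on_in: "arg_max_on f S \<in> S"
    and arg_max_on_ge: "y \<in> S \<Longrightarrow> f y \<le> f (arg_max_on f S)"
proof -
  obtain x where "x \<in> S" "f x = Max (f ` S)"
    using assms by (metis (no_types, lifting) Max_in finite_imageI imageE image_is_empty)
  then have "is_arg_max f (\<lambda>x. x \<in> S) x"
    using assms by (auto simp: is_arg_max_linorder)
  then have "is_arg_max f (\<lambda>x. x \<in> S) (arg_max_on f S)"
    unfolding arg_max_on_def arg_max_def by (rule someI)
  then show "arg_max_on f S \<in> S" "y \<in> S \<Longrightarrow> f y \<le> f (arg_max_on f S)"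
    by (auto simp: is_arg_max_linorder)
qed

text \<open>The choice is made from the same set of maximizers, so ties are broken alike. This makes
  the chosen matching without item j, not just its welfare, a function of the values for the other
  items.\<close>

lemma arg_max_on_cong: "(\<And>x. x \<in> S \<Longrightarrow> f x = g x) \<Longrightarrow> arg_max_on f S = arg_max_on g S"
  unfolding arg_max_on_def arg_max_def is_arg_max_def by (metis (mono_tags, lifting))

lemma finite_allocations [simp]: "finite (allocations m n)"
  unfolding allocations_def
  by (rule finite_subset[of _ "{..<n} \<rightarrow>\<^sub>E Pow {..<m}"]) (auto intro: finite_PiE)

lemma matchings_subset: "matchings m n \<subseteq> allocations m n"
  unfolding matchings_def by auto

lemma finite_matchings [simp]: "finite (matchings m n)"
  using finite_subset[OF matchings_subset] by simp

definition no_allocation :: "nat \<Rightarrow> allocation" where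
  "no_allocation n = (\<lambda>i\<in>{..<n}. {})"

lemma no_allocation_matchings: "no_allocation n \<in> matchings m n"
  unfolding matchings_def allocations_def no_allocation_def disjoint_family_on_def by auto

lemma no_allocation_allocations: "no_allocation n \<in> allocations m n"
  using no_allocation_matchings matchings_subset by blast

lemma allocationsD:
  assumes "A \<in> allocations m n"
  shows "i < n \<Longrightarrow> A i \<subseteq> {..<m}" "i < n \<Longrightarrow> finite (A i)"
    "i < n \<Longrightarrow> l < n \<Longrightarrow> x \<in> A i \<Longrightarrow> x \<in> A l \<Longrightarrow> i = l" "\<not> i < n \<Longrightarrow> A i = undefined"
proof -
  show "i < n \<Longrightarrow> A i \<subseteq> {..<m}" "\<not> i < n \<Longrightarrow> A i = undefined"
    using assms unfolding allocations_def by (auto simp: PiE_def extensional_def)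
  then show "i < n \<Longrightarrow> finite (A i)" using finite_subset by blast
  show "i < n \<Longrightarrow> l < n \<Longrightarrow> x \<in> A i \<Longrightarrow> x \<in> A l \<Longrightarrow> i = l"
    using assms unfolding allocations_def disjoint_family_on_def by blast
qed

lemma allocations_disjoint:
  "A \<in> allocations m n \<Longrightarrow> i < n \<Longrightarrow> l < n \<Longrightarrow> i \<noteq> l \<Longrightarrow> A i \<inter> A l = {}"
  using allocationsD(3) by blast

lemma matchings_eqI:
  assumes "A \<in> matchings m n" "i < n" "x \<in> A i" "y \<in> A i"
  shows "x = y"
  using assms allocationsD(2)[of A m n i] unfolding matchings_def
  by (auto simp: card_le_Suc0_iff_eq)

lemma matchingsI:
  assumes "\<And>i. i < n \<Longrightarrow> A i \<subseteq> {..<m}"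
    and "\<And>i l x. i < n \<Longrightarrow> l < n \<Longrightarrow> x \<in> A i \<Longrightarrow> x \<in> A l \<Longrightarrow> i = l"
    and "\<And>i. \<not> i < n \<Longrightarrow> A i = undefined"
    and "\<And>i x y. i < n \<Longrightarrow> x \<in> A i \<Longrightarrow> y \<in> A i \<Longrightarrow> x = y"
  shows "A \<in> matchings m n"
proof -
  have "finite (A i)" if "i < n" for i
    using assms(1)[OF that] finite_subset by blast
  then show ?thesis
    unfolding matchings_def allocations_def disjoint_family_on_def PiE_def extensional_def
    using assms by (auto simp: card_le_Suc0_iff_eq)
qed

lemma allocationsI:
  assumes "\<And>i. i < n \<Longrightarrow> A i \<subseteq> {..<m}"
    and "\<And>i l x. i < n \<Longrightarrow> l < n \<Longrightarrow> x \<in> A i \<Longrightarrow> x \<in> A l \<Longrightarrow> i = l"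
    and "\<And>i. \<not> i < n \<Longrightarrow> A i = undefined"
  shows "A \<in> allocations m n"
  using assms unfolding allocations_def disjoint_family_on_def PiE_def extensional_def by auto

text \<open>Additive welfare of a value matrix \<open>T\<close>, bidders by items. On matchings it
  is also the welfare of every valuation profile with these singleton values that is 0 on the empty
  bundle.\<close>

definition item_welfare :: "nat set \<Rightarrow> (nat \<Rightarrow> nat \<Rightarrow> real) \<Rightarrow> allocation \<Rightarrow> real" where
  "item_welfare B T A = (\<Sum>i\<in>B. \<Sum>j\<in>A i. T i j)"

lemma item_welfare_remove:
  "i < n \<Longrightarrow> item_welfare {..<n} T A = (\<Sum>j\<in>A i. T i j) + item_welfare ({..<n} - {i}) T A"
  unfolding item_welfare_def by (subst sum.remove[of _ i]) auto

lemma vcg_payments_eq: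
  "i < n \<Longrightarrow> vcg_payments R n w i =
    Max (welfare ({..<n} - {i}) w ` {A \<in> R. A i = {}})
      - welfare ({..<n} - {i}) w (vcg_allocation R n w)"
  by (simp add: vcg_payments_def)

lemma vcg_allocation_in: "finite R \<Longrightarrow> R \<noteq> {} \<Longrightarrow> vcg_allocation R n w \<in> R"
  unfolding vcg_allocation_def by (rule arg_max_on_in)

lemma vcg_allocation_ge:
  "finite R \<Longrightarrow> B \<in> R \<Longrightarrow> welfare {..<n} w B \<le> welfare {..<n} w (vcg_allocation R n w)"
  unfolding vcg_allocation_def by (rule arg_max_on_ge[where f = "welfare {..<n} w"]) auto


section \<open>Second-highest values\<close>

text \<open>The supremum of the minima of two distinct entries is the second-largest entry, counted
  with multiplicity and cut off at 0; it is 0 for fewer than two bidders. In this form an upper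
  bound is checked on pairs and a lower bound needs just one pair.\<close>

definition second_highest :: "'i set \<Rightarrow> ('i \<Rightarrow> real) \<Rightarrow> ennreal" where
  "second_highest I y = (SUP a\<in>I. SUP b\<in>I - {a}. ennreal (min (y a) (y b)))"

lemma second_highest_le:
  assumes "\<And>a b. a \<in> I \<Longrightarrow> b \<in> I \<Longrightarrow> a \<noteq> b \<Longrightarrow> ennreal (min (y a) (y b)) \<le> c"
  shows "second_highest I y \<le> c"
  unfolding second_highest_def using assms by (intro SUP_least) auto

lemma second_highest_ge:
  assumes "a \<in> I" "b \<in> I" "a \<noteq> b"
  shows "ennreal (min (y a) (y b)) \<le> second_highest I y"
  unfolding second_highest_def by (intro SUP_upper2[of a] SUP_upper2[of b]) (use assms in auto)

lemma second_highest_reindex_le: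
  assumes "inj_on h I" "h ` I \<subseteq> I'"
  shows "second_highest I (\<lambda>i. y (h i)) \<le> second_highest I' y"
  by (rule second_highest_le, rule second_highest_ge) (use assms in \<open>auto dest: inj_onD\<close>)

lemma second_highest_cong:
  "(\<And>i. i \<in> I \<Longrightarrow> x i = y i) \<Longrightarrow> second_highest I x = second_highest I y"
  unfolding second_highest_def by (intro SUP_cong refl) auto

lemma measurable_second_highest [measurable]:
  assumes "finite I" "\<And>i. i \<in> I \<Longrightarrow> (\<lambda>w. y w i) \<in> borel_measurable M"
  shows "(\<lambda>w. second_highest I (y w)) \<in> borel_measurable M"
  unfolding second_highest_def using assms
  by (intro borel_measurable_SUP countable_finite measurable_compose[OF _ measurable_ennreal] borel_measurable_min) auto


section \<open>Additive bidders\<close>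

text \<open>An optimal allocation gives every held item to a bidder with the highest value for it.
  Without bidder i, the others gain nothing on the items that she does not hold; an item that she
  holds brings them at most its highest value among them, which is its second-highest value overall.
  The argument works for any way of breaking ties.\<close>

lemma vcg_payment_additive_le:
  fixes w :: "nat \<Rightarrow> valuation"
  assumes w: "\<And>i S. i < k \<Longrightarrow> S \<subseteq> {..<m} \<Longrightarrow> w i S = (\<Sum>j\<in>S. T i j)"
    and nonneg: "\<And>i j. i < k \<Longrightarrow> j < m \<Longrightarrow> 0 \<le> T i j"
    and i: "i < k"
  shows "ennreal (vcg_payments (allocations m k) k w i) \<le>
    (\<Sum>j\<in>vcg_allocation (allocations m k) k w i. second_highest {..<k} (\<lambda>l. T l j))"
proof -
  define A where "A = vcg_allocation (allocations m k) k w"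
  have A: "A \<in> allocations m k"
    unfolding A_def using no_allocation_allocations by (intro vcg_allocation_in) auto
  have wel: "welfare B w A' = item_welfare B T A'" if "A' \<in> allocations m k" "B \<subseteq> {..<k}" for A' B
    unfolding welfare_def item_welfare_def
    using allocationsD(1)[OF that(1)] that(2) w by (intro sum.cong) auto
  have opt: "item_welfare {..<k} T A' \<le> item_welfare {..<k} T A" if "A' \<in> allocations m k" for A'
    using vcg_allocation_ge[of "allocations m k" A' k w] that A by (simp add: A_def wel)
  \<comment> \<open>Handing the unsold item j to l changes the welfare by exactly
    \<open>T l j\<close>, so optimality of \<open>A\<close> forces the sign.\<close>
  have unheld: "T l j \<le> 0" if l: "l < k" "j < m" "\<And>i. i < k \<Longrightarrow> j \<notin> A i" for l j
  proof -
    define A' where "A' = A(l := insert j (A l))"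
    have A': "A' \<in> allocations m k"
    proof (rule allocationsI)
      show "A' i \<subseteq> {..<m}" if "i < k" for i
        using l allocationsD(1)[OF A that] unfolding A'_def by auto
      show "i = i'" if "i < k" "i' < k" "x \<in> A' i" "x \<in> A' i'" for i i' x
        using that l(3) allocationsD(3)[OF A that(1,2), of x] unfolding A'_def by (auto split: if_splits)
      show "A' i = undefined" if "\<not> i < k" for i
        using that l allocationsD(4)[OF A that] unfolding A'_def by auto
    qed
    have "item_welfare {..<k} T A' = item_welfare {..<k} T A + T l j"
      using l allocationsD(2)[OF A]
      by (simp add: item_welfare_remove[of l] A'_def) (simp add: item_welfare_def)
    then show ?thesis using opt[OF A'] by simp
  qed
  have held: "T l' j \<le> T l j" if l: "l < k" "l' < k" "j \<in> A l" for l l' j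
  proof (cases "l = l'")
    case False
    define A' where "A' = A(l := A l - {j}, l' := insert j (A l'))"
    have "j < m" using allocationsD(1)[OF A] l by auto
    have mem: "x \<in> A' i \<longleftrightarrow> (if x = j then i = l' else x \<in> A i)" if "i < k" for x i
    proof (cases "i = l")
      case False
      then have "j \<notin> A i" using allocationsD(3)[OF A l(1) that l(3)] by auto
      then show ?thesis using False unfolding A'_def by auto
    qed (use \<open>l \<noteq> l'\<close> in \<open>auto simp: A'_def\<close>)
    have A': "A' \<in> allocations m k"
    proof (rule allocationsI)
      show "A' i \<subseteq> {..<m}" if "i < k" for i
        using mem that \<open>j < m\<close> allocationsD(1)[OF A that] by (auto split: if_splits)
      show "i = i'" if "i < k" "i' < k" "x \<in> A' i" "x \<in> A' i'" for i i' x
        using that(3,4) allocationsD(3)[OF A that(1,2), of x]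
        unfolding mem[OF that(1)] mem[OF that(2)] by (cases "x = j") auto
      show "A' i = undefined" if "\<not> i < k" for i
        using that l allocationsD(4)[OF A that] unfolding A'_def by auto
    qed
    have "j \<notin> A l'" using allocationsD(3)[OF A, of l l' j] l False by auto
    moreover have split: "item_welfare {..<k} T X =
        (\<Sum>x\<in>X l. T l x) + (\<Sum>x\<in>X l'. T l' x) + item_welfare ({..<k} - {l, l'}) T X" for X
    proof -
      have "item_welfare ({..<k} - {l}) T X =
          (\<Sum>x\<in>X l'. T l' x) + item_welfare ({..<k} - {l} - {l'}) T X"
        unfolding item_welfare_def using l False by (intro sum.remove) auto
      moreover have "{..<k} - {l} - {l'} = {..<k} - {l, l'}" by auto
      ultimately show ?thesis using item_welfare_remove[OF l(1)] by simp
    qed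
    moreover have "item_welfare ({..<k} - {l, l'}) T A' = item_welfare ({..<k} - {l, l'}) T A"
      unfolding item_welfare_def A'_def by (intro sum.cong) auto
    ultimately have "item_welfare {..<k} T A' = item_welfare {..<k} T A + T l' j - T l j"
      using l allocationsD(2)[OF A] False sum.remove[of "A l" j "T l"]
      by (simp add: split[of A] split[of A']) (simp add: A'_def)
    then show ?thesis using opt[OF A'] by simp
  qed auto
  obtain B where B: "B \<in> allocations m k" "B i = {}"
    and Bmax: "Max (welfare ({..<k} - {i}) w ` {A \<in> allocations m k. A i = {}}) = welfare ({..<k} - {i}) w B"
  proof -
    have "welfare ({..<k} - {i}) w ` {A \<in> allocations m k. A i = {}} \<noteq> {}"
      using no_allocation_allocations[of k m] i by (auto simp: no_allocation_def)
    from Max_in[OF _ this] show ?thesis using that by auto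
  qed
  \<comment> \<open>Splits the others' welfare by items: for an allocation \<open>C\<close>,
    \<open>f C j\<close> is the value of j to its holder, and 0 when j is unsold or held by
    i.\<close>
  define f where "f = (\<lambda>A j. \<Sum>l\<in>{..<k} - {i}. if j \<in> A l then T l j else 0)"
  have f: "item_welfare ({..<k} - {i}) T C = (\<Sum>j<m. f C j)" if "C \<in> allocations m k" for C
    unfolding item_welfare_def f_def
    by (subst sum.swap) (use allocationsD(1)[OF that] in
        \<open>auto simp: sum.inter_restrict[symmetric] Int_absorb1 intro!: sum.cong\<close>)
  have f_eq: "f C j = T l j" if "C \<in> allocations m k" "j \<in> C l" "l < k" "l \<noteq> i" for C j l
  proof -
    have "j \<notin> C l'" if "l' < k" "l' \<noteq> l" for l'
      using allocations_disjoint[OF \<open>C \<in> allocations m k\<close> that(1) \<open>l < k\<close> that(2)] \<open>j \<in> C l\<close> by blast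
    then have "f C j = (\<Sum>l'\<in>{..<k} - {i}. if l' = l then T l j else 0)"
      unfolding f_def using that by (intro sum.cong) auto
    then show ?thesis using that by simp
  qed
  have f_0: "f C j = 0" if "\<And>l. l < k \<Longrightarrow> l \<noteq> i \<Longrightarrow> j \<notin> C l" for C j
    unfolding f_def using that by (intro sum.neutral) auto
  have f_A: "f A j = 0" if "j \<in> A i" for j
    using allocations_disjoint[OF A _ i] that by (intro f_0) blast
  have f_le: "f B j \<le> f A j" if j: "j < m" "j \<notin> A i" for j
  proof (cases "\<exists>l'. l' < k \<and> j \<in> A l'")
    case True
    then obtain l' where l': "l' < k" "j \<in> A l'" by auto
    then have fA: "f A j = T l' j" using f_eq[OF A, of j l'] j by auto
    show ?thesis
    proof (cases "\<exists>l. l < k \<and> l \<noteq> i \<and> j \<in> B l")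
      case True
      then obtain l where "l < k" "l \<noteq> i" "j \<in> B l" by auto
      then show ?thesis using f_eq[OF B(1), of j l] held[of l' l j] l' fA by simp
    next
      case False
      then have "f B j = 0" by (intro f_0) auto
      then show ?thesis using nonneg[of l' j] l' j fA by simp
    qed
  next
    case False
    then have fA: "f A j = 0" by (intro f_0) auto
    show ?thesis
    proof (cases "\<exists>l. l < k \<and> l \<noteq> i \<and> j \<in> B l")
      case True
      then obtain l where "l < k" "l \<noteq> i" "j \<in> B l" by auto
      then show ?thesis using f_eq[OF B(1), of j l] unheld[of l j] fA False j by simp
    next
      case False
      then have "f B j = 0" by (intro f_0) auto
      then show ?thesis using fA by simp
    qed
  qed
  have f_second: "ennreal (f B j) \<le> second_highest {..<k} (\<lambda>l. T l j)" if j: "j \<in> A i" for j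
  proof (cases "\<exists>l. l < k \<and> l \<noteq> i \<and> j \<in> B l")
    case True
    then obtain l where l: "l < k" "l \<noteq> i" "j \<in> B l" by auto
    then have "f B j = min (T i j) (T l j)"
      using f_eq[OF B(1), of j l] held[of i l j] i j by simp
    then show ?thesis using second_highest_ge[of i "{..<k}" l "\<lambda>l. T l j"] i l by simp
  next
    case False
    then have "f B j = 0" by (intro f_0) auto
    then show ?thesis by simp
  qed
  have "vcg_payments (allocations m k) k w i = (\<Sum>j<m. f B j) - (\<Sum>j<m. f A j)"
    unfolding vcg_payments_eq[OF i] Bmax A_def[symmetric]
    using f[OF A] f[OF B(1)] by (simp add: wel A B(1))
  also have "\<dots> = (\<Sum>j<m. f B j - f A j)" by (simp add: sum_subtractf)
  \<comment> \<open>Items outside \<open>A i\<close> contribute at most 0 by \<open>f_le\<close>; on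
    \<open>A i\<close> the subtracted term is 0.\<close>
  also have "\<dots> \<le> (\<Sum>j<m. if j \<in> A i then f B j else 0)"
    using f_le f_A by (intro sum_mono) auto
  also have "\<dots> = (\<Sum>j\<in>A i. f B j)"
    using allocationsD(1)[OF A i] by (simp add: sum.inter_restrict[symmetric] Int_absorb1)
  finally have "ennreal (vcg_payments (allocations m k) k w i) \<le> ennreal (\<Sum>j\<in>A i. f B j)"
    by (rule ennreal_leI)
  also have "\<dots> = (\<Sum>j\<in>A i. ennreal (f B j))"
  proof -
    have "0 \<le> f B j" if "j \<in> A i" for j
      unfolding f_def using allocationsD(1)[OF A i] that nonneg by (intro sum_nonneg) auto
    then show ?thesis by (intro sum_ennreal[symmetric])
  qed
  also have "\<dots> \<le> (\<Sum>j\<in>A i. second_highest {..<k} (\<lambda>l. T l j))"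
    using f_second by (rule sum_mono)
  finally show ?thesis by (simp add: A_def)
qed

lemma sum_allocation_le:
  fixes g :: "nat \<Rightarrow> ennreal"
  assumes "A \<in> allocations m k"
  shows "(\<Sum>i<k. \<Sum>j\<in>A i. g j) \<le> (\<Sum>j<m. g j)"
proof -
  have "(\<Sum>i<k. \<Sum>j\<in>A i. g j) = (\<Sum>j\<in>(\<Union>i<k. A i). g j)"
    using allocationsD(2)[OF assms] allocations_disjoint[OF assms] by (subst sum.UNION_disjoint) auto
  also have "\<dots> \<le> (\<Sum>j<m. g j)"
    using allocationsD(1)[OF assms] by (intro sum_mono2) auto
  finally show ?thesis .
qed

lemma sum_vcg_payments_additive_le:
  fixes w :: "nat \<Rightarrow> valuation"
  assumes "\<And>i S. i < k \<Longrightarrow> S \<subseteq> {..<m} \<Longrightarrow> w i S = (\<Sum>j\<in>S. T i j)"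
    and "\<And>i j. i < k \<Longrightarrow> j < m \<Longrightarrow> 0 \<le> T i j"
  shows "(\<Sum>i<k. ennreal (vcg_payments (allocations m k) k w i)) \<le>
    (\<Sum>j<m. second_highest {..<k} (\<lambda>l. T l j))"
proof -
  have "vcg_allocation (allocations m k) k w \<in> allocations m k"
    using no_allocation_allocations by (intro vcg_allocation_in) auto
  note sum_allocation_le[OF this]
  moreover have "(\<Sum>i<k. ennreal (vcg_payments (allocations m k) k w i)) \<le>
      (\<Sum>i<k. \<Sum>j\<in>vcg_allocation (allocations m k) k w i. second_highest {..<k} (\<lambda>l. T l j))"
    using assms by (intro sum_mono vcg_payment_additive_le) auto
  ultimately show ?thesis using order_trans by blast
qed


section \<open>Bidders competing in matchings\<close>

definition matchings_avoiding :: "nat \<Rightarrow> nat \<Rightarrow> nat \<Rightarrow> allocation set" where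
  "matchings_avoiding m n j = {A \<in> matchings m n. \<forall>i<n. j \<notin> A i}"

definition best_matching_avoiding :: "nat \<Rightarrow> nat \<Rightarrow> nat \<Rightarrow> (nat \<Rightarrow> nat \<Rightarrow> real) \<Rightarrow> allocation" where
  "best_matching_avoiding m n j T = arg_max_on (item_welfare {..<n} T) (matchings_avoiding m n j)"

definition free_bidders :: "nat \<Rightarrow> nat \<Rightarrow> nat \<Rightarrow> (nat \<Rightarrow> nat \<Rightarrow> real) \<Rightarrow> nat set" where
  "free_bidders m n j T = {i\<in>{..<n}. best_matching_avoiding m n j T i = {}}"

lemma finite_matchings_avoiding [simp]: "finite (matchings_avoiding m n j)"
  unfolding matchings_avoiding_def by simp

lemma no_allocation_matchings_avoiding: "no_allocation n \<in> matchings_avoiding m n j"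
  using no_allocation_matchings by (simp add: matchings_avoiding_def no_allocation_def)

lemma best_matching_avoiding_in: "best_matching_avoiding m n j T \<in> matchings_avoiding m n j"
  unfolding best_matching_avoiding_def
  using no_allocation_matchings_avoiding by (intro arg_max_on_in) auto

lemma best_matching_avoiding_ge:
  assumes "A \<in> matchings_avoiding m n j"
  shows "item_welfare {..<n} T A \<le> item_welfare {..<n} T (best_matching_avoiding m n j T)"
  unfolding best_matching_avoiding_def
  by (rule arg_max_on_ge[where f = "item_welfare {..<n} T"]) (use assms in auto)

text \<open>A matching that avoids j never reads column j of the matrix, so the welfare function on
  these matchings is unchanged, and with it the maximizer chosen. The independence behind the
  expected price bound rests on this.\<close>

lemma free_bidders_cong:
  assumes "\<And>i l. i < n \<Longrightarrow> l < m \<Longrightarrow> l \<noteq> j \<Longrightarrow> T i l = T' i l"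
  shows "free_bidders m n j T = free_bidders m n j T'"
proof -
  have "item_welfare {..<n} T A = item_welfare {..<n} T' A" if A: "A \<in> matchings_avoiding m n j" for A
  proof -
    have "T i l = T' i l" if "i < n" "l \<in> A i" for i l
      using assms[of i l] A that allocationsD(1)[of A m n i] matchings_subset
      unfolding matchings_avoiding_def by fastforce
    then show ?thesis unfolding item_welfare_def by (intro sum.cong) auto
  qed
  then show ?thesis
    unfolding free_bidders_def best_matching_avoiding_def by (simp cong: arg_max_on_cong)
qed

text \<open>The matched bidders hold disjoint nonempty sets of the m - 1 items other than j, so
  there are at most m - 1 of them. This is the source of the m - 1 in the theorem.\<close>

lemma card_free_bidders:
  assumes "j < m"
  shows "n - (m - 1) \<le> card (free_bidders m n j T)"
proof -
  define B where "B = best_matching_avoiding m n j T"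
  have B: "B \<in> matchings m n" "\<And>i. i < n \<Longrightarrow> j \<notin> B i"
    using best_matching_avoiding_in unfolding B_def matchings_avoiding_def by auto
  then have B': "B \<in> allocations m n" using matchings_subset by auto
  define N where "N = {i\<in>{..<n}. B i \<noteq> {}}"
  have "card N \<le> (\<Sum>i\<in>N. card (B i))"
  proof -
    have "1 \<le> card (B i)" if "i \<in> N" for i
      using that allocationsD(2)[OF B'] by (auto simp: N_def Suc_le_eq card_gt_0_iff)
    then show ?thesis using sum_mono[of N "\<lambda>_. 1" "\<lambda>i. card (B i)"] by simp
  qed
  also have "\<dots> = card (\<Union>i\<in>N. B i)"
    by (rule card_UN_disjoint[symmetric])
      (use allocationsD(2)[OF B'] allocations_disjoint[OF B'] in \<open>auto simp: N_def\<close>)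
  also have "\<dots> \<le> card ({..<m} - {j})"
    by (rule card_mono) (use allocationsD(1)[OF B'] B(2) in \<open>auto simp: N_def\<close>)
  finally have "card N \<le> m - 1" using assms by simp
  moreover have "free_bidders m n j T = {..<n} - N"
    unfolding free_bidders_def N_def B_def by auto
  moreover have "card ({..<n} - N) = n - card N"
    by (subst card_Diff_subset) (auto simp: N_def)
  ultimately show ?thesis by simp
qed

text \<open>
  Exchanging \<open>A\<close> and \<open>B\<close> on the items of the alternating path that starts at \<open>j\<close>
  augments \<open>B\<close>.
\<close>

inductive_set alternating_path :: "nat \<Rightarrow> allocation \<Rightarrow> allocation \<Rightarrow> nat \<Rightarrow> nat set"
  for n A B j where
  start: "j \<in> alternating_path n A B j"
| step: "x \<in> alternating_path n A B j \<Longrightarrow> i < n \<Longrightarrow> x \<in> A i \<Longrightarrow> y \<in> B i \<Longrightarrow> y \<in> alternating_path n A B j"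

text \<open>
  The sets of bidders matched by optimal matchings grow by at most one bidder when an item is added.
\<close>

lemma augmented_matching:
  fixes T :: "nat \<Rightarrow> nat \<Rightarrow> real"
  assumes A: "A \<in> matchings m n" and B: "B \<in> matchings_avoiding m n j"
    and B_opt: "\<And>B'. B' \<in> matchings_avoiding m n j \<Longrightarrow> item_welfare {..<n} T B' \<le> item_welfare {..<n} T B"
    and i: "i < n" "j \<in> A i"
  obtains C where "C \<in> matchings m n" "item_welfare {..<n} T A \<le> item_welfare {..<n} T C" "j \<in> C i"
    "\<And>a b. a < n \<Longrightarrow> b < n \<Longrightarrow> a \<noteq> b \<Longrightarrow> B a = {} \<Longrightarrow> B b = {} \<Longrightarrow> C a = {} \<or> C b = {}"
proof -
  define P where "P = alternating_path n A B j"
  have B': "B \<in> matchings m n" and jB: "\<And>l. l < n \<Longrightarrow> j \<notin> B l"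
    using B by (auto simp: matchings_avoiding_def)
  have AA: "A \<in> allocations m n" and BA: "B \<in> allocations m n"
    using A B' matchings_subset by auto
  have jP: "j \<in> P" unfolding P_def by (rule alternating_path.start)
  have stepP: "y \<in> P" if "x \<in> P" "l < n" "x \<in> A l" "y \<in> B l" for x y l
    using alternating_path.step[of x n A B j l y] that unfolding P_def by auto
  have pred: "\<exists>l<n. \<exists>x\<in>P. x \<in> A l \<and> y \<in> B l" if "y \<in> P" "y \<noteq> j" for y
    using that unfolding P_def by (cases rule: alternating_path.cases) auto
  have P_sub: "P \<subseteq> {..<m}"
  proof
    fix y assume "y \<in> P"
    then show "y \<in> {..<m}"
      using pred[of y] allocationsD(1)[OF AA i(1)] allocationsD(1)[OF BA] i(2) by (cases "y = j") auto
  qed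
  then have finP: "finite P" using finite_subset by blast
  \<comment> \<open>\<open>C\<close> follows \<open>A\<close> on the path and \<open>B\<close> off
    it; \<open>D\<close> does the opposite. Together they use the same bidder-item pairs as
    \<open>A\<close> and \<open>B\<close>, so the total welfare is preserved.\<close>
  define C where "C = (\<lambda>l\<in>{..<n}. (A l \<inter> P) \<union> (B l - P))"
  define D where "D = (\<lambda>l\<in>{..<n}. (B l \<inter> P) \<union> (A l - P))"
  have C: "C \<in> matchings m n"
  proof (rule matchingsI)
    fix l assume l: "l < n"
    show "C l \<subseteq> {..<m}" using l allocationsD(1)[OF AA l] allocationsD(1)[OF BA l] by (auto simp: C_def)
    show "l = l'" if "l' < n" "x \<in> C l" "x \<in> C l'" for l' x
      using that l allocationsD(3)[OF AA, of l l' x] allocationsD(3)[OF BA, of l l' x] by (auto simp: C_def)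
    show "x = y" if "x \<in> C l" "y \<in> C l" for x y
      using that l matchings_eqI[OF A l, of x y] matchings_eqI[OF B' l, of x y]
        stepP[of x l y] stepP[of y l x] by (auto simp: C_def)
  qed (simp add: C_def)
  have D': "D \<in> matchings m n"
  proof (rule matchingsI)
    fix l assume l: "l < n"
    show "D l \<subseteq> {..<m}" using l allocationsD(1)[OF AA l] allocationsD(1)[OF BA l] by (auto simp: D_def)
    show "l = l'" if "l' < n" "x \<in> D l" "x \<in> D l'" for l' x
      using that l allocationsD(3)[OF AA, of l l' x] allocationsD(3)[OF BA, of l l' x] by (auto simp: D_def)
    \<comment> \<open>A bidder cannot hold both a path item x from \<open>B\<close> and an off-path
      item y from \<open>A\<close>: since \<open>B\<close> avoids j, x is not the start, so the path
      reached x through an item that this bidder holds in \<open>A\<close>, and that item would have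
      to be y.\<close>
    have 1: False if xy: "x \<in> B l" "x \<in> P" "y \<in> A l" "y \<notin> P" for x y
    proof -
      have "x \<noteq> j" using jB[OF l] xy by auto
      then obtain l' z where z: "l' < n" "z \<in> P" "z \<in> A l'" "x \<in> B l'" using pred[OF xy(2)] by auto
      then have "l' = l" using allocationsD(3)[OF BA] xy l by blast
      then show False using matchings_eqI[OF A l, of z y] z xy by auto
    qed
    show "x = y" if "x \<in> D l" "y \<in> D l" for x y
      using that l matchings_eqI[OF A l, of x y] matchings_eqI[OF B' l, of x y] 1[of x y] 1[of y x]
      by (auto simp: D_def)
  qed (simp add: D_def)
  have D: "D \<in> matchings_avoiding m n j"
    using D' jB jP by (auto simp: matchings_avoiding_def D_def)
  have "item_welfare {..<n} T C + item_welfare {..<n} T D = item_welfare {..<n} T A + item_welfare {..<n} T B"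
  proof -
    have "(\<Sum>x\<in>C l. T l x) + (\<Sum>x\<in>D l. T l x) = (\<Sum>x\<in>A l. T l x) + (\<Sum>x\<in>B l. T l x)" if l: "l < n" for l
    proof -
      have fin: "finite (A l)" "finite (B l)" using allocationsD(2) AA BA l by auto
      have "(\<Sum>x\<in>C l. T l x) = (\<Sum>x\<in>A l \<inter> P. T l x) + (\<Sum>x\<in>B l - P. T l x)"
        using fin l by (simp add: C_def) (subst sum.union_disjoint; auto)
      moreover have "(\<Sum>x\<in>D l. T l x) = (\<Sum>x\<in>B l \<inter> P. T l x) + (\<Sum>x\<in>A l - P. T l x)"
        using fin l by (simp add: D_def) (subst sum.union_disjoint; auto)
      moreover note sum.Int_Diff[OF fin(1), of "T l" P] sum.Int_Diff[OF fin(2), of "T l" P]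
      ultimately show ?thesis by simp
    qed
    then show ?thesis by (simp add: item_welfare_def sum.distrib[symmetric])
  qed
  \<comment> \<open>\<open>D\<close> avoids j and hence is no better than \<open>B\<close>; as the
    two totals agree, \<open>C\<close> is no worse than \<open>A\<close>.\<close>
  with B_opt[OF D] have "item_welfare {..<n} T A \<le> item_welfare {..<n} T C" by simp
  moreover have "j \<in> C i" using i jP by (simp add: C_def)
  moreover have "C a = {} \<or> C b = {}" if ab: "a < n" "b < n" "a \<noteq> b" "B a = {}" "B b = {}" for a b
  proof (rule ccontr)
    assume "\<not> ?thesis"
    then obtain x y where x: "x \<in> A a" "x \<in> P" and y: "y \<in> A b" "y \<in> P"
      using ab by (auto simp: C_def)
    have "x \<noteq> y" using allocationsD(3)[OF AA] x y ab by blast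
    \<comment> \<open>\<open>g\<close> sends each path item other than j to a predecessor. It is
      injective, as items have one holder in \<open>A\<close> and bidders at most one item in
      \<open>B\<close>. It misses x and y, where the path stops because their holders in
      \<open>A\<close> get nothing in \<open>B\<close>. As x and y are distinct,
      \<open>card P - 1\<close> elements would inject into \<open>card P - 2\<close>.\<close>
    have "\<forall>z\<in>P - {j}. \<exists>l u. l < n \<and> u \<in> P \<and> u \<in> A l \<and> z \<in> B l" using pred by blast
    then obtain L g where Lg: "\<And>z. z \<in> P - {j} \<Longrightarrow> L z < n \<and> g z \<in> P \<and> g z \<in> A (L z) \<and> z \<in> B (L z)"
      by metis
    have "inj_on g (P - {j})"
    proof (rule inj_onI)
      fix z z' assume z: "z \<in> P - {j}" "z' \<in> P - {j}" "g z = g z'"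
      then have "L z = L z'" using Lg[OF z(1)] Lg[OF z(2)] allocationsD(3)[OF AA] by metis
      then show "z = z'" using Lg[OF z(1)] Lg[OF z(2)] matchings_eqI[OF B'] by metis
    qed
    moreover have "g ` (P - {j}) \<subseteq> P - {x, y}"
    proof (rule image_subsetI)
      fix z assume z: "z \<in> P - {j}"
      note Lz = Lg[OF z]
      then have "L z \<noteq> a" "L z \<noteq> b" using ab by auto
      then have "g z \<noteq> x" "g z \<noteq> y"
        using Lz x(1) y(1) allocations_disjoint[OF AA, of "L z"] ab(1,2) by blast+
      then show "g z \<in> P - {x, y}" using Lz by blast
    qed
    ultimately have "card (P - {j}) \<le> card (P - {x, y})"
      using finP by (intro card_inj_on_le) auto
    moreover have "card (P - {x, y}) = card P - 2"
      using x y \<open>x \<noteq> y\<close> finP by (subst card_Diff_subset) auto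
    \<comment> \<open>Rules out truncation in the natural number \<open>card P - 2\<close>.\<close>
    moreover have "2 \<le> card P"
      using card_mono[OF finP, of "{x, y}"] x y \<open>x \<noteq> y\<close> by auto
    ultimately show False using jP finP by simp
  qed
  ultimately show ?thesis using that C by blast
qed

section \<open>Payments of VCG on matchings\<close>

lemma vcg_payment_matchings_nonneg:
  assumes w: "\<And>i. i < n \<Longrightarrow> w i {} = 0" and i: "i < n"
  shows "0 \<le> vcg_payments (matchings m n) n w i"
proof -
  define A where "A = vcg_allocation (matchings m n) n w"
  have A: "A \<in> matchings m n"
    unfolding A_def using no_allocation_matchings by (intro vcg_allocation_in) auto
  have AA: "A \<in> allocations m n" using A matchings_subset by auto
  \<comment> \<open>Emptying the bundle of i leaves a matching with the same welfare for the others,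
    so their maximum without i is at least that.\<close>
  have "A(i := {}) \<in> matchings m n"
  proof (rule matchingsI)
    fix l assume l: "l < n"
    show "(A(i := {})) l \<subseteq> {..<m}" using allocationsD(1)[OF AA l] by auto
    show "l = l'" if "l' < n" "x \<in> (A(i := {})) l" "x \<in> (A(i := {})) l'" for l' x
      using that l allocationsD(3)[OF AA, of l l' x] by (auto split: if_splits)
    show "x = y" if "x \<in> (A(i := {})) l" "y \<in> (A(i := {})) l" for x y
      using that matchings_eqI[OF A l, of x y] by (auto split: if_splits)
  qed (use i allocationsD(4)[OF AA] in auto)
  then have "welfare ({..<n} - {i}) w (A(i := {})) \<le>
      Max (welfare ({..<n} - {i}) w ` {A \<in> matchings m n. A i = {}})"
    by (intro Max_ge) auto
  moreover have "welfare ({..<n} - {i}) w (A(i := {})) = welfare ({..<n} - {i}) w A"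
    unfolding welfare_def by (intro sum.cong) auto
  ultimately show ?thesis using i by (simp add: vcg_payments_eq A_def)
qed

text \<open>If j stays unsold, the best matching without j is optimal among all matchings, so no
  free bidder has a positive value for j. Otherwise let i win j. A bidder a that the augmented
  matching leaves empty-handed could take j in place of i, so the payment of i is at least the value
  of a for j; of two free bidders, at least one is such an a. The sum over all winners of j treats
  both cases at once, as there is at most one winner.\<close>

lemma second_highest_le_vcg_payments_matchings:
  assumes w0: "\<And>i. i < n \<Longrightarrow> w i {} = 0"
    and w1: "\<And>i j. i < n \<Longrightarrow> j < m \<Longrightarrow> w i {j} = T i j"
    and j: "j < m"
  shows "second_highest (free_bidders m n j T) (\<lambda>i. T i j) \<le>
    (\<Sum>i | i < n \<and> j \<in> vcg_allocation (matchings m n) n w i. ennreal (vcg_payments (matchings m n) n w i))"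
proof -
  define A where "A = vcg_allocation (matchings m n) n w"
  have A: "A \<in> matchings m n"
    unfolding A_def using no_allocation_matchings by (intro vcg_allocation_in) auto
  have AA: "A \<in> allocations m n" using A matchings_subset by auto
  define B where "B = best_matching_avoiding m n j T"
  have B: "B \<in> matchings_avoiding m n j" unfolding B_def by (rule best_matching_avoiding_in)
  then have BA: "B \<in> allocations m n" and B': "B \<in> matchings m n"
    using matchings_subset by (auto simp: matchings_avoiding_def)
  have B_opt: "item_welfare {..<n} T B' \<le> item_welfare {..<n} T B"
    if "B' \<in> matchings_avoiding m n j" for B'
    using best_matching_avoiding_ge[OF that] by (simp add: B_def)
  have wel: "welfare N w A' = item_welfare N T A'" if "A' \<in> matchings m n" "N \<subseteq> {..<n}" for A' N
  proof -
    have "w i (A' i) = (\<Sum>j\<in>A' i. T i j)" if i: "i < n" for i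
    proof (cases "A' i = {}")
      case False
      then obtain x where "A' i = {x}"
        using matchings_eqI[OF \<open>A' \<in> matchings m n\<close> i] by blast
      moreover have "A' i \<subseteq> {..<m}"
        using allocationsD(1)[of A' m n i] matchings_subset \<open>A' \<in> matchings m n\<close> i by auto
      ultimately show ?thesis using w1[OF i] by simp
    qed (simp add: w0 i)
    then show ?thesis unfolding welfare_def item_welfare_def using that(2) by (intro sum.cong) auto
  qed
  have opt: "item_welfare {..<n} T A' \<le> item_welfare {..<n} T A" if "A' \<in> matchings m n" for A'
    using vcg_allocation_ge[of "matchings m n" A' n w] that A by (simp add: A_def wel)
  show ?thesis
  proof (cases "\<exists>i<n. j \<in> A i")
    case False
    then have "A \<in> matchings_avoiding m n j" using A by (auto simp: matchings_avoiding_def)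
    note AB = B_opt[OF this]
    have "T l j \<le> 0" if l: "l < n" "B l = {}" for l
    proof -
      have "B(l := {j}) \<in> matchings m n"
      proof (rule matchingsI)
        fix i assume i: "i < n"
        have "j \<notin> B i" using B i by (simp add: matchings_avoiding_def)
        show "(B(l := {j})) i \<subseteq> {..<m}" using j allocationsD(1)[OF BA i] by auto
        show "i = i'" if "i' < n" "x \<in> (B(l := {j})) i" "x \<in> (B(l := {j})) i'" for i' x
          using that i B allocationsD(3)[OF BA, of i i' x]
          by (auto simp: matchings_avoiding_def split: if_splits)
        show "x = y" if "x \<in> (B(l := {j})) i" "y \<in> (B(l := {j})) i" for x y
          using that matchings_eqI[OF B' i, of x y] by (auto split: if_splits)
      qed (use l allocationsD(4)[OF BA] in auto)
      from opt[OF this] AB have "item_welfare {..<n} T (B(l := {j})) \<le> item_welfare {..<n} T B" by simp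
      moreover have "item_welfare {..<n} T (B(l := {j})) = item_welfare {..<n} T B + T l j"
        using l by (simp add: item_welfare_remove[of l]) (simp add: item_welfare_def)
      ultimately show ?thesis by simp
    qed
    then have "second_highest (free_bidders m n j T) (\<lambda>i. T i j) \<le> 0"
      by (intro second_highest_le) (auto simp: free_bidders_def B_def[symmetric] ennreal_neg min_le_iff_disj)
    then show ?thesis by simp
  next
    case True
    then obtain i where i: "i < n" "j \<in> A i" by auto
    have Ai: "A i = {j}" using matchings_eqI[OF A i(1) i(2)] i by blast
    \<comment> \<open>It matters that i holds j in \<open>C\<close> as in \<open>A\<close>: the
      value of i cancels, so \<open>C\<close> is no worse than \<open>A\<close> for the bidders
      other than i, whose welfare determines the payment.\<close>
    obtain C where C: "C \<in> matchings m n" "item_welfare {..<n} T A \<le> item_welfare {..<n} T C" "j \<in> C i"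
      and free: "\<And>a b. a < n \<Longrightarrow> b < n \<Longrightarrow> a \<noteq> b \<Longrightarrow> B a = {} \<Longrightarrow> B b = {} \<Longrightarrow> C a = {} \<or> C b = {}"
      using augmented_matching[OF A B B_opt i] by metis
    have CA: "C \<in> allocations m n" using C matchings_subset by auto
    have Ci: "C i = {j}" using matchings_eqI[OF C(1) i(1) C(3)] C(3) by blast
    define p where "p = vcg_payments (matchings m n) n w i"
    have price: "T a j \<le> p" if a: "a < n" "C a = {}" for a
    proof -
      have "a \<noteq> i" using Ci a by auto
      define C' where "C' = C(i := {}, a := {j})"
      have mem: "x \<in> C' l \<longleftrightarrow> (if x = j then l = a else x \<in> C l)" if "l < n" for x l
      proof (cases "l = i")
        case False
        then have "j \<notin> C l" using allocations_disjoint[OF CA that i(1)] C(3) by auto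
        then show ?thesis using False a(2) by (auto simp: C'_def)
      qed (use Ci \<open>a \<noteq> i\<close> in \<open>auto simp: C'_def\<close>)
      have C': "C' \<in> matchings m n"
      proof (rule matchingsI)
        fix l assume l: "l < n"
        show "C' l \<subseteq> {..<m}" using l j allocationsD(1)[OF CA l] by (auto simp: C'_def)
        show "l = l'" if "l' < n" "x \<in> C' l" "x \<in> C' l'" for l' x
          using that(2,3) allocationsD(3)[OF CA l that(1), of x]
          unfolding mem[OF l] mem[OF that(1)] by (cases "x = j") auto
        show "x = y" if "x \<in> C' l" "y \<in> C' l" for x y
          using that matchings_eqI[OF C(1) l, of x y] by (auto simp: C'_def split: if_splits)
      next
        fix l assume "\<not> l < n"
        then show "C' l = undefined" using allocationsD(4)[OF CA] a i by (auto simp: C'_def)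
      qed
      have "welfare ({..<n} - {i}) w C' \<le> Max (welfare ({..<n} - {i}) w ` {A \<in> matchings m n. A i = {}})"
        using C' \<open>a \<noteq> i\<close> by (intro Max_ge) (auto simp: C'_def)
      then have "item_welfare ({..<n} - {i}) T C' - item_welfare ({..<n} - {i}) T A \<le> p"
        using i by (simp add: p_def vcg_payments_eq A_def[symmetric] wel C' A)
      moreover have split: "item_welfare ({..<n} - {i}) T X =
          (\<Sum>x\<in>X a. T a x) + item_welfare ({..<n} - {i} - {a}) T X" for X
        unfolding item_welfare_def using a \<open>a \<noteq> i\<close> by (intro sum.remove) auto
      moreover have "item_welfare ({..<n} - {i} - {a}) T C' = item_welfare ({..<n} - {i} - {a}) T C"
        unfolding item_welfare_def C'_def by (intro sum.cong) auto
      moreover have "C' a = {j}" by (simp add: C'_def)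
      moreover have "item_welfare ({..<n} - {i}) T C \<ge> item_welfare ({..<n} - {i}) T A"
        using C(2) item_welfare_remove[OF i(1), of T A] item_welfare_remove[OF i(1), of T C]
        by (simp add: Ai Ci)
      ultimately show ?thesis using split[of C] split[of C'] a(2) by simp
    qed
    have "second_highest (free_bidders m n j T) (\<lambda>i. T i j) \<le> ennreal p"
    proof (rule second_highest_le)
      fix a b assume "a \<in> free_bidders m n j T" "b \<in> free_bidders m n j T" "a \<noteq> b"
      then have ab: "a < n" "b < n" "a \<noteq> b" "B a = {}" "B b = {}"
        by (auto simp: free_bidders_def B_def)
      show "ennreal (min (T a j) (T b j)) \<le> ennreal p"
        using free[OF ab] price ab by (intro ennreal_leI) (auto simp: min_le_iff_disj)
    qed
    also have "{i. i < n \<and> j \<in> A i} = {i}"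
      using i allocationsD(3)[OF AA] by blast
    then have "ennreal p = (\<Sum>i | i < n \<and> j \<in> A i. ennreal (vcg_payments (matchings m n) n w i))"
      by (simp add: p_def)
    finally show ?thesis by (simp add: A_def)
  qed
qed

text \<open>In a matching a bidder holds at most one item, so each payment is counted at most once
  when the payments are summed by items.\<close>

lemma sum_second_highest_le_vcg_payments_matchings:
  assumes "\<And>i. i < n \<Longrightarrow> w i {} = 0"
    and "\<And>i j. i < n \<Longrightarrow> j < m \<Longrightarrow> w i {j} = T i j"
  shows "(\<Sum>j<m. second_highest (free_bidders m n j T) (\<lambda>i. T i j)) \<le>
    (\<Sum>i<n. ennreal (vcg_payments (matchings m n) n w i))"
proof -
  define A where "A = vcg_allocation (matchings m n) n w"
  have A: "A \<in> matchings m n"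
    unfolding A_def using no_allocation_matchings by (intro vcg_allocation_in) auto
  define p where "p = (\<lambda>i. ennreal (vcg_payments (matchings m n) n w i))"
  have "(\<Sum>j<m. second_highest (free_bidders m n j T) (\<lambda>i. T i j)) \<le>
      (\<Sum>j<m. \<Sum>i | i < n \<and> j \<in> A i. p i)"
    unfolding A_def p_def by (intro sum_mono second_highest_le_vcg_payments_matchings assms) auto
  also have "\<dots> = (\<Sum>j<m. \<Sum>i<n. if j \<in> A i then p i else 0)"
    by (intro sum.cong refl sum.mono_neutral_cong_left) auto
  also have "\<dots> = (\<Sum>i<n. \<Sum>j<m. if j \<in> A i then p i else 0)"
    by (rule sum.swap)
  also have "\<dots> \<le> (\<Sum>i<n. p i)"
  proof (rule sum_mono)
    fix i assume i: "i \<in> {..<n}"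
    have "(\<Sum>j<m. if j \<in> A i then p i else 0) = (\<Sum>j\<in>{..<m} \<inter> A i. p i)"
      by (rule sum.inter_restrict[symmetric]) simp
    also have "\<dots> \<le> p i"
    proof (cases "{..<m} \<inter> A i = {}")
      case False
      then obtain x where "{..<m} \<inter> A i = {x}"
        using matchings_eqI[OF A] i by blast
      then show ?thesis by simp
    qed simp
    finally show "(\<Sum>j<m. if j \<in> A i then p i else 0) \<le> p i" .
  qed
  finally show ?thesis by (simp add: p_def)
qed


section \<open>Products of independent samples\<close>

text \<open>The set of maximizers takes finitely many values, each on a measurable event. The choice
  from it is a function on a discrete space and so is measurable whatever it picks. The larger set
  \<open>S\<close> lets the result land in the space of all allocations.\<close>

lemma measurable_arg_max_on:
  fixes f :: "'a \<Rightarrow> 'b \<Rightarrow> real"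
  assumes R: "finite R" "R \<noteq> {}" "R \<subseteq> S" "finite S"
    and f: "\<And>x. x \<in> R \<Longrightarrow> (\<lambda>w. f w x) \<in> borel_measurable N"
  shows "(\<lambda>w. arg_max_on (f w) R) \<in> N \<rightarrow>\<^sub>M count_space S"
proof -
  define G where "G = (\<lambda>w. {x\<in>R. \<forall>y\<in>R. f w y \<le> f w x})"
  have "G \<in> N \<rightarrow>\<^sub>M count_space (Pow R)"
    unfolding measurable_count_space_eq2[OF finite_Pow_iff[THEN iffD2, OF R(1)]]
  proof (intro conjI ballI)
    fix X assume "X \<in> Pow R"
    then have "G -` {X} \<inter> space N =
        {w \<in> space N. \<forall>x\<in>R. (\<forall>y\<in>R. f w y \<le> f w x) = (x \<in> X)}"
      unfolding G_def by auto
    also have "\<dots> \<in> sets N"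
      using f R(1) by measurable
    finally show "G -` {X} \<inter> space N \<in> sets N" .
  qed (auto simp: G_def)
  then have "(\<lambda>w. SOME x. x \<in> G w) \<in> N \<rightarrow>\<^sub>M count_space UNIV"
    by (rule measurable_compose) simp
  moreover have "(SOME x. x \<in> G w) = arg_max_on (f w) R" for w
    unfolding G_def arg_max_on_def arg_max_def is_arg_max_linorder by (simp add: Ball_def)
  ultimately have "(\<lambda>w. arg_max_on (f w) R) \<in> N \<rightarrow>\<^sub>M count_space UNIV" by simp
  moreover have "arg_max_on (f w) R \<in> S" for w
    using arg_max_on_in[OF R(1,2)] R(3) by blast
  ultimately show ?thesis
    unfolding measurable_count_space_eq2[OF R(4)] by (auto intro: measurable_sets)
qed

lemma distr_PiM_const:
  assumes "finite I" "prob_space M" "prob_space M'" "f \<in> M \<rightarrow>\<^sub>M M'" "distr M M' f = M'"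
  shows "distr (\<Pi>\<^sub>M i\<in>I. M) (\<Pi>\<^sub>M i\<in>I. M') (\<lambda>x. \<lambda>i\<in>I. f (x i)) = (\<Pi>\<^sub>M i\<in>I. M')"
  using distr_PiM_finite_prob_space'[of I "\<lambda>_. M" "\<lambda>_. M'" f] assms
  by (simp add: compose_def[abs_def])

text \<open>By Fubini the two laws agree on boxes, and these determine a finite product. It serves
  to split all types into the values for one item and the rest, and to give every additive bidder a
  constraint of her own.\<close>

lemma distr_pair_PiM_zip:
  assumes "finite I" "prob_space M" "prob_space N"
    and f [measurable]: "f \<in> M \<Otimes>\<^sub>M N \<rightarrow>\<^sub>M L"
  shows "distr ((\<Pi>\<^sub>M i\<in>I. M) \<Otimes>\<^sub>M (\<Pi>\<^sub>M i\<in>I. N)) (\<Pi>\<^sub>M i\<in>I. L) (\<lambda>(x, y). \<lambda>i\<in>I. f (x i, y i)) =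
    (\<Pi>\<^sub>M i\<in>I. distr (M \<Otimes>\<^sub>M N) L f)"
proof -
  interpret M: prob_space M by fact
  interpret N: prob_space N by fact
  interpret MN: pair_prob_space M N ..
  interpret F: prob_space "distr (M \<Otimes>\<^sub>M N) L f" by (intro MN.prob_space_distr f)
  interpret PM: product_prob_space "\<lambda>_. M" I ..
  interpret PN: product_prob_space "\<lambda>_. N" I ..
  interpret PF: product_prob_space "\<lambda>_. distr (M \<Otimes>\<^sub>M N) L f" I ..
  interpret P: pair_prob_space "\<Pi>\<^sub>M i\<in>I. M" "\<Pi>\<^sub>M i\<in>I. N" ..
  show ?thesis
  proof (rule PF.PiM_eqI)
    show "finite I" by fact
    show "sets (distr ((\<Pi>\<^sub>M i\<in>I. M) \<Otimes>\<^sub>M (\<Pi>\<^sub>M i\<in>I. N)) (\<Pi>\<^sub>M i\<in>I. L) (\<lambda>(x, y). \<lambda>i\<in>I. f (x i, y i))) =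
        sets (\<Pi>\<^sub>M i\<in>I. distr (M \<Otimes>\<^sub>M N) L f)"
      by (simp cong: sets_PiM_cong)
    fix A assume "\<And>i. i \<in> I \<Longrightarrow> A i \<in> sets (distr (M \<Otimes>\<^sub>M N) L f)"
    then have A [measurable]: "\<And>i. i \<in> I \<Longrightarrow> A i \<in> sets L" by simp
    define g :: "_ \<Rightarrow> _ \<Rightarrow> ennreal" where "g i = (\<lambda>p. indicator (A i) (f p))" for i
    have g [measurable]: "g i \<in> borel_measurable (M \<Otimes>\<^sub>M N)" if "i \<in> I" for i
      unfolding g_def using A[OF that] by measurable
    have AS: "Pi\<^sub>E I A \<in> sets (\<Pi>\<^sub>M i\<in>I. L)"
      using \<open>finite I\<close> by (intro sets_PiM_I_finite A) auto
    have meas: "(\<lambda>(x, y). \<lambda>i\<in>I. f (x i, y i)) \<in> (\<Pi>\<^sub>M i\<in>I. M) \<Otimes>\<^sub>M (\<Pi>\<^sub>M i\<in>I. N) \<rightarrow>\<^sub>M (\<Pi>\<^sub>M i\<in>I. L)"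
      by measurable
    have "emeasure (distr ((\<Pi>\<^sub>M i\<in>I. M) \<Otimes>\<^sub>M (\<Pi>\<^sub>M i\<in>I. N)) (\<Pi>\<^sub>M i\<in>I. L) (\<lambda>(x, y). \<lambda>i\<in>I. f (x i, y i))) (Pi\<^sub>E I A) =
        (\<integral>\<^sup>+p. indicator (Pi\<^sub>E I A) ((\<lambda>(x, y). \<lambda>i\<in>I. f (x i, y i)) p) \<partial>((\<Pi>\<^sub>M i\<in>I. M) \<Otimes>\<^sub>M (\<Pi>\<^sub>M i\<in>I. N)))"
      using AS by (subst nn_integral_distr[OF meas, symmetric]) simp_all
    \<comment> \<open>The indicator of a box is the product of the coordinate indicators, so that
      the iterated integrals factorize one after the other.\<close>
    also have "\<dots> = (\<integral>\<^sup>+p. (\<Prod>i\<in>I. g i (fst p i, snd p i)) \<partial>((\<Pi>\<^sub>M i\<in>I. M) \<Otimes>\<^sub>M (\<Pi>\<^sub>M i\<in>I. N)))"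
    proof (rule nn_integral_cong)
      fix p
      show "indicator (Pi\<^sub>E I A) ((\<lambda>(x, y). \<lambda>i\<in>I. f (x i, y i)) p) = (\<Prod>i\<in>I. g i (fst p i, snd p i))"
      proof (cases "\<forall>i\<in>I. f (fst p i, snd p i) \<in> A i")
        case False
        then obtain i where "i \<in> I" "g i (fst p i, snd p i) = 0" by (auto simp: g_def)
        then have "(\<Prod>i\<in>I. g i (fst p i, snd p i)) = 0" using \<open>finite I\<close> by (intro prod_zero) auto
        then show ?thesis using False by (auto simp: split_beta PiE_iff)
      qed (auto simp: g_def split_beta)
    qed
    also have "\<dots> = (\<integral>\<^sup>+x. \<integral>\<^sup>+y. (\<Prod>i\<in>I. g i (x i, y i)) \<partial>(\<Pi>\<^sub>M i\<in>I. N) \<partial>(\<Pi>\<^sub>M i\<in>I. M))"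
      by (subst PN.nn_integral_fst[symmetric]) (auto intro!: borel_measurable_prod_ennreal)
    also have "\<dots> = (\<integral>\<^sup>+x. (\<Prod>i\<in>I. \<integral>\<^sup>+b. g i (x i, b) \<partial>N) \<partial>(\<Pi>\<^sub>M i\<in>I. M))"
    proof (rule nn_integral_cong)
      fix x assume x: "x \<in> space (\<Pi>\<^sub>M i\<in>I. M)"
      have "(\<lambda>b. g i (x i, b)) \<in> borel_measurable N" if "i \<in> I" for i
        using x that by (intro measurable_compose[OF measurable_Pair1' g]) (auto simp: space_PiM)
      then show "(\<integral>\<^sup>+y. (\<Prod>i\<in>I. g i (x i, y i)) \<partial>(\<Pi>\<^sub>M i\<in>I. N)) = (\<Prod>i\<in>I. \<integral>\<^sup>+b. g i (x i, b) \<partial>N)"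
        by (rule PN.product_nn_integral_prod[OF \<open>finite I\<close>, of "\<lambda>i b. g i (x i, b)"])
    qed
    also have "\<dots> = (\<Prod>i\<in>I. \<integral>\<^sup>+a. \<integral>\<^sup>+b. g i (a, b) \<partial>N \<partial>M)"
      by (rule PM.product_nn_integral_prod[OF \<open>finite I\<close>, of "\<lambda>i a. \<integral>\<^sup>+b. g i (a, b) \<partial>N"])
        (auto intro!: N.borel_measurable_nn_integral_fst)
    also have "\<dots> = (\<Prod>i\<in>I. emeasure (distr (M \<Otimes>\<^sub>M N) L f) (A i))"
    proof (rule prod.cong[OF refl])
      fix i assume i: "i \<in> I"
      have "(\<integral>\<^sup>+a. \<integral>\<^sup>+b. g i (a, b) \<partial>N \<partial>M) = (\<integral>\<^sup>+p. indicator (A i) (f p) \<partial>(M \<Otimes>\<^sub>M N))"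
        using i by (subst N.nn_integral_fst) (auto simp: g_def)
      also have "\<dots> = emeasure (distr (M \<Otimes>\<^sub>M N) L f) (A i)"
        using A[OF i] by (subst nn_integral_distr[OF f, symmetric]) simp_all
      finally show "(\<integral>\<^sup>+a. \<integral>\<^sup>+b. g i (a, b) \<partial>N \<partial>M) = emeasure (distr (M \<Otimes>\<^sub>M N) L f) (A i)" .
    qed
    finally show "emeasure (distr ((\<Pi>\<^sub>M i\<in>I. M) \<Otimes>\<^sub>M (\<Pi>\<^sub>M i\<in>I. N)) (\<Pi>\<^sub>M i\<in>I. L) (\<lambda>(x, y). \<lambda>i\<in>I. f (x i, y i))) (Pi\<^sub>E I A) =
        (\<Prod>i\<in>I. emeasure (distr (M \<Otimes>\<^sub>M N) L f) (A i))" .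
  qed
qed


section \<open>Expected revenue of VCG mechanisms\<close>

text \<open>Recovers the type from an additive valuation; for a constrained valuation it does so
  almost surely, as singletons are feasible.\<close>

definition singleton_values :: "nat \<Rightarrow> valuation \<Rightarrow> nat \<Rightarrow> real" where
  "singleton_values m v = (\<lambda>j\<in>{..<m}. v {j})"

lemma measurable_valuation_component [measurable (raw)]:
  "f \<in> N \<rightarrow>\<^sub>M valuation_space m \<Longrightarrow> S \<subseteq> {..<m} \<Longrightarrow> (\<lambda>x. f x S) \<in> borel_measurable N"
  unfolding valuation_space_def by (rule measurable_component_singleton') auto

lemma measurable_singleton_values [measurable]:
  "singleton_values m \<in> valuation_space m \<rightarrow>\<^sub>M (\<Pi>\<^sub>M j\<in>{..<m}. borel)"
  unfolding singleton_values_def by (intro measurable_restrict measurable_valuation_component) auto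

lemma measurable_welfare:
  assumes "A \<in> allocations m n" "B \<subseteq> {..<n}"
  shows "(\<lambda>w. welfare B w A) \<in> borel_measurable (\<Pi>\<^sub>M i\<in>{..<n}. valuation_space m)"
  unfolding welfare_def using assms allocationsD(1)[OF assms(1)]
  by (intro borel_measurable_sum measurable_valuation_component[of _ _ m] measurable_component_singleton) auto

lemma measurable_vcg_allocation:
  assumes "R \<subseteq> allocations m n" "R \<noteq> {}"
  shows "vcg_allocation R n \<in> (\<Pi>\<^sub>M i\<in>{..<n}. valuation_space m) \<rightarrow>\<^sub>M count_space (allocations m n)"
  unfolding vcg_allocation_def using assms finite_subset[OF assms(1)]
  by (intro measurable_arg_max_on measurable_welfare) auto

lemma measurable_vcg_payments:
  assumes R: "R \<subseteq> allocations m n" "R \<noteq> {}"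
  shows "vcg_payments R n \<in> (\<Pi>\<^sub>M i\<in>{..<n}. valuation_space m) \<rightarrow>\<^sub>M (\<Pi>\<^sub>M i\<in>{..<n}. borel)"
  unfolding vcg_payments_def
proof (intro measurable_restrict borel_measurable_diff)
  fix i
  show "(\<lambda>w. Max (welfare ({..<n} - {i}) w ` {A \<in> R. A i = {}})) \<in> borel_measurable (\<Pi>\<^sub>M i\<in>{..<n}. valuation_space m)"
    using finite_subset[OF R(1)] R(1) by (intro borel_measurable_Max measurable_welfare[of _ m n]) auto
  show "(\<lambda>w. welfare ({..<n} - {i}) w (vcg_allocation R n w)) \<in> borel_measurable (\<Pi>\<^sub>M i\<in>{..<n}. valuation_space m)"
    by (rule measurable_compose_countable'[OF measurable_welfare measurable_vcg_allocation[OF R]])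
      (auto intro: countable_finite)
qed

lemma measurable_vcg_in_range:
  assumes "R m n \<subseteq> allocations m n" "R m n \<noteq> {}"
  shows "vcg_in_range R m n \<in> (\<Pi>\<^sub>M i\<in>{..<n}. valuation_space m) \<rightarrow>\<^sub>M prob_algebra (outcome_space m n)"
  unfolding vcg_in_range_def
  by (rule measurable_compose[OF _ measurable_return_prob_space])
    (unfold outcome_space_def,
      intro measurable_Pair measurable_vcg_allocation measurable_vcg_payments assms)

text \<open>The mechanism is deterministic, so integrating over outcomes amounts to evaluating the
  payment rule at a random profile.\<close>

lemma nn_integral_truthful_outcome_vcg:
  assumes R: "R m n \<subseteq> allocations m n" "R m n \<noteq> {}"
    and F: "sets F = sets (valuation_space m)"
    and g: "g \<in> borel_measurable borel" and i: "i < n"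
  shows "(\<integral>\<^sup>+(A, p). g (p i) \<partial>truthful_outcome n (vcg_in_range R m n) F) =
    (\<integral>\<^sup>+w. g (vcg_payments (R m n) n w i) \<partial>(\<Pi>\<^sub>M i\<in>{..<n}. F))"
proof -
  have PF: "sets (\<Pi>\<^sub>M i\<in>{..<n}. F) = sets (\<Pi>\<^sub>M i\<in>{..<n}. valuation_space m)"
    using F by (intro sets_PiM_cong) auto
  have M: "vcg_in_range R m n \<in> (\<Pi>\<^sub>M i\<in>{..<n}. F) \<rightarrow>\<^sub>M subprob_algebra (outcome_space m n)"
    using measurable_prob_algebraD[OF measurable_vcg_in_range[where R = R, OF R]] measurable_cong_sets[OF PF refl] by blast
  have h [measurable]: "(\<lambda>(A, p). g (p i)) \<in> borel_measurable (outcome_space m n)"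
    unfolding outcome_space_def split_beta'
    by (intro measurable_compose[OF _ g] measurable_compose[OF measurable_snd] measurable_component_singleton)
      (use i in auto)
  have out: "(vcg_allocation (R m n) n w, vcg_payments (R m n) n w) \<in> space (outcome_space m n)"
    if "w \<in> space (\<Pi>\<^sub>M i\<in>{..<n}. F)" for w
  proof -
    have w: "w \<in> space (\<Pi>\<^sub>M i\<in>{..<n}. valuation_space m)" using that sets_eq_imp_space_eq[OF PF] by simp
    show ?thesis
      using measurable_space[OF measurable_vcg_allocation[OF R] w]
        measurable_space[OF measurable_vcg_payments[OF R] w]
      by (simp add: outcome_space_def space_pair_measure)
  qed
  show ?thesis
    unfolding truthful_outcome_def nn_integral_bind[OF h M]
    by (intro nn_integral_cong) (simp add: vcg_in_range_def nn_integral_return out)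
qed

text \<open>In \<open>ereal\<close>, subtracting a nonnegative number never increases, even when
  both numbers are infinite. So VCG revenue is bounded from above without a look at the sign of its
  payments.\<close>

lemma revenue_le:
  "revenue n M F \<le> enn2ereal (\<Sum>i<n. \<integral>\<^sup>+(A, p). ennreal (p i) \<partial>truthful_outcome n M F)"
proof -
  have "x - y \<le> x" if "0 \<le> y" for x y :: ereal
    using that by (cases x; cases y) auto
  then have "revenue n M F \<le> (\<Sum>i<n. enn2ereal (\<integral>\<^sup>+(A, p). ennreal (p i) \<partial>truthful_outcome n M F))"
    unfolding revenue_def by (intro sum_mono) auto
  then show ?thesis by simp
qed

lemma revenue_eq_nonneg:
  assumes "\<And>i. i < n \<Longrightarrow> (\<integral>\<^sup>+(A, p). ennreal (- p i) \<partial>truthful_outcome n M F) = 0"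
  shows "revenue n M F = enn2ereal (\<Sum>i<n. \<integral>\<^sup>+(A, p). ennreal (p i) \<partial>truthful_outcome n M F)"
proof -
  have "revenue n M F = (\<Sum>i<n. enn2ereal (\<integral>\<^sup>+(A, p). ennreal (p i) \<partial>truthful_outcome n M F))"
    unfolding revenue_def using assms by (intro sum.cong) (auto simp: zero_ennreal.rep_eq)
  then show ?thesis by simp
qed

lemma AE_PiM_iid:
  assumes "finite I" "prob_space F" "AE v in F. P v"
  shows "AE w in (\<Pi>\<^sub>M i\<in>I. F). \<forall>i\<in>I. P (w i)"
  using AE_PiM_component[of I "\<lambda>_. F", OF assms(2) _ assms(3)] assms(1) by (simp add: AE_finite_all)

section \<open>Item prices as the link between the two revenues\<close>

locale item_distributions =
  fixes m :: nat and D :: "nat \<Rightarrow> real measure"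
  assumes prob_space_item: "\<And>j. prob_space (D j)"
    and sets_item [simp, measurable_cong]: "\<And>j. sets (D j) = sets borel"
    and nonneg_item: "\<And>j. AE x in D j. 0 \<le> x"
begin

definition type_dist :: "(nat \<Rightarrow> real) measure" where
  "type_dist = (\<Pi>\<^sub>M j\<in>{..<m}. D j)"

lemma space_item [simp]: "space (D j) = UNIV"
  using sets_eq_imp_space_eq[OF sets_item] by simp

lemma prob_space_type_dist: "prob_space type_dist"
  unfolding type_dist_def by (intro prob_space_PiM prob_space_item)

lemma sets_type_dist [measurable_cong]: "sets type_dist = sets (\<Pi>\<^sub>M j\<in>{..<m}. borel)"
  unfolding type_dist_def by (intro sets_PiM_cong) auto

lemma measurable_singleton_values_type_dist [measurable]:
  "singleton_values m \<in> valuation_space m \<rightarrow>\<^sub>M type_dist"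
  using measurable_cong_sets[OF refl sets_type_dist] measurable_singleton_values by blast

lemma measurable_type_component: "j < m \<Longrightarrow> (\<lambda>t. t j) \<in> type_dist \<rightarrow>\<^sub>M D j"
  unfolding type_dist_def by (rule measurable_component_singleton) auto

lemma distr_type_component:
  assumes "j < m"
  shows "distr type_dist (D j) (\<lambda>t. t j) = D j"
  unfolding type_dist_def using assms by (intro distr_PiM_component prob_space_item) auto

text \<open>The expected revenue of a second-price auction of item j among k bidders, possibly
  infinite. Its sum over the items bounds VCG revenue from above and, with m - 1 bidders more, the
  revenue on matchings from below.\<close>

definition item_price :: "nat \<Rightarrow> nat \<Rightarrow> ennreal" where
  "item_price k j = (\<integral>\<^sup>+y. second_highest {..<k} y \<partial>(\<Pi>\<^sub>M i\<in>{..<k}. D j))"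

lemma measurable_second_highest_PiM:
  "finite S \<Longrightarrow> S \<subseteq> I \<Longrightarrow> second_highest S \<in> borel_measurable (\<Pi>\<^sub>M i\<in>I. D j)"
  using measurable_component_singleton[of _ I "\<lambda>_. D j"] measurable_cong_sets[OF refl sets_item]
  by (intro measurable_second_highest[of S "\<lambda>w. w"]) blast+

lemma item_price_eq_columns:
  assumes j: "j < m"
  shows "item_price k j = (\<integral>\<^sup>+T. second_highest {..<k} (\<lambda>i. T i j) \<partial>(\<Pi>\<^sub>M i\<in>{..<k}. type_dist))"
proof -
  have c: "(\<lambda>x. \<lambda>i\<in>{..<k}. x i j) \<in> (\<Pi>\<^sub>M i\<in>{..<k}. type_dist) \<rightarrow>\<^sub>M (\<Pi>\<^sub>M i\<in>{..<k}. D j)"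
    by (intro measurable_restrict measurable_compose[OF _ measurable_type_component[OF j]]
        measurable_component_singleton)
  have "item_price k j = (\<integral>\<^sup>+T. second_highest {..<k} (\<lambda>i\<in>{..<k}. T i j) \<partial>(\<Pi>\<^sub>M i\<in>{..<k}. type_dist))"
    unfolding item_price_def
    by (subst distr_PiM_const[OF _ prob_space_type_dist prob_space_item
          measurable_type_component[OF j] distr_type_component[OF j], symmetric])
      (auto simp: nn_integral_distr[OF c] measurable_second_highest_PiM)
  also have "\<dots> = (\<integral>\<^sup>+T. second_highest {..<k} (\<lambda>i. T i j) \<partial>(\<Pi>\<^sub>M i\<in>{..<k}. type_dist))"
    by (intro nn_integral_cong second_highest_cong) simp
  finally show ?thesis .
qed

lemma measurable_types:
  assumes "i < K" "l < m"
  shows "(\<lambda>T. T i l) \<in> borel_measurable (\<Pi>\<^sub>M i\<in>{..<K}. type_dist)"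
  using measurable_compose[OF measurable_component_singleton[of i "{..<K}" "\<lambda>_. type_dist"]
      measurable_type_component[OF assms(2)]] assms(1) measurable_cong_sets[OF refl sets_item] by blast

text \<open>The free set is a measurable function with finitely many values, so it suffices to fix
  it.\<close>

lemma measurable_second_highest_free_bidders:
  assumes j: "j < m"
  shows "(\<lambda>T. second_highest (free_bidders m K j T) (\<lambda>i. T i j)) \<in> borel_measurable (\<Pi>\<^sub>M i\<in>{..<K}. type_dist)"
proof -
  have best: "best_matching_avoiding m K j \<in> (\<Pi>\<^sub>M i\<in>{..<K}. type_dist) \<rightarrow>\<^sub>M count_space (allocations m K)"
    unfolding best_matching_avoiding_def item_welfare_def
  proof (rule measurable_arg_max_on)
    show "matchings_avoiding m K j \<subseteq> allocations m K"
      using matchings_subset by (auto simp: matchings_avoiding_def)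
    then show "(\<lambda>T. \<Sum>i<K. \<Sum>l\<in>A i. T i l) \<in> borel_measurable (\<Pi>\<^sub>M i\<in>{..<K}. type_dist)"
      if "A \<in> matchings_avoiding m K j" for A
      using that allocationsD(1)[of A m K] by (intro borel_measurable_sum measurable_types) auto
  qed (use no_allocation_matchings_avoiding in auto)
  have free: "free_bidders m K j \<in> (\<Pi>\<^sub>M i\<in>{..<K}. type_dist) \<rightarrow>\<^sub>M count_space (Pow {..<K})"
    unfolding free_bidders_def by (rule measurable_compose[OF best]) auto
  show ?thesis
    by (rule measurable_compose_countable'[OF _ free])
      (auto intro!: measurable_second_highest measurable_types j countable_finite intro: finite_subset)
qed

text \<open>The bidders that are free for item \<open>j\<close> are independent of the values for item \<open>j\<close>.\<close>

lemma item_price_le_free_bidders: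
  assumes j: "j < m" and k: "k \<le> K - (m - 1)"
  shows "item_price k j \<le>
    (\<integral>\<^sup>+T. second_highest (free_bidders m K j T) (\<lambda>i. T i j) \<partial>(\<Pi>\<^sub>M i\<in>{..<K}. type_dist))"
proof -
  \<comment> \<open>\<open>N\<close> is the law of one bidder's values for the items other than j,
    and \<open>f\<close> puts the value for j back; \<open>Z\<close> does this for all bidders at
    once.\<close>
  define N where "N = (\<Pi>\<^sub>M l\<in>{..<m} - {j}. D l)"
  define f where "f = (\<lambda>(y, x :: nat \<Rightarrow> real). x(j := y :: real))"
  have ins: "insert j ({..<m} - {j}) = {..<m}" using j by auto
  interpret Dj: prob_space "D j" by (rule prob_space_item)
  interpret N: prob_space N unfolding N_def by (intro prob_space_PiM prob_space_item)
  interpret DjN: pair_prob_space "D j" N ..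
  interpret PD: product_prob_space "\<lambda>_. D j" "{..<K}" ..
  interpret PN: product_prob_space "\<lambda>_. N" "{..<K}" ..
  interpret P: pair_prob_space "\<Pi>\<^sub>M i\<in>{..<K}. D j" "\<Pi>\<^sub>M i\<in>{..<K}. N" ..
  have f: "f \<in> D j \<Otimes>\<^sub>M N \<rightarrow>\<^sub>M type_dist"
    using measurable_add_dim[of j "{..<m} - {j}" D]
    unfolding f_def N_def type_dist_def ins
    by (subst measurable_pair_swap_iff) (simp add: split_beta' case_prod_unfold)
  have distr_f: "distr (D j \<Otimes>\<^sub>M N) type_dist f = type_dist"
    using distr_pair_PiM_eq_PiM[of "{..<m} - {j}" D j] prob_space_item
    unfolding f_def N_def type_dist_def ins by simp
  define Z where "Z = (\<lambda>(y, x). \<lambda>i\<in>{..<K}. f (y i, x i))"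
  have zip: "distr ((\<Pi>\<^sub>M i\<in>{..<K}. D j) \<Otimes>\<^sub>M (\<Pi>\<^sub>M i\<in>{..<K}. N)) (\<Pi>\<^sub>M i\<in>{..<K}. type_dist) Z
      = (\<Pi>\<^sub>M i\<in>{..<K}. type_dist)"
    using distr_pair_PiM_zip[OF _ Dj.prob_space_axioms N.prob_space_axioms f, of "{..<K}"]
    by (simp add: distr_f Z_def)
  have Z: "Z \<in> (\<Pi>\<^sub>M i\<in>{..<K}. D j) \<Otimes>\<^sub>M (\<Pi>\<^sub>M i\<in>{..<K}. N) \<rightarrow>\<^sub>M (\<Pi>\<^sub>M i\<in>{..<K}. type_dist)"
    unfolding Z_def using f by measurable
  have main: "item_price k j \<le>
      (\<integral>\<^sup>+y. second_highest (free_bidders m K j (Z (y, x))) (\<lambda>i. Z (y, x) i j) \<partial>(\<Pi>\<^sub>M i\<in>{..<K}. D j))" for x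
  proof -
    \<comment> \<open>The free set is computed from x alone: its entries in column j are never read,
      so the values y inserted there do not matter.\<close>
    define S where "S = free_bidders m K j x"
    have S: "free_bidders m K j (Z (y, x)) = S" for y
      unfolding S_def by (rule free_bidders_cong) (auto simp: Z_def f_def)
    have SK: "S \<subseteq> {..<K}" by (auto simp: S_def free_bidders_def)
    then have "finite S" using finite_subset by blast
    moreover have "k \<le> card S"
      using card_free_bidders[OF j, of K x] k by (simp add: S_def)
    \<comment> \<open>The embedding \<open>h\<close> of k bidders into the free set does not depend
      on y, so the values for j of the chosen bidders are k i.i.d. draws. More free bidders can only
      raise the second-highest value.\<close>
    ultimately obtain h where h: "inj_on h {..<k}" "h ` {..<k} \<subseteq> S"
      using card_le_inj[of "{..<k}" S] by auto
    have r: "(\<lambda>y. \<lambda>i\<in>{..<k}. y (h i)) \<in> (\<Pi>\<^sub>M i\<in>{..<K}. D j) \<rightarrow>\<^sub>M (\<Pi>\<^sub>M i\<in>{..<k}. D j)"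
      using h SK by (intro measurable_restrict measurable_component_singleton) auto
    have "item_price k j = (\<integral>\<^sup>+y. second_highest {..<k} (\<lambda>i\<in>{..<k}. y (h i)) \<partial>(\<Pi>\<^sub>M i\<in>{..<K}. D j))"
      unfolding item_price_def
      by (subst distr_PiM_reindex[of "{..<K}" "\<lambda>_. D j" h "{..<k}", symmetric])
        (use h SK prob_space_item in \<open>auto simp: nn_integral_distr[OF r] measurable_second_highest_PiM\<close>)
    also have "\<dots> \<le> (\<integral>\<^sup>+y. second_highest (free_bidders m K j (Z (y, x))) (\<lambda>i. Z (y, x) i j) \<partial>(\<Pi>\<^sub>M i\<in>{..<K}. D j))"
    proof (rule nn_integral_mono)
      fix y
      have "second_highest {..<k} (\<lambda>i\<in>{..<k}. y (h i)) = second_highest {..<k} (\<lambda>i. y (h i))"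
        by (rule second_highest_cong) simp
      also have "\<dots> \<le> second_highest S y" by (rule second_highest_reindex_le[OF h])
      also have "\<dots> = second_highest S (\<lambda>i. Z (y, x) i j)"
        using SK by (intro second_highest_cong) (auto simp: Z_def f_def)
      finally show "second_highest {..<k} (\<lambda>i\<in>{..<k}. y (h i)) \<le>
          second_highest (free_bidders m K j (Z (y, x))) (\<lambda>i. Z (y, x) i j)"
        by (simp add: S)
    qed
    finally show ?thesis .
  qed
  have "item_price k j = (\<integral>\<^sup>+x. item_price k j \<partial>(\<Pi>\<^sub>M i\<in>{..<K}. N))"
    using PN.emeasure_space_1 by simp
  also have "\<dots> \<le> (\<integral>\<^sup>+x. \<integral>\<^sup>+y. second_highest (free_bidders m K j (Z (y, x))) (\<lambda>i. Z (y, x) i j)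
      \<partial>(\<Pi>\<^sub>M i\<in>{..<K}. D j) \<partial>(\<Pi>\<^sub>M i\<in>{..<K}. N))"
    by (intro nn_integral_mono main)
  also have "\<dots> = (\<integral>\<^sup>+p. second_highest (free_bidders m K j (Z p)) (\<lambda>i. Z p i j)
      \<partial>((\<Pi>\<^sub>M i\<in>{..<K}. D j) \<Otimes>\<^sub>M (\<Pi>\<^sub>M i\<in>{..<K}. N)))"
    using measurable_compose[OF Z measurable_second_highest_free_bidders[OF j]]
    by (subst P.nn_integral_snd[symmetric]) auto
  also have "\<dots> = (\<integral>\<^sup>+T. second_highest (free_bidders m K j T) (\<lambda>i. T i j) \<partial>(\<Pi>\<^sub>M i\<in>{..<K}. type_dist))"
    using nn_integral_distr[OF Z, of "\<lambda>T. second_highest (free_bidders m K j T) (\<lambda>i. T i j)"]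
      measurable_second_highest_free_bidders[OF j]
    unfolding zip by simp
  finally show ?thesis .
qed

lemma measurable_second_highest_columns:
  fixes k :: nat
  shows "j < m \<Longrightarrow> (\<lambda>T. second_highest {..<k} (\<lambda>i. T i j)) \<in> borel_measurable (\<Pi>\<^sub>M i\<in>{..<k}. type_dist)"
  by (intro measurable_second_highest measurable_types) auto

text \<open>What the additive and the constrained distribution have in common: singleton values
  distributed like types. It turns expectations over valuation profiles into expectations over value
  matrices.\<close>

definition valuations_of_items :: "valuation measure \<Rightarrow> bool" where
  "valuations_of_items F \<longleftrightarrow> prob_space F \<and> sets F = sets (valuation_space m) \<and>
     distr F type_dist (singleton_values m) = type_dist"

lemma nn_integral_singleton_values:
  fixes k :: nat
  assumes F: "valuations_of_items F" and G: "G \<in> borel_measurable (\<Pi>\<^sub>M i\<in>{..<k}. type_dist)"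
  shows "(\<integral>\<^sup>+w. G (\<lambda>i\<in>{..<k}. singleton_values m (w i)) \<partial>(\<Pi>\<^sub>M i\<in>{..<k}. F)) =
    (\<integral>\<^sup>+T. G T \<partial>(\<Pi>\<^sub>M i\<in>{..<k}. type_dist))"
proof -
  have sv: "singleton_values m \<in> F \<rightarrow>\<^sub>M type_dist"
    using F measurable_cong_sets[of F "valuation_space m" type_dist type_dist]
      measurable_singleton_values_type_dist
    unfolding valuations_of_items_def by simp
  have meas: "(\<lambda>w. \<lambda>i\<in>{..<k}. singleton_values m (w i)) \<in> (\<Pi>\<^sub>M i\<in>{..<k}. F) \<rightarrow>\<^sub>M (\<Pi>\<^sub>M i\<in>{..<k}. type_dist)"
    by (intro measurable_restrict measurable_compose[OF _ sv] measurable_component_singleton)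
  have "distr (\<Pi>\<^sub>M i\<in>{..<k}. F) (\<Pi>\<^sub>M i\<in>{..<k}. type_dist) (\<lambda>w. \<lambda>i\<in>{..<k}. singleton_values m (w i)) =
      (\<Pi>\<^sub>M i\<in>{..<k}. type_dist)"
    using F sv prob_space_type_dist unfolding valuations_of_items_def by (intro distr_PiM_const) auto
  then show ?thesis using nn_integral_distr[OF meas, of G] G by simp
qed

lemma nn_integral_sum_vcg_payments:
  assumes F: "valuations_of_items F" and R: "R m k \<subseteq> allocations m k" "R m k \<noteq> {}"
  shows "(\<Sum>i<k. \<integral>\<^sup>+(A, p). ennreal (p i) \<partial>truthful_outcome k (vcg_in_range R m k) F) =
    (\<integral>\<^sup>+w. (\<Sum>i<k. ennreal (vcg_payments (R m k) k w i)) \<partial>(\<Pi>\<^sub>M i\<in>{..<k}. F))"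
proof -
  have F': "sets F = sets (valuation_space m)" using F by (simp add: valuations_of_items_def)
  have PF: "sets (\<Pi>\<^sub>M i\<in>{..<k}. F) = sets (\<Pi>\<^sub>M i\<in>{..<k}. valuation_space m)"
    using F' by (intro sets_PiM_cong) auto
  have "(\<lambda>w. ennreal (vcg_payments (R m k) k w i)) \<in> borel_measurable (\<Pi>\<^sub>M i\<in>{..<k}. F)" if "i < k" for i
    unfolding measurable_cong_sets[OF PF refl]
    using measurable_compose[OF measurable_vcg_payments[OF R] measurable_component_singleton[of i]] that
    by (intro measurable_compose[OF _ measurable_ennreal]) auto
  then show ?thesis
    using nn_integral_truthful_outcome_vcg[where R = R, OF R F', of ennreal]
    by (subst nn_integral_sum) auto
qed

text \<open>At almost every profile the payments sum to at most the second-highest values of all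
  items. In expectation these are the item prices, since each column of the value matrix is
  i.i.d.\<close>

lemma revenue_VCG_le:
  assumes F: "valuations_of_items F"
    and additive: "AE v in F. (\<forall>S. S \<subseteq> {..<m} \<longrightarrow> v S = (\<Sum>j\<in>S. v {j})) \<and> (\<forall>j<m. 0 \<le> v {j})"
  shows "revenue k (VCG m k) F \<le> enn2ereal (\<Sum>j<m. item_price k j)"
proof -
  define G where "G = (\<lambda>T. \<Sum>j<m. second_highest {..<k} (\<lambda>i. T i j))"
  have G: "G \<in> borel_measurable (\<Pi>\<^sub>M i\<in>{..<k}. type_dist)"
    unfolding G_def by (intro borel_measurable_sum measurable_second_highest_columns) auto
  have prob: "prob_space F" using F by (simp add: valuations_of_items_def)
  have "AE w in (\<Pi>\<^sub>M i\<in>{..<k}. F). (\<Sum>i<k. ennreal (vcg_payments (allocations m k) k w i)) \<le>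
      G (\<lambda>i\<in>{..<k}. singleton_values m (w i))"
    using AE_PiM_iid[OF finite_lessThan[of k] prob additive]
  proof eventually_elim
    case (elim w)
    have "(\<Sum>i<k. ennreal (vcg_payments (allocations m k) k w i)) \<le>
        (\<Sum>j<m. second_highest {..<k} (\<lambda>l. w l {j}))"
    proof (rule sum_vcg_payments_additive_le)
      show "w i S = (\<Sum>j\<in>S. w i {j})" if "i < k" "S \<subseteq> {..<m}" for i S
        using elim that by blast
      show "0 \<le> w i {j}" if "i < k" "j < m" for i j
        using elim that by blast
    qed
    also have "\<dots> = G (\<lambda>i\<in>{..<k}. singleton_values m (w i))"
      unfolding G_def by (intro sum.cong second_highest_cong) (auto simp: singleton_values_def)
    finally show ?case .
  qed
  then have "(\<integral>\<^sup>+w. (\<Sum>i<k. ennreal (vcg_payments (allocations m k) k w i)) \<partial>(\<Pi>\<^sub>M i\<in>{..<k}. F)) \<le>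
      (\<integral>\<^sup>+w. G (\<lambda>i\<in>{..<k}. singleton_values m (w i)) \<partial>(\<Pi>\<^sub>M i\<in>{..<k}. F))"
    by (rule nn_integral_mono_AE)
  also have "\<dots> = (\<integral>\<^sup>+T. G T \<partial>(\<Pi>\<^sub>M i\<in>{..<k}. type_dist))"
    by (rule nn_integral_singleton_values[OF F G])
  also have "\<dots> = (\<Sum>j<m. item_price k j)"
    unfolding G_def using item_price_eq_columns measurable_second_highest_columns
    by (subst nn_integral_sum) auto
  finally have "enn2ereal (\<integral>\<^sup>+w. (\<Sum>i<k. ennreal (vcg_payments (allocations m k) k w i)) \<partial>(\<Pi>\<^sub>M i\<in>{..<k}. F)) \<le>
      enn2ereal (\<Sum>j<m. item_price k j)"
    by (simp add: less_eq_ennreal.rep_eq)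
  moreover have "allocations m k \<noteq> {}" using no_allocation_allocations by blast
  ultimately show ?thesis
    using revenue_le[of k "VCG m k" F] nn_integral_sum_vcg_payments[OF F, where R = allocations and k = k]
    unfolding VCG_def by simp
qed

text \<open>The second-highest values among free bidders lie in between: in expectation they are at
  least the prices among k bidders, and at almost every profile their sum is at most the sum of the
  payments. Payments are almost surely nonnegative, so no negative part is subtracted.\<close>

lemma revenue_VCG_UD_ge:
  assumes F: "valuations_of_items F" and empty: "AE v in F. v {} = 0" and k: "k \<le> K - (m - 1)"
  shows "enn2ereal (\<Sum>j<m. item_price k j) \<le> revenue K (VCG_UD m K) F"
proof -
  have R: "matchings m K \<subseteq> allocations m K" "matchings m K \<noteq> {}"
    using matchings_subset no_allocation_matchings by blast+
  define H where "H = (\<lambda>T j. second_highest (free_bidders m K j T) (\<lambda>i. T i j))"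
  have H: "(\<lambda>T. H T j) \<in> borel_measurable (\<Pi>\<^sub>M i\<in>{..<K}. type_dist)" if "j < m" for j
    unfolding H_def using that by (rule measurable_second_highest_free_bidders)
  have AE0: "AE w in (\<Pi>\<^sub>M i\<in>{..<K}. F). \<forall>i\<in>{..<K}. w i {} = 0"
    using F unfolding valuations_of_items_def by (intro AE_PiM_iid empty) auto
  have F': "sets F = sets (valuation_space m)" using F by (simp add: valuations_of_items_def)
  have "(\<Sum>j<m. item_price k j) \<le> (\<Sum>j<m. \<integral>\<^sup>+T. H T j \<partial>(\<Pi>\<^sub>M i\<in>{..<K}. type_dist))"
    unfolding H_def using k by (intro sum_mono item_price_le_free_bidders) auto
  also have "\<dots> = (\<integral>\<^sup>+T. (\<Sum>j<m. H T j) \<partial>(\<Pi>\<^sub>M i\<in>{..<K}. type_dist))"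
    using H by (subst nn_integral_sum) auto
  also have "\<dots> = (\<integral>\<^sup>+w. (\<Sum>j<m. H (\<lambda>i\<in>{..<K}. singleton_values m (w i)) j) \<partial>(\<Pi>\<^sub>M i\<in>{..<K}. F))"
    using H by (intro nn_integral_singleton_values[OF F, symmetric] borel_measurable_sum) auto
  also have "\<dots> \<le> (\<integral>\<^sup>+w. (\<Sum>i<K. ennreal (vcg_payments (matchings m K) K w i)) \<partial>(\<Pi>\<^sub>M i\<in>{..<K}. F))"
    using AE0 unfolding H_def
    by (intro nn_integral_mono_AE, eventually_elim, intro sum_second_highest_le_vcg_payments_matchings)
      (auto simp: singleton_values_def)
  also have "\<dots> = (\<Sum>i<K. \<integral>\<^sup>+(A, p). ennreal (p i) \<partial>truthful_outcome K (VCG_UD m K) F)"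
    unfolding VCG_UD_def by (rule nn_integral_sum_vcg_payments[where R = matchings, OF F R, symmetric])
  finally have "enn2ereal (\<Sum>j<m. item_price k j) \<le>
      enn2ereal (\<Sum>i<K. \<integral>\<^sup>+(A, p). ennreal (p i) \<partial>truthful_outcome K (VCG_UD m K) F)"
    by (simp add: less_eq_ennreal.rep_eq)
  moreover have "(\<integral>\<^sup>+(A, p). ennreal (- p i) \<partial>truthful_outcome K (VCG_UD m K) F) = 0" if i: "i < K" for i
  proof -
    have "(\<integral>\<^sup>+(A, p). ennreal (- p i) \<partial>truthful_outcome K (VCG_UD m K) F) =
        (\<integral>\<^sup>+w. ennreal (- vcg_payments (matchings m K) K w i) \<partial>(\<Pi>\<^sub>M i\<in>{..<K}. F))"
      unfolding VCG_UD_def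
      using nn_integral_truthful_outcome_vcg[where R = matchings and g = "\<lambda>x. ennreal (- x)", OF R F' _ i] by simp
    also have "\<dots> = (\<integral>\<^sup>+w. 0 \<partial>(\<Pi>\<^sub>M i\<in>{..<K}. F))"
    proof (rule nn_integral_cong_AE)
      show "AE w in (\<Pi>\<^sub>M i\<in>{..<K}. F). ennreal (- vcg_payments (matchings m K) K w i) = 0"
        using AE0
      proof eventually_elim
        case (elim w)
        then have "0 \<le> vcg_payments (matchings m K) K w i"
          using i by (intro vcg_payment_matchings_nonneg) auto
        then show ?case by (simp add: ennreal_neg)
      qed
    qed
    finally show ?thesis by simp
  qed
  ultimately show ?thesis by (simp add: revenue_eq_nonneg)
qed

end


section \<open>Constrained valuations\<close>

lemma constrained_val_apply:
  "S \<subseteq> {..<m} \<Longrightarrow> constrained_val m I t S = Max ((\<lambda>T. \<Sum>j\<in>T. t j) ` {T. T \<subseteq> S \<and> T \<in> I})"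
  unfolding constrained_val_def by auto

lemma finite_feasible: "S \<subseteq> {..<m :: nat} \<Longrightarrow> finite {T. T \<subseteq> S \<and> T \<in> I}"
  by (rule finite_subset[of _ "Pow {..<m}"]) auto

text \<open>Set systems outside the support of the constraint law are arbitrary. Cutting them down
  to sets of items leaves finitely many, which yields measurability in the constraint.\<close>

lemma constrained_val_Int_Pow: "constrained_val m (I \<inter> Pow {..<m}) t = constrained_val m I t"
proof -
  have "{T. T \<subseteq> S \<and> T \<in> I \<inter> Pow {..<m}} = {T. T \<subseteq> S \<and> T \<in> I}" if "S \<in> Pow {..<m}" for S
    using that by auto
  then show ?thesis unfolding constrained_val_def by (intro restrict_ext) simp
qed

text \<open>A feasible set has at most m items, so moving each value by at most e moves each
  candidate sum by at most m * e. This Lipschitz bound carries balls of types into balls around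
  constrained valuations.\<close>

lemma constrained_val_diff_le:
  assumes S: "S \<subseteq> {..<m}" and I: "{} \<in> I" and t: "\<And>j. j < m \<Longrightarrow> \<bar>t j - t' j\<bar> \<le> e" and e: "0 \<le> e"
  shows "constrained_val m I t S \<le> constrained_val m I t' S + real m * e"
  unfolding constrained_val_apply[OF S]
proof (subst Max_le_iff)
  show "\<forall>a\<in>sum t ` {T. T \<subseteq> S \<and> T \<in> I}. a \<le> Max (sum t' ` {T. T \<subseteq> S \<and> T \<in> I}) + real m * e"
  proof safe
    fix T assume T: "T \<subseteq> S" "T \<in> I"
    have "sum t T \<le> (\<Sum>j\<in>T. t' j + e)"
      using T S t by (intro sum_mono) (force simp: abs_le_iff)
    also have "\<dots> = sum t' T + real (card T) * e" by (simp add: sum.distrib)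
    also have "\<dots> \<le> Max (sum t' ` {T. T \<subseteq> S \<and> T \<in> I}) + real m * e"
    proof (intro add_mono Max_ge mult_right_mono e)
      show "real (card T) \<le> real m"
        using card_mono[of "{..<m}" T] T S by auto
    qed (use T finite_feasible[OF S] in auto)
    finally show "sum t T \<le> Max (sum t' ` {T. T \<subseteq> S \<and> T \<in> I}) + real m * e" .
  qed
qed (use finite_feasible[OF S] I in auto)

lemma measurable_constrained_val:
  assumes N: "sets N = sets (\<Pi>\<^sub>M j\<in>{..<m}. borel)" and "finite X"
  shows "(\<lambda>(t, I). constrained_val m I t) \<in> N \<Otimes>\<^sub>M count_space X \<rightarrow>\<^sub>M valuation_space m"
  unfolding constrained_val_def valuation_space_def split_beta'
proof (rule measurable_restrict)
  fix S assume S: "S \<in> Pow {..<m}"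
  have t: "(\<lambda>p. fst p j) \<in> borel_measurable (N \<Otimes>\<^sub>M count_space X)" if "j < m" for j
    using measurable_compose[OF measurable_fst, of "\<lambda>t. t j" N borel "count_space X"] that
    unfolding measurable_cong_sets[OF N refl] by (auto intro: measurable_component_singleton)
  show "(\<lambda>p. Max (sum (fst p) ` {T. T \<subseteq> S \<and> T \<in> snd p})) \<in> borel_measurable (N \<Otimes>\<^sub>M count_space X)"
  proof (rule measurable_compose_countable'[where g = snd and I = X])
    fix I
    show "(\<lambda>p. Max (sum (fst p) ` {T. T \<subseteq> S \<and> T \<in> I})) \<in> borel_measurable (N \<Otimes>\<^sub>M count_space X)"
      using S by (intro borel_measurable_Max finite_feasible[of S m] borel_measurable_sum t) auto
  qed (use \<open>finite X\<close> in \<open>auto intro: countable_finite\<close>)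
qed

lemma measurable_additive_val: "additive_val m \<in> (\<Pi>\<^sub>M j\<in>{..<m}. borel) \<rightarrow>\<^sub>M valuation_space m"
  unfolding additive_val_def valuation_space_def
  by (intro measurable_restrict borel_measurable_sum measurable_component_singleton) auto

section \<open>Random constraints as a distribution on a finite space\<close>

locale constrained_items = item_distributions +
  fixes C :: "nat set set pmf"
  assumes m_pos: "1 \<le> m"
    and downward_closed_C: "\<And>I. I \<in> set_pmf C \<Longrightarrow> downward_closed m I"
    and singletons_C: "\<And>I j. I \<in> set_pmf C \<Longrightarrow> j < m \<Longrightarrow> {j} \<in> I"
begin

lemma constraint_subset: "I \<in> set_pmf C \<Longrightarrow> I \<subseteq> Pow {..<m}"
  using downward_closed_C by (auto simp: downward_closed_def)

text \<open>As 1 \<le> m, the singleton {0} is feasible, and with it its subset {}. This guarantees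
  that every maximum over feasible subsets is taken over a nonempty set.\<close>

lemma empty_feasible: "I \<in> set_pmf C \<Longrightarrow> {} \<in> I"
  using downward_closed_C[of I] singletons_C[of I 0] m_pos by (auto simp: downward_closed_def)

lemma finite_constraints [simp]: "finite (set_pmf C)"
  by (rule finite_subset[of _ "Pow (Pow {..<m})"]) (use constraint_subset in auto)

text \<open>The distribution \<open>C\<close>, on the finite \<sigma>-algebra over its support.\<close>

definition some_constraint :: "nat set set \<Rightarrow> nat set set" where
  "some_constraint I = (if I \<in> set_pmf C then I else (SOME I. I \<in> set_pmf C))"

definition constraint_dist :: "nat set set measure" where
  "constraint_dist = distr (measure_pmf C) (count_space (set_pmf C)) some_constraint"

lemma measurable_some_constraint: "some_constraint \<in> measure_pmf C \<rightarrow>\<^sub>M count_space (set_pmf C)"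
  using set_pmf_not_empty[of C] by (auto simp: some_constraint_def some_in_eq)

lemma prob_space_constraint_dist: "prob_space constraint_dist"
  unfolding constraint_dist_def by (intro measure_pmf.prob_space_distr measurable_some_constraint)

lemma sets_constraint_dist [simp, measurable_cong]: "sets constraint_dist = sets (count_space (set_pmf C))"
  unfolding constraint_dist_def by simp

lemma space_constraint_dist [simp]: "space constraint_dist = set_pmf C"
  unfolding constraint_dist_def by simp

lemma nn_integral_constraint_dist:
  "(\<integral>\<^sup>+I. f I \<partial>constraint_dist) = (\<Sum>I\<in>set_pmf C. f I * ennreal (pmf C I))"
proof -
  have "(\<integral>\<^sup>+I. f I \<partial>constraint_dist) = (\<integral>\<^sup>+I. f (some_constraint I) \<partial>measure_pmf C)"
    unfolding constraint_dist_def by (rule nn_integral_distr[OF measurable_some_constraint]) simp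
  also have "\<dots> = (\<Sum>I\<in>set_pmf C. f I * ennreal (pmf C I))"
    by (subst nn_integral_measure_pmf_finite) (auto simp: some_constraint_def)
  finally show ?thesis .
qed

definition additive_dist :: "valuation measure" where
  "additive_dist = distr type_dist (valuation_space m) (additive_val m)"

definition constrained_dist :: "valuation measure" where
  "constrained_dist = distr (type_dist \<Otimes>\<^sub>M measure_pmf C) (valuation_space m) (\<lambda>(t, I). constrained_val m I t)"

lemma measurable_additive_val_type_dist: "additive_val m \<in> type_dist \<rightarrow>\<^sub>M valuation_space m"
  using measurable_additive_val measurable_cong_sets[OF sets_type_dist refl] by blast

lemma measurable_constrained_val_constraint_dist:
  "(\<lambda>(t, I). constrained_val m I t) \<in> type_dist \<Otimes>\<^sub>M constraint_dist \<rightarrow>\<^sub>M valuation_space m"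
  using measurable_constrained_val[OF sets_type_dist finite_constraints]
    measurable_cong_sets[OF sets_pair_measure_cong[OF refl sets_constraint_dist] refl] by blast

lemma space_type_dist: "space type_dist = {..<m} \<rightarrow>\<^sub>E UNIV"
  using sets_eq_imp_space_eq[OF sets_type_dist] by (simp add: space_PiM)

lemma singleton_values_additive: "t \<in> space type_dist \<Longrightarrow> singleton_values m (additive_val m t) = t"
  by (auto simp: singleton_values_def additive_val_def space_type_dist fun_eq_iff PiE_def extensional_def)

lemma pair_prob_space_types: "pair_prob_space type_dist constraint_dist"
proof -
  interpret T: prob_space type_dist by (rule prob_space_type_dist)
  interpret Q: prob_space constraint_dist by (rule prob_space_constraint_dist)
  show ?thesis ..
qed

text \<open>\<open>measure_pmf C\<close> makes every subset of an uncountable type measurable.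
  Passing to the law on its finite support changes the drawn constraint only on a null set and
  reduces measurability in the constraint to finitely many cases.\<close>

lemma constrained_dist_eq:
  "constrained_dist =
    distr (type_dist \<Otimes>\<^sub>M constraint_dist) (valuation_space m) (\<lambda>(t, I). constrained_val m I t)"
proof -
  interpret T: prob_space type_dist by (rule prob_space_type_dist)
  interpret Q: prob_space constraint_dist by (rule prob_space_constraint_dist)
  interpret TC: pair_prob_space type_dist "measure_pmf C" ..
  have some: "(\<lambda>(t, I). (t, some_constraint I)) \<in> type_dist \<Otimes>\<^sub>M measure_pmf C \<rightarrow>\<^sub>M type_dist \<Otimes>\<^sub>M constraint_dist"
    using measurable_some_constraint measurable_cong_sets[OF refl sets_constraint_dist]
    by (intro measurable_pair) (auto simp: comp_def split_beta' intro!: measurable_compose[OF measurable_snd])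
  have "type_dist \<Otimes>\<^sub>M constraint_dist = distr (type_dist \<Otimes>\<^sub>M measure_pmf C)
      (type_dist \<Otimes>\<^sub>M count_space (set_pmf C)) (\<lambda>(t, I). (t, some_constraint I))"
    unfolding constraint_dist_def
    using pair_measure_distr[of "\<lambda>t. t" type_dist type_dist some_constraint "measure_pmf C" "count_space (set_pmf C)"]
      measurable_some_constraint Q.sigma_finite_measure_axioms
    by (simp add: distr_id2 constraint_dist_def)
  also have "\<dots> = distr (type_dist \<Otimes>\<^sub>M measure_pmf C) (type_dist \<Otimes>\<^sub>M constraint_dist)
      (\<lambda>(t, I). (t, some_constraint I))"
    by (intro distr_cong sets_pair_measure_cong) auto
  finally have TQ: "type_dist \<Otimes>\<^sub>M constraint_dist = \<dots>" .
  have Pow: "(\<lambda>(t, I). (t, I \<inter> Pow {..<m})) \<in>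
      type_dist \<Otimes>\<^sub>M measure_pmf C \<rightarrow>\<^sub>M type_dist \<Otimes>\<^sub>M count_space (Pow (Pow {..<m}))"
    by (intro measurable_pair) (auto simp: comp_def split_beta' intro!: measurable_compose[OF measurable_snd])
  have meas: "(\<lambda>(t, I). constrained_val m I t) \<in> type_dist \<Otimes>\<^sub>M measure_pmf C \<rightarrow>\<^sub>M valuation_space m"
    using measurable_compose[OF Pow measurable_constrained_val[OF sets_type_dist]]
    by (simp add: split_beta' constrained_val_Int_Pow)
  have ae: "AE p in type_dist \<Otimes>\<^sub>M measure_pmf C. snd p \<in> set_pmf C"
    by (rule TC.AE_pair_measure) (auto simp: AE_measure_pmf intro: measurable_sets_Collect[OF measurable_snd])
  have "constrained_dist = distr (type_dist \<Otimes>\<^sub>M measure_pmf C) (valuation_space m)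
      (\<lambda>(t, I). constrained_val m (some_constraint I) t)"
    unfolding constrained_dist_def
  proof (rule distr_cong_AE)
    show "(\<lambda>(t, I). constrained_val m (some_constraint I) t) \<in> type_dist \<Otimes>\<^sub>M measure_pmf C \<rightarrow>\<^sub>M valuation_space m"
      using measurable_compose[OF some measurable_constrained_val_constraint_dist] by (simp add: split_beta')
    show "AE p in type_dist \<Otimes>\<^sub>M measure_pmf C. (case p of (t, I) \<Rightarrow> constrained_val m I t) =
        (case p of (t, I) \<Rightarrow> constrained_val m (some_constraint I) t)"
      using ae by eventually_elim (auto simp: some_constraint_def)
  qed (fact meas | rule refl)+
  also have "\<dots> = distr (type_dist \<Otimes>\<^sub>M constraint_dist) (valuation_space m) (\<lambda>(t, I). constrained_val m I t)"
    by (subst TQ, subst distr_distr[OF measurable_constrained_val_constraint_dist some])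
      (simp add: comp_def split_beta')
  finally show ?thesis .
qed

lemma AE_types: "AE p in type_dist \<Otimes>\<^sub>M constraint_dist. (\<forall>j<m. 0 \<le> fst p j) \<and> snd p \<in> set_pmf C"
proof -
  interpret T: prob_space type_dist by (rule prob_space_type_dist)
  interpret Q: prob_space constraint_dist by (rule prob_space_constraint_dist)
  have "AE t in type_dist. \<forall>j\<in>{..<m}. 0 \<le> t j"
    unfolding type_dist_def using AE_PiM_component[of "{..<m}" D _ "\<lambda>x. 0 \<le> x"] prob_space_item nonneg_item
    by (simp add: AE_finite_all)
  then have "AE t in distr (type_dist \<Otimes>\<^sub>M constraint_dist) type_dist fst. \<forall>j\<in>{..<m}. 0 \<le> t j"
    unfolding Q.distr_pair_fst .
  from AE_distrD[OF measurable_fst this]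
  have "AE p in type_dist \<Otimes>\<^sub>M constraint_dist. \<forall>j\<in>{..<m}. 0 \<le> fst p j" .
  moreover have "AE p in type_dist \<Otimes>\<^sub>M constraint_dist. snd p \<in> set_pmf C"
    by (intro AE_I2) (auto simp: space_pair_measure)
  ultimately show ?thesis by eventually_elim auto
qed

lemma constrained_val_empty: "I \<in> set_pmf C \<Longrightarrow> constrained_val m I t {} = 0"
proof -
  assume "I \<in> set_pmf C"
  then have "{T. T \<subseteq> {} \<and> T \<in> I} = {{}}" using empty_feasible by auto
  then show ?thesis by (simp add: constrained_val_apply)
qed

text \<open>The maximum runs over {} and {j}, so it is that of 0 and \<open>t j\<close>. Feasibility
  of singletons and nonnegativity of values both enter here.\<close>

lemma constrained_val_singleton:
  assumes "I \<in> set_pmf C" "j < m" "0 \<le> t j"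
  shows "constrained_val m I t {j} = t j"
proof -
  have "{T. T \<subseteq> {j} \<and> T \<in> I} = {{}, {j}}"
    using empty_feasible singletons_C assms by auto
  then show ?thesis using assms by (simp add: constrained_val_apply)
qed

lemma AE_constrained_dist: "AE v in constrained_dist. v {} = 0"
  unfolding constrained_dist_eq
proof (subst AE_distr_iff[OF measurable_constrained_val_constraint_dist])
  show "{v \<in> space (valuation_space m). v {} = 0} \<in> sets (valuation_space m)"
    by measurable
  show "AE p in type_dist \<Otimes>\<^sub>M constraint_dist. (case p of (t, I) \<Rightarrow> constrained_val m I t) {} = 0"
    using AE_types by eventually_elim (auto simp: split_beta' constrained_val_empty)
qed

lemma AE_additive_dist:
  "AE v in additive_dist. (\<forall>S. S \<subseteq> {..<m} \<longrightarrow> v S = (\<Sum>j\<in>S. v {j})) \<and> (\<forall>j<m. 0 \<le> v {j})"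
proof -
  have "AE t in type_dist. \<forall>j\<in>{..<m}. 0 \<le> t j"
    unfolding type_dist_def using AE_PiM_component[of "{..<m}" D _ "\<lambda>x. 0 \<le> x"] prob_space_item nonneg_item
    by (simp add: AE_finite_all)
  then have ae: "AE t in type_dist. (\<forall>S\<in>Pow {..<m}. additive_val m t S = (\<Sum>j\<in>S. additive_val m t {j})) \<and>
      (\<forall>j\<in>{..<m}. 0 \<le> additive_val m t {j})"
  proof eventually_elim
    case (elim t)
    have "(\<Sum>j\<in>S. additive_val m t {j}) = (\<Sum>j\<in>S. t j)" if "S \<subseteq> {..<m}" for S
      using that by (intro sum.cong) (auto simp: additive_val_def)
    then show ?case using elim by (auto simp: additive_val_def)
  qed
  have "AE v in additive_dist. (\<forall>S\<in>Pow {..<m}. v S = (\<Sum>j\<in>S. v {j})) \<and> (\<forall>j\<in>{..<m}. 0 \<le> v {j})"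
    unfolding additive_dist_def
  proof (subst AE_distr_iff[OF measurable_additive_val_type_dist])
    show "{v \<in> space (valuation_space m). (\<forall>S\<in>Pow {..<m}. v S = (\<Sum>j\<in>S. v {j})) \<and> (\<forall>j\<in>{..<m}. 0 \<le> v {j})}
        \<in> sets (valuation_space m)"
      by (intro sets.sets_Collect_conj sets.sets_Collect_finite_All borel_measurable_eq
          borel_measurable_le[OF borel_measurable_const]
          borel_measurable_sum measurable_valuation_component[of _ _ m]) auto
  qed (rule ae)
  then show ?thesis by (rule AE_mp) (intro AE_I2, blast)
qed

lemma valuations_of_items_additive: "valuations_of_items additive_dist"
proof -
  interpret T: prob_space type_dist by (rule prob_space_type_dist)
  have "distr additive_dist type_dist (singleton_values m) =
      distr type_dist type_dist (\<lambda>t. singleton_values m (additive_val m t))"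
    unfolding additive_dist_def
    by (subst distr_distr[OF measurable_singleton_values_type_dist measurable_additive_val_type_dist])
      (simp add: comp_def)
  also have "\<dots> = distr type_dist type_dist (\<lambda>t. t)"
    by (intro distr_cong refl singleton_values_additive)
  finally show ?thesis
    unfolding valuations_of_items_def using T.prob_space_distr[OF measurable_additive_val_type_dist]
    by (simp add: additive_dist_def distr_id2)
qed

text \<open>A constraint that admits all singletons leaves singleton values alone, so these almost
  surely return the drawn type.\<close>

lemma valuations_of_items_constrained: "valuations_of_items constrained_dist"
proof -
  interpret Q: prob_space constraint_dist by (rule prob_space_constraint_dist)
  interpret TQ: pair_prob_space type_dist constraint_dist by (rule pair_prob_space_types)
  note meas = measurable_constrained_val_constraint_dist
  have "distr constrained_dist type_dist (singleton_values m) =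
      distr (type_dist \<Otimes>\<^sub>M constraint_dist) type_dist (\<lambda>p. singleton_values m (constrained_val m (snd p) (fst p)))"
    unfolding constrained_dist_eq
    by (subst distr_distr[OF measurable_singleton_values_type_dist meas]) (simp add: comp_def split_beta')
  also have "\<dots> = distr (type_dist \<Otimes>\<^sub>M constraint_dist) type_dist fst"
  proof (rule distr_cong_AE)
    show "AE p in type_dist \<Otimes>\<^sub>M constraint_dist. singleton_values m (constrained_val m (snd p) (fst p)) = fst p"
      using AE_types AE_space
    proof eventually_elim
      case (elim p)
      then have "fst p \<in> space type_dist" by (auto simp: space_pair_measure)
      with elim show ?case
        by (auto simp: singleton_values_def constrained_val_singleton space_type_dist fun_eq_iff
            PiE_def extensional_def)
    qed
    show "(\<lambda>p. singleton_values m (constrained_val m (snd p) (fst p))) \<in> type_dist \<Otimes>\<^sub>M constraint_dist \<rightarrow>\<^sub>M type_dist"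
      using measurable_compose[OF meas measurable_singleton_values_type_dist] by (simp add: split_beta')
  qed auto
  also have "\<dots> = type_dist" by (rule Q.distr_pair_fst)
  finally show ?thesis
    unfolding valuations_of_items_def using TQ.prob_space_distr[OF meas]
    by (simp add: constrained_dist_eq)
qed

text \<open>Reads only singleton values, so that it applies to every bid; bids need not be
  additive.\<close>

definition constrain :: "nat set set \<Rightarrow> valuation \<Rightarrow> valuation" where
  "constrain I v = constrained_val m I (singleton_values m v)"

lemma measurable_constrain: "(\<lambda>(v, I). constrain I v) \<in> additive_dist \<Otimes>\<^sub>M constraint_dist \<rightarrow>\<^sub>M valuation_space m"
proof -
  have "(\<lambda>(v, I). (singleton_values m v, I)) \<in> additive_dist \<Otimes>\<^sub>M constraint_dist \<rightarrow>\<^sub>M type_dist \<Otimes>\<^sub>M constraint_dist"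
    using measurable_singleton_values_type_dist measurable_cong_sets[of additive_dist "valuation_space m" type_dist type_dist]
    by (intro measurable_pair) (auto simp: comp_def split_beta' additive_dist_def intro!: measurable_compose[OF measurable_fst])
  from measurable_compose[OF this measurable_constrained_val_constraint_dist] show ?thesis
    by (simp add: split_beta' constrain_def)
qed

lemma distr_constrain:
  "distr (additive_dist \<Otimes>\<^sub>M constraint_dist) (valuation_space m) (\<lambda>(v, I). constrain I v) = constrained_dist"
proof -
  interpret Q: prob_space constraint_dist by (rule prob_space_constraint_dist)
  have add: "(\<lambda>(t, I). (additive_val m t, I)) \<in> type_dist \<Otimes>\<^sub>M constraint_dist \<rightarrow>\<^sub>M additive_dist \<Otimes>\<^sub>M constraint_dist"
    using measurable_additive_val_type_dist measurable_cong_sets[of type_dist type_dist additive_dist "valuation_space m"]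
    by (intro measurable_pair) (auto simp: comp_def split_beta' additive_dist_def intro!: measurable_compose[OF measurable_fst])
  have "additive_dist \<Otimes>\<^sub>M constraint_dist =
      distr (type_dist \<Otimes>\<^sub>M constraint_dist) (valuation_space m \<Otimes>\<^sub>M constraint_dist) (\<lambda>(t, I). (additive_val m t, I))"
    using pair_measure_distr[of "additive_val m" type_dist "valuation_space m" "\<lambda>I. I" constraint_dist constraint_dist]
      measurable_additive_val_type_dist Q.sigma_finite_measure_axioms
    by (simp add: distr_id2 additive_dist_def)
  also have "\<dots> = distr (type_dist \<Otimes>\<^sub>M constraint_dist) (additive_dist \<Otimes>\<^sub>M constraint_dist)
      (\<lambda>(t, I). (additive_val m t, I))"
    by (intro distr_cong sets_pair_measure_cong) (auto simp: additive_dist_def)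
  finally have "additive_dist \<Otimes>\<^sub>M constraint_dist = \<dots>" .
  then have "distr (additive_dist \<Otimes>\<^sub>M constraint_dist) (valuation_space m) (\<lambda>(v, I). constrain I v) =
      distr (type_dist \<Otimes>\<^sub>M constraint_dist) (valuation_space m)
        ((\<lambda>(v, I). constrain I v) \<circ> (\<lambda>(t, I). (additive_val m t, I)))"
    using distr_distr[OF measurable_constrain add] by simp
  also have "\<dots> = constrained_dist"
    unfolding constrained_dist_eq
    by (intro distr_cong) (auto simp: constrain_def space_pair_measure singleton_values_additive)
  finally show ?thesis .
qed

end


section \<open>Selling to constrained bidders through additive ones\<close>

text \<open>The mixture identity is assumed for all nonnegative Borel functions of the integrand at
  once. Applied to the absolute value it gives integrability; applied to the positive and the
  negative part it gives the integral.\<close>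

lemma integral_finite_mixture:
  fixes h :: "'a \<Rightarrow> real" and h' :: "'i \<Rightarrow> 'b \<Rightarrow> real" and c :: "'i \<Rightarrow> real"
  assumes "finite Y" and c: "\<And>i. i \<in> Y \<Longrightarrow> 0 \<le> c i"
    and h: "h \<in> borel_measurable P" and h': "\<And>i. i \<in> Y \<Longrightarrow> integrable (Q i) (h' i)"
    and mixture: "\<And>g :: real \<Rightarrow> ennreal. g \<in> borel_measurable borel \<Longrightarrow>
      (\<integral>\<^sup>+x. g (h x) \<partial>P) = (\<Sum>i\<in>Y. (\<integral>\<^sup>+x. g (h' i x) \<partial>Q i) * ennreal (c i))"
  shows integrable_finite_mixture: "integrable P h"
    and integral_finite_mixture_eq: "(\<integral>x. h x \<partial>P) = (\<Sum>i\<in>Y. (\<integral>x. h' i x \<partial>Q i) * c i)"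
proof -
  have fin: "(\<integral>\<^sup>+x. ennreal (h' i x) \<partial>Q i) < \<infinity>" "(\<integral>\<^sup>+x. ennreal (- h' i x) \<partial>Q i) < \<infinity>"
    "(\<integral>\<^sup>+x. ennreal \<bar>h' i x\<bar> \<partial>Q i) < \<infinity>" if "i \<in> Y" for i
    using h'[OF that] integrable_iff_bounded[of "Q i" "h' i"]
    by (auto simp: real_integrable_def top.not_eq_extremum)
  show int: "integrable P h"
    unfolding integrable_iff_bounded using h fin \<open>finite Y\<close>
    by (auto simp: mixture[of "\<lambda>x. ennreal \<bar>x\<bar>"] ennreal_mult_less_top)
  have sum: "enn2real (\<integral>\<^sup>+x. ennreal (s * h x) \<partial>P) = (\<Sum>i\<in>Y. enn2real (\<integral>\<^sup>+x. ennreal (s * h' i x) \<partial>Q i) * c i)"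
    if s: "s = 1 \<or> s = -1" for s :: real
  proof -
    have "enn2real (\<integral>\<^sup>+x. ennreal (s * h x) \<partial>P) =
        enn2real (\<Sum>i\<in>Y. (\<integral>\<^sup>+x. ennreal (s * h' i x) \<partial>Q i) * ennreal (c i))"
      by (subst mixture[of "\<lambda>x. ennreal (s * x)"]) auto
    also have "\<dots> = (\<Sum>i\<in>Y. enn2real ((\<integral>\<^sup>+x. ennreal (s * h' i x) \<partial>Q i) * ennreal (c i)))"
      using fin s by (subst enn2real_sum) (auto simp: ennreal_mult_less_top)
    also have "\<dots> = (\<Sum>i\<in>Y. enn2real (\<integral>\<^sup>+x. ennreal (s * h' i x) \<partial>Q i) * c i)"
      using c by (intro sum.cong) (auto simp: enn2real_mult)
    finally show ?thesis .
  qed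
  have "(\<integral>x. h x \<partial>P) = enn2real (\<integral>\<^sup>+x. ennreal (h x) \<partial>P) - enn2real (\<integral>\<^sup>+x. ennreal (- h x) \<partial>P)"
    by (rule real_lebesgue_integral_def[OF int])
  also have "\<dots> = (\<Sum>i\<in>Y. (enn2real (\<integral>\<^sup>+x. ennreal (h' i x) \<partial>Q i) - enn2real (\<integral>\<^sup>+x. ennreal (- h' i x) \<partial>Q i)) * c i)"
    using sum[of 1] sum[of "-1"] by (simp add: sum_subtractf left_diff_distrib)
  also have "\<dots> = (\<Sum>i\<in>Y. (\<integral>x. h' i x \<partial>Q i) * c i)"
    using h' by (intro sum.cong) (auto simp: real_lebesgue_integral_def)
  finally show "(\<integral>x. h x \<partial>P) = (\<Sum>i\<in>Y. (\<integral>x. h' i x \<partial>Q i) * c i)" .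
qed

text \<open>A best feasible part with respect to the reported valuation. Like
  \<open>constrain\<close> it reads singleton values only, so the two match for every bid.\<close>

definition favourite :: "nat set set \<Rightarrow> valuation \<Rightarrow> nat set \<Rightarrow> nat set" where
  "favourite I v S = arg_max_on (\<lambda>T. \<Sum>j\<in>T. v {j}) {T. T \<subseteq> S \<and> T \<in> I}"

lemma favourite_in:
  assumes "S \<subseteq> {..<m :: nat}" "{} \<in> I"
  shows "favourite I v S \<subseteq> S" "favourite I v S \<in> I"
proof -
  have "favourite I v S \<in> {T. T \<subseteq> S \<and> T \<in> I}"
    unfolding favourite_def using finite_feasible[OF assms(1)] assms(2) by (intro arg_max_on_in) auto
  then show "favourite I v S \<subseteq> S" "favourite I v S \<in> I" by auto
qed

lemma space_valuation_space: "space (valuation_space m) = Pow {..<m} \<rightarrow>\<^sub>E UNIV"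
  by (simp add: valuation_space_def space_PiM)

lemma constrained_val_in_space: "constrained_val m I t \<in> space (valuation_space m)"
  by (simp add: space_valuation_space constrained_val_def)

context constrained_items
begin

lemma constrain_in_space: "constrain I v \<in> space (valuation_space m)"
  unfolding constrain_def by (rule constrained_val_in_space)

lemma constrain_apply:
  assumes "S \<subseteq> {..<m}"
  shows "constrain I v S = Max ((\<lambda>T. \<Sum>j\<in>T. v {j}) ` {T. T \<subseteq> S \<and> T \<in> I})"
proof -
  have "(\<Sum>j\<in>T. singleton_values m v j) = (\<Sum>j\<in>T. v {j})" if "T \<subseteq> S" for T
    using that assms by (intro sum.cong) (auto simp: singleton_values_def)
  then show ?thesis
    unfolding constrain_def constrained_val_apply[OF assms] by (intro arg_cong[of _ _ Max] image_cong) auto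
qed

lemma sum_favourite:
  assumes "S \<subseteq> {..<m}" "{} \<in> I"
  shows "(\<Sum>j\<in>favourite I v S. v {j}) = constrain I v S"
  unfolding constrain_apply[OF assms(1)]
proof (rule antisym)
  show "(\<Sum>j\<in>favourite I v S. v {j}) \<le> Max ((\<lambda>T. \<Sum>j\<in>T. v {j}) ` {T. T \<subseteq> S \<and> T \<in> I})"
    using favourite_in[OF assms] finite_feasible[OF assms(1)] by (intro Max_ge) auto
  show "Max ((\<lambda>T. \<Sum>j\<in>T. v {j}) ` {T. T \<subseteq> S \<and> T \<in> I}) \<le> (\<Sum>j\<in>favourite I v S. v {j})"
    unfolding favourite_def using finite_feasible[OF assms(1)] assms(2)
    by (subst Max_le_iff) (auto intro: arg_max_on_ge[where f = "\<lambda>T. \<Sum>j\<in>T. v {j}"])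
qed

lemma sum_le_constrain:
  assumes "S \<subseteq> {..<m}" "T \<subseteq> S" "T \<in> I"
  shows "(\<Sum>j\<in>T. v {j}) \<le> constrain I v S"
  unfolding constrain_apply[OF assms(1)] using finite_feasible[OF assms(1)] assms by (intro Max_ge) auto

lemma sets_additive_dist [simp, measurable_cong]: "sets additive_dist = sets (valuation_space m)"
  by (simp add: additive_dist_def)

lemma sets_constrained_dist [simp, measurable_cong]: "sets constrained_dist = sets (valuation_space m)"
  by (simp add: constrained_dist_def)

lemma space_additive_dist [simp]: "space additive_dist = space (valuation_space m)"
  by (simp add: additive_dist_def)

lemma space_constrained_dist [simp]: "space constrained_dist = space (valuation_space m)"
  by (simp add: constrained_dist_def)

lemma ball_in_sets: "{w \<in> space (valuation_space m). \<forall>S\<in>Pow {..<m}. \<bar>w S - v S\<bar> < e} \<in> sets (valuation_space m)"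
  by (intro sets.sets_Collect_finite_All borel_measurable_less borel_measurable_abs borel_measurable_diff
      borel_measurable_const measurable_valuation_component[of _ _ m]) auto

lemma type_ball_in_sets:
  "{t \<in> space type_dist. \<forall>j\<in>{..<m}. \<bar>t j - v {j}\<bar> < e} \<in> sets type_dist"
proof -
  have "(\<lambda>t. t j) \<in> borel_measurable type_dist" if "j < m" for j
    using measurable_type_component[OF that] measurable_cong_sets[OF refl sets_item] by blast
  then show ?thesis
    by (intro sets.sets_Collect_finite_All borel_measurable_less borel_measurable_abs borel_measurable_diff
        borel_measurable_const) auto
qed

section \<open>Support points and their constrained versions\<close>

lemma additive_support_ball:
  assumes v: "v \<in> valuation_support m additive_dist" and e: "0 < e"
  shows "0 < measure type_dist {t \<in> space type_dist. \<forall>S\<in>Pow {..<m}. \<bar>additive_val m t S - v S\<bar> < e}"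
proof -
  have "0 < measure additive_dist {w \<in> space (valuation_space m). \<forall>S\<in>Pow {..<m}. \<bar>w S - v S\<bar> < e}"
    using v e by (simp add: valuation_support_def)
  also have "measure additive_dist {w \<in> space (valuation_space m). \<forall>S\<in>Pow {..<m}. \<bar>w S - v S\<bar> < e} =
      measure type_dist (additive_val m -` {w \<in> space (valuation_space m). \<forall>S\<in>Pow {..<m}. \<bar>w S - v S\<bar> < e} \<inter> space type_dist)"
    unfolding additive_dist_def by (rule measure_distr[OF measurable_additive_val_type_dist ball_in_sets])
  also have "additive_val m -` {w \<in> space (valuation_space m). \<forall>S\<in>Pow {..<m}. \<bar>w S - v S\<bar> < e} \<inter> space type_dist =
      {t \<in> space type_dist. \<forall>S\<in>Pow {..<m}. \<bar>additive_val m t S - v S\<bar> < e}"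
    using measurable_space[OF measurable_additive_val_type_dist] by auto
  finally show ?thesis .
qed

text \<open>Every ball around a support point has positive measure and so contains an additive
  valuation; additivity survives the limit.\<close>

lemma additive_support_additive:
  assumes v: "v \<in> valuation_support m additive_dist" and S: "S \<subseteq> {..<m}"
  shows "v S = (\<Sum>j\<in>S. v {j})"
proof -
  have "\<bar>v S - (\<Sum>j\<in>S. v {j})\<bar> \<le> 0 + d" if d: "0 < d" for d
  proof -
    \<comment> \<open>One error e for the bundle and one for each of its at most m items add up to
      at most d.\<close>
    define e where "e = d / (1 + real m)"
    have e: "0 < e" using d by (simp add: e_def)
    have "{t \<in> space type_dist. \<forall>S\<in>Pow {..<m}. \<bar>additive_val m t S - v S\<bar> < e} \<noteq> {}"
      using additive_support_ball[OF v e] by (metis measure_empty less_irrefl)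
    then obtain t where t: "\<And>S. S \<subseteq> {..<m} \<Longrightarrow> \<bar>additive_val m t S - v S\<bar> < e" by blast
    have tS: "additive_val m t S = (\<Sum>j\<in>S. t j)" if "S \<subseteq> {..<m}" for S
      using that by (auto simp: additive_val_def)
    have "\<bar>v S - (\<Sum>j\<in>S. v {j})\<bar> \<le> \<bar>v S - (\<Sum>j\<in>S. t j)\<bar> + \<bar>\<Sum>j\<in>S. t j - v {j}\<bar>"
      by (simp add: sum_subtractf)
    also have "\<dots> \<le> e + (\<Sum>j\<in>S. e)"
    proof (rule add_mono)
      show "\<bar>v S - (\<Sum>j\<in>S. t j)\<bar> \<le> e" using t[OF S] tS[OF S] by simp
      have "\<bar>t j - v {j}\<bar> \<le> e" if "j \<in> S" for j
        using t[of "{j}"] tS[of "{j}"] S that by auto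
      then show "\<bar>\<Sum>j\<in>S. t j - v {j}\<bar> \<le> (\<Sum>j\<in>S. e)"
        by (rule order_trans[OF sum_abs sum_mono])
    qed
    also have "\<dots> \<le> e + real m * e"
      using card_mono[OF _ S] e by simp
    also have "\<dots> = (1 + real m) * e" by (simp add: distrib_right)
    also have "\<dots> = d" by (simp add: e_def)
    finally show ?thesis by simp
  qed
  then have "\<bar>v S - (\<Sum>j\<in>S. v {j})\<bar> \<le> 0" by (rule field_le_epsilon)
  then show ?thesis by simp
qed

text \<open>Needed because BIC and BIR apply only at types in the support. The constraint
  \<open>I\<close> is an atom, and close types have close constrained valuations under
  \<open>I\<close>, so a ball of types around v, paired with \<open>I\<close>, lands in the given
  ball.\<close>

lemma constrain_in_support:
  assumes v: "v \<in> valuation_support m additive_dist" and I: "I \<in> set_pmf C"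
  shows "constrain I v \<in> valuation_support m constrained_dist"
  unfolding valuation_support_def
proof (intro CollectI conjI allI impI)
  show "constrain I v \<in> space constrained_dist" using constrain_in_space by simp
  fix d :: real assume d: "0 < d"
  interpret T: prob_space type_dist by (rule prob_space_type_dist)
  interpret Q: prob_space constraint_dist by (rule prob_space_constraint_dist)
  interpret TQ: pair_prob_space type_dist constraint_dist ..
  \<comment> \<open>The Lipschitz constant is m; the additional 1 makes m * e strictly less than
    d.\<close>
  define e where "e = d / (1 + real m)"
  have e: "0 < e" using d by (simp add: e_def)
  define E where "E = {t \<in> space type_dist. \<forall>j\<in>{..<m}. \<bar>t j - v {j}\<bar> < e}"
  have E: "E \<in> sets type_dist" unfolding E_def by (rule type_ball_in_sets)
  have "0 < measure type_dist {t \<in> space type_dist. \<forall>S\<in>Pow {..<m}. \<bar>additive_val m t S - v S\<bar> < e}"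
    by (rule additive_support_ball[OF v e])
  also have "\<dots> \<le> measure type_dist E"
  proof (rule T.finite_measure_mono[OF _ E], safe)
    fix t assume t: "t \<in> space type_dist" "\<forall>S\<in>Pow {..<m}. \<bar>additive_val m t S - v S\<bar> < e"
    have "additive_val m t {j} = t j" if "j < m" for j using that by (auto simp: additive_val_def)
    then have "\<bar>t j - v {j}\<bar> < e" if "j < m" for j
      using t(2)[THEN bspec, of "{j}"] that by auto
    then show "t \<in> E" using t by (simp add: E_def)
  qed
  finally have E_pos: "0 < measure type_dist E" .
  have I_sets: "{I} \<in> sets constraint_dist" using I by simp
  have "emeasure constraint_dist {I} = ennreal (pmf C I)"
  proof -
    have "emeasure constraint_dist {I} = (\<integral>\<^sup>+J. indicator {I} J \<partial>constraint_dist)"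
      using I_sets by simp
    also have "\<dots> = (\<Sum>J\<in>set_pmf C. indicator {I} J * ennreal (pmf C J))"
      by (rule nn_integral_constraint_dist)
    also have "\<dots> = ennreal (pmf C I)"
      using I by (subst sum.remove[of _ I]) auto
    finally show ?thesis .
  qed
  then have I_pos: "0 < measure constraint_dist {I}"
    using I by (simp add: measure_def pmf_positive)
  define B where "B = {w \<in> space (valuation_space m). \<forall>S\<in>Pow {..<m}. \<bar>w S - constrain I v S\<bar> < d}"
  have B: "B \<in> sets (valuation_space m)" unfolding B_def by (rule ball_in_sets)
  note meas = measurable_constrained_val_constraint_dist
  have "E \<times> {I} \<subseteq> (\<lambda>(t, I). constrained_val m I t) -` B \<inter> space (type_dist \<Otimes>\<^sub>M constraint_dist)"
  proof (rule subsetI)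
    fix p assume "p \<in> E \<times> {I}"
    then obtain t where p: "p = (t, I)" and t: "t \<in> E" by auto
    have "(t, I) \<in> space (type_dist \<Otimes>\<^sub>M constraint_dist)"
      using t I by (simp add: space_pair_measure E_def)
    moreover have "\<bar>constrained_val m I t S - constrain I v S\<bar> < d" if S: "S \<in> Pow {..<m}" for S
    proof -
      have tv: "\<bar>t j - singleton_values m v j\<bar> \<le> e" "\<bar>singleton_values m v j - t j\<bar> \<le> e" if "j < m" for j
        using t that by (auto simp: E_def singleton_values_def abs_minus_commute intro!: less_imp_le)
      have "real m * e < d" using d by (simp add: e_def field_simps)
      then show ?thesis
        unfolding constrain_def
        using constrained_val_diff_le[of S m I t "singleton_values m v" e]
          constrained_val_diff_le[of S m I "singleton_values m v" t e] S tv empty_feasible[OF I] e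
        by auto
    qed
    ultimately show "p \<in> (\<lambda>(t, I). constrained_val m I t) -` B \<inter> space (type_dist \<Otimes>\<^sub>M constraint_dist)"
      by (simp add: p B_def constrained_val_in_space)
  qed
  then have "measure (type_dist \<Otimes>\<^sub>M constraint_dist) (E \<times> {I}) \<le> measure constrained_dist B"
    unfolding constrained_dist_eq measure_distr[OF meas B]
    by (intro TQ.finite_measure_mono measurable_sets[OF meas B])
  moreover have "measure (type_dist \<Otimes>\<^sub>M constraint_dist) (E \<times> {I}) = measure type_dist E * measure constraint_dist {I}"
    by (simp only: measure_def Q.emeasure_pair_measure_Times[OF E I_sets] enn2real_mult)
  ultimately show "0 < measure constrained_dist {w \<in> space constrained_dist. \<forall>S\<in>Pow {..<m}. \<bar>w S - constrain I v S\<bar> < d}"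
    using mult_pos_pos[OF E_pos I_pos] by (simp add: B_def)
qed

end

lemma measurable_favourite:
  assumes f: "f \<in> L \<rightarrow>\<^sub>M valuation_space m" and g: "g \<in> L \<rightarrow>\<^sub>M count_space Y"
    and h: "h \<in> L \<rightarrow>\<^sub>M count_space (Pow {..<m})"
    and Y: "finite Y" "\<And>I. I \<in> Y \<Longrightarrow> {} \<in> I"
  shows "(\<lambda>x. favourite (g x) (f x) (h x)) \<in> L \<rightarrow>\<^sub>M count_space (Pow {..<m})"
proof (rule measurable_compose_countable'[OF measurable_compose_countable'[OF _ h] g])
  fix I S assume IS: "I \<in> Y" "S \<in> Pow {..<m}"
  show "(\<lambda>x. favourite I (f x) S) \<in> L \<rightarrow>\<^sub>M count_space (Pow {..<m})"
    unfolding favourite_def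
  proof (rule measurable_arg_max_on)
    show "(\<lambda>x. \<Sum>j\<in>T. f x {j}) \<in> borel_measurable L" if "T \<in> {T. T \<subseteq> S \<and> T \<in> I}" for T
      using that IS by (intro borel_measurable_sum measurable_valuation_component[OF f]) auto
  qed (use IS Y finite_feasible[of S m I] in auto)
qed (use Y in \<open>auto intro: countable_finite\<close>)

lemma measurable_outcome_component:
  assumes \<psi>: "\<And>S. S \<subseteq> {..<m} \<Longrightarrow> \<psi> S \<in> borel_measurable borel" and i: "i < n"
  shows "(\<lambda>(A, p). \<psi> (A i) (p i)) \<in> borel_measurable (outcome_space m n)"
  unfolding split_beta'
proof (rule measurable_compose_countable'[where g = "\<lambda>x. fst x i" and I = "Pow {..<m}"])
  have "(\<lambda>x. snd x i) \<in> borel_measurable (outcome_space m n)"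
    unfolding outcome_space_def using i
    by (intro measurable_compose[OF measurable_snd] measurable_component_singleton) auto
  then show "(\<lambda>x. \<psi> S (snd x i)) \<in> borel_measurable (outcome_space m n)" if "S \<in> Pow {..<m}" for S
    using measurable_compose[OF _ \<psi>[of S]] that by simp
  show "(\<lambda>x. fst x i) \<in> outcome_space m n \<rightarrow>\<^sub>M count_space (Pow {..<m})"
    unfolding outcome_space_def using allocationsD(1)[of _ m n i] i
    by (intro measurable_compose[OF measurable_fst]) auto
qed (auto intro: countable_finite)

section \<open>The reduction as a mechanism for additive bidders\<close>

context constrained_items
begin

abbreviation profile_space :: "nat \<Rightarrow> (nat \<Rightarrow> valuation) measure" where
  "profile_space n \<equiv> \<Pi>\<^sub>M i\<in>{..<n}. valuation_space m"

abbreviation constraint_profile :: "nat set \<Rightarrow> (nat \<Rightarrow> nat set set) measure" where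
  "constraint_profile N \<equiv> \<Pi>\<^sub>M i\<in>N. constraint_dist"

text \<open>
  The seller runs a mechanism \<open>M\<close> for constrained bidders on additive ones: she draws a constraint
  for each bidder herself, and hands over only the favourite feasible part of the bundle that \<open>M\<close>
  allocates. Lying to the seller then amounts to lying to \<open>M\<close>.
\<close>

definition reduction_kernel ::
    "nat \<Rightarrow> mechanism \<Rightarrow> (nat \<Rightarrow> valuation) \<Rightarrow> (nat \<Rightarrow> nat set set) \<Rightarrow> (allocation \<times> payments) measure" where
  "reduction_kernel n M b \<I> =
     distr (M (\<lambda>i\<in>{..<n}. constrain (\<I> i) (b i))) (outcome_space m n)
       (\<lambda>(A, p). (\<lambda>i\<in>{..<n}. favourite (\<I> i) (b i) (A i), p))"

definition reduction :: "nat \<Rightarrow> mechanism \<Rightarrow> mechanism" where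
  "reduction n M b = constraint_profile {..<n} \<bind> reduction_kernel n M b"

lemma prob_space_constraint_profile: "prob_space (constraint_profile N)"
  by (intro prob_space_PiM prob_space_constraint_dist)

lemma measurable_constrain': "(\<lambda>(v, I). constrain I v) \<in> valuation_space m \<Otimes>\<^sub>M constraint_dist \<rightarrow>\<^sub>M valuation_space m"
  using measurable_constrain
    measurable_cong_sets[OF sets_pair_measure_cong[OF sets_additive_dist refl, of constraint_dist] refl] by blast

lemma measurable_constrain_profile:
  "(\<lambda>(b, \<I>). \<lambda>i\<in>N. constrain (\<I> i) (b i)) \<in>
    (\<Pi>\<^sub>M i\<in>N. valuation_space m) \<Otimes>\<^sub>M constraint_profile N \<rightarrow>\<^sub>M (\<Pi>\<^sub>M i\<in>N. valuation_space m)"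
  unfolding split_beta'
proof (rule measurable_restrict)
  fix i assume i: "i \<in> N"
  have "(\<lambda>x. (fst x i, snd x i)) \<in>
      (\<Pi>\<^sub>M i\<in>N. valuation_space m) \<Otimes>\<^sub>M constraint_profile N \<rightarrow>\<^sub>M valuation_space m \<Otimes>\<^sub>M constraint_dist"
    using i by (intro measurable_Pair measurable_compose[OF measurable_fst] measurable_compose[OF measurable_snd]
        measurable_component_singleton)
  from measurable_compose[OF this measurable_constrain']
  show "(\<lambda>x. constrain (snd x i) (fst x i)) \<in> (\<Pi>\<^sub>M i\<in>N. valuation_space m) \<Otimes>\<^sub>M constraint_profile N \<rightarrow>\<^sub>M valuation_space m"
    by simp
qed

text \<open>Parts of disjoint bundles are disjoint, so the result is again an allocation.
  Measurability is shown bidder by bidder and carried over to the discrete space of allocations,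
  which is finite.\<close>

lemma measurable_favourite_outcome:
  "(\<lambda>x. (\<lambda>i\<in>{..<n}. favourite (snd (fst x) i) (fst (fst x) i) (fst (snd x) i), snd (snd x))) \<in>
    (profile_space n \<Otimes>\<^sub>M constraint_profile {..<n}) \<Otimes>\<^sub>M outcome_space m n \<rightarrow>\<^sub>M outcome_space m n"
  (is "(\<lambda>x. (?A x, _)) \<in> ?L \<rightarrow>\<^sub>M _")
proof -
  have comp: "(\<lambda>x. favourite (snd (fst x) i) (fst (fst x) i) (fst (snd x) i)) \<in> ?L \<rightarrow>\<^sub>M count_space (Pow {..<m})"
    if i: "i \<in> {..<n}" for i
  proof (rule measurable_favourite[where Y = "set_pmf C"])
    show "(\<lambda>x. fst (fst x) i) \<in> ?L \<rightarrow>\<^sub>M valuation_space m"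
      using i by (intro measurable_compose[OF measurable_fst] measurable_component_singleton)
    have "(\<lambda>x. snd (fst x) i) \<in> ?L \<rightarrow>\<^sub>M constraint_dist"
      using i by (intro measurable_compose[OF measurable_fst] measurable_compose[OF measurable_snd]
          measurable_component_singleton)
    then show "(\<lambda>x. snd (fst x) i) \<in> ?L \<rightarrow>\<^sub>M count_space (set_pmf C)"
      using measurable_cong_sets[OF refl sets_constraint_dist] by blast
    show "(\<lambda>x. fst (snd x) i) \<in> ?L \<rightarrow>\<^sub>M count_space (Pow {..<m})"
      unfolding outcome_space_def using allocationsD(1)[of _ m n i] i
      by (intro measurable_compose[OF measurable_snd] measurable_compose[OF measurable_fst]) auto
  qed (use empty_feasible in auto)
  have "?A \<in> ?L \<rightarrow>\<^sub>M (\<Pi>\<^sub>M i\<in>{..<n}. count_space (Pow {..<m}))"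
    by (intro measurable_restrict comp)
  then have A: "?A \<in> ?L \<rightarrow>\<^sub>M count_space ({..<n} \<rightarrow>\<^sub>E Pow {..<m})"
    by (subst (asm) count_space_PiM_finite) (auto intro: countable_finite)
  have "?A \<in> ?L \<rightarrow>\<^sub>M count_space (allocations m n)"
    unfolding measurable_count_space_eq2[OF finite_allocations]
  proof (intro conjI ballI)
    show "?A -` {a} \<inter> space ?L \<in> sets ?L" if "a \<in> allocations m n" for a
      using measurable_sets[OF A, of "{a}"] that by (auto simp: allocations_def)
    show "?A \<in> space ?L \<rightarrow> allocations m n"
    proof
      fix x assume x: "x \<in> space ?L"
      then have xA: "fst (snd x) \<in> allocations m n" and I: "\<And>i. i < n \<Longrightarrow> snd (fst x) i \<in> set_pmf C"
        by (auto simp: space_pair_measure outcome_space_def space_PiM)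
      have sub: "favourite (snd (fst x) i) (fst (fst x) i) (fst (snd x) i) \<subseteq> fst (snd x) i" if "i < n" for i
        using favourite_in(1)[OF allocationsD(1)[OF xA that] empty_feasible[OF I[OF that]]] .
      show "?A x \<in> allocations m n"
      proof (rule allocationsI)
        show "?A x i \<subseteq> {..<m}" if "i < n" for i
          using sub[OF that] allocationsD(1)[OF xA that] that by auto
        show "i = l" if "i < n" "l < n" "y \<in> ?A x i" "y \<in> ?A x l" for i l y
          using allocationsD(3)[OF xA that(1,2), of y] sub that by auto
      qed auto
    qed
  qed
  moreover have "(\<lambda>x. snd (snd x)) \<in> ?L \<rightarrow>\<^sub>M (\<Pi>\<^sub>M i\<in>{..<n}. borel)"
    unfolding outcome_space_def by (intro measurable_compose[OF measurable_snd] measurable_snd)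
  ultimately have "(\<lambda>x. (?A x, snd (snd x))) \<in> ?L \<rightarrow>\<^sub>M count_space (allocations m n) \<Otimes>\<^sub>M (\<Pi>\<^sub>M i\<in>{..<n}. borel)"
    by (rule measurable_Pair)
  then show ?thesis by (simp add: outcome_space_def)
qed

context
  fixes n :: nat and M :: mechanism
  assumes mech: "is_mechanism m n M"
begin

lemma measurable_mechanism: "M \<in> profile_space n \<rightarrow>\<^sub>M prob_algebra (outcome_space m n)"
  using mech by (simp add: is_mechanism_def)

lemma measurable_reduction_kernel:
  "(\<lambda>(b, \<I>). reduction_kernel n M b \<I>) \<in>
    profile_space n \<Otimes>\<^sub>M constraint_profile {..<n} \<rightarrow>\<^sub>M prob_algebra (outcome_space m n)"
  unfolding reduction_kernel_def split_beta'
proof (rule measurable_distr_prob_space2)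
  show "(\<lambda>x. M (\<lambda>i\<in>{..<n}. constrain (snd x i) (fst x i))) \<in>
      profile_space n \<Otimes>\<^sub>M constraint_profile {..<n} \<rightarrow>\<^sub>M prob_algebra (outcome_space m n)"
    using measurable_compose[OF measurable_constrain_profile measurable_mechanism] by (simp add: split_beta')
qed (use measurable_favourite_outcome in \<open>simp add: split_beta'\<close>)

lemma measurable_reduction_kernel_snd:
  assumes "b \<in> space (profile_space n)"
  shows "reduction_kernel n M b \<in> constraint_profile {..<n} \<rightarrow>\<^sub>M prob_algebra (outcome_space m n)"
  using measurable_compose[OF measurable_Pair1'[OF assms] measurable_reduction_kernel] by simp

lemma measurable_reduction: "reduction n M \<in> profile_space n \<rightarrow>\<^sub>M prob_algebra (outcome_space m n)"
  unfolding reduction_def[abs_def]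
proof (rule measurable_bind_prob_space2)
  show "(\<lambda>b. constraint_profile {..<n}) \<in> profile_space n \<rightarrow>\<^sub>M prob_algebra (constraint_profile {..<n})"
    by (rule measurable_const) (simp add: space_prob_algebra prob_space_constraint_profile)
qed (rule measurable_reduction_kernel)

lemma nn_integral_reduction_kernel:
  assumes b: "b \<in> space (profile_space n)" and \<I>: "\<I> \<in> space (constraint_profile {..<n})"
    and h: "h \<in> borel_measurable (outcome_space m n)"
  shows "(\<integral>\<^sup>+x. h x \<partial>reduction_kernel n M b \<I>) =
    (\<integral>\<^sup>+(A, p). h (\<lambda>i\<in>{..<n}. favourite (\<I> i) (b i) (A i), p) \<partial>M (\<lambda>i\<in>{..<n}. constrain (\<I> i) (b i)))"
proof -
  have "(b, \<I>) \<in> space (profile_space n \<Otimes>\<^sub>M constraint_profile {..<n})"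
    using b \<I> by (simp add: space_pair_measure)
  from measurable_compose[OF measurable_Pair1'[OF this] measurable_favourite_outcome[of n]]
  have f: "(\<lambda>(A, p). (\<lambda>i\<in>{..<n}. favourite (\<I> i) (b i) (A i), p)) \<in> outcome_space m n \<rightarrow>\<^sub>M outcome_space m n"
    by (simp add: split_beta')
  have "(\<lambda>i\<in>{..<n}. constrain (\<I> i) (b i)) \<in> space (profile_space n)"
    using constrain_in_space by (auto simp: space_PiM)
  then have "sets (M (\<lambda>i\<in>{..<n}. constrain (\<I> i) (b i))) = sets (outcome_space m n)"
    using measurable_space[OF measurable_mechanism] by (auto simp: space_prob_algebra)
  with f have "(\<lambda>(A, p). (\<lambda>i\<in>{..<n}. favourite (\<I> i) (b i) (A i), p)) \<in>
      M (\<lambda>i\<in>{..<n}. constrain (\<I> i) (b i)) \<rightarrow>\<^sub>M outcome_space m n"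
    using measurable_cong_sets by blast
  from nn_integral_distr[OF this, of h] h show ?thesis
    by (simp add: reduction_kernel_def split_beta')
qed

lemma nn_integral_reduction:
  assumes b: "b \<in> space (profile_space n)" and h: "h \<in> borel_measurable (outcome_space m n)"
  shows "(\<integral>\<^sup>+x. h x \<partial>reduction n M b) = (\<integral>\<^sup>+\<I>. \<integral>\<^sup>+x. h x \<partial>reduction_kernel n M b \<I> \<partial>constraint_profile {..<n})"
  unfolding reduction_def
  by (rule nn_integral_bind[OF h measurable_prob_algebraD[OF measurable_reduction_kernel_snd[OF b]]])

section \<open>Outcome laws of the reduction\<close>

lemma distr_constrain_profile:
  assumes "finite N"
  shows "distr ((\<Pi>\<^sub>M i\<in>N. additive_dist) \<Otimes>\<^sub>M constraint_profile N) (\<Pi>\<^sub>M i\<in>N. valuation_space m)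
      (\<lambda>(b, \<I>). \<lambda>i\<in>N. constrain (\<I> i) (b i)) = (\<Pi>\<^sub>M i\<in>N. constrained_dist)"
  using distr_pair_PiM_zip[OF assms, of additive_dist constraint_dist, OF _ _ measurable_constrain]
    valuations_of_items_additive prob_space_constraint_dist
  by (simp add: valuations_of_items_def distr_constrain)

lemma nn_integral_constrain_profile:
  assumes "finite N" and h: "h \<in> borel_measurable (\<Pi>\<^sub>M i\<in>N. valuation_space m)"
  shows "(\<integral>\<^sup>+b. \<integral>\<^sup>+\<I>. h (\<lambda>i\<in>N. constrain (\<I> i) (b i)) \<partial>constraint_profile N \<partial>(\<Pi>\<^sub>M i\<in>N. additive_dist)) =
    (\<integral>\<^sup>+w. h w \<partial>(\<Pi>\<^sub>M i\<in>N. constrained_dist))"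
proof -
  interpret Q: prob_space "constraint_profile N" by (rule prob_space_constraint_profile)
  have "sets ((\<Pi>\<^sub>M i\<in>N. additive_dist) \<Otimes>\<^sub>M constraint_profile N) =
      sets ((\<Pi>\<^sub>M i\<in>N. valuation_space m) \<Otimes>\<^sub>M constraint_profile N)"
    by (intro sets_pair_measure_cong sets_PiM_cong refl) auto
  then have meas: "(\<lambda>(b, \<I>). \<lambda>i\<in>N. constrain (\<I> i) (b i)) \<in>
      (\<Pi>\<^sub>M i\<in>N. additive_dist) \<Otimes>\<^sub>M constraint_profile N \<rightarrow>\<^sub>M (\<Pi>\<^sub>M i\<in>N. valuation_space m)"
    using measurable_constrain_profile measurable_cong_sets by blast
  have "(\<integral>\<^sup>+w. h w \<partial>(\<Pi>\<^sub>M i\<in>N. constrained_dist)) =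
      (\<integral>\<^sup>+x. h (\<lambda>i\<in>N. constrain (snd x i) (fst x i)) \<partial>((\<Pi>\<^sub>M i\<in>N. additive_dist) \<Otimes>\<^sub>M constraint_profile N))"
    using nn_integral_distr[OF meas, of h] h distr_constrain_profile[OF \<open>finite N\<close>] by (simp add: split_beta')
  also have "\<dots> = (\<integral>\<^sup>+b. \<integral>\<^sup>+\<I>. h (\<lambda>i\<in>N. constrain (\<I> i) (b i)) \<partial>constraint_profile N \<partial>(\<Pi>\<^sub>M i\<in>N. additive_dist))"
    using measurable_compose[OF meas h] by (subst Q.nn_integral_fst[symmetric]) (auto simp: split_beta')
  finally show ?thesis by simp
qed

text \<open>Truthful additive bids with independent constraints are passed on as i.i.d. constrained
  bids, and payments are not touched. Hence revenue and the expected negative parts of payments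
  carry over.\<close>

lemma nn_integral_truthful_reduction:
  assumes i: "i < n" and g: "g \<in> borel_measurable borel"
  shows "(\<integral>\<^sup>+(A, p). g (p i) \<partial>truthful_outcome n (reduction n M) additive_dist) =
    (\<integral>\<^sup>+(A, p). g (p i) \<partial>truthful_outcome n M constrained_dist)"
proof -
  have h: "(\<lambda>(A, p). g (p i)) \<in> borel_measurable (outcome_space m n)"
    using measurable_outcome_component[of m "\<lambda>_. g", OF g i] .
  have PA: "sets (\<Pi>\<^sub>M i\<in>{..<n}. additive_dist) = sets (profile_space n)"
    and PC: "sets (\<Pi>\<^sub>M i\<in>{..<n}. constrained_dist) = sets (profile_space n)"
    by (intro sets_PiM_cong; simp)+
  have red: "reduction n M \<in> (\<Pi>\<^sub>M i\<in>{..<n}. additive_dist) \<rightarrow>\<^sub>M subprob_algebra (outcome_space m n)"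
    using measurable_prob_algebraD[OF measurable_reduction] measurable_cong_sets[OF PA refl] by blast
  have M: "M \<in> (\<Pi>\<^sub>M i\<in>{..<n}. constrained_dist) \<rightarrow>\<^sub>M subprob_algebra (outcome_space m n)"
    using measurable_prob_algebraD[OF measurable_mechanism] measurable_cong_sets[OF PC refl] by blast
  have Mh: "(\<lambda>w. \<integral>\<^sup>+(A, p). g (p i) \<partial>M w) \<in> borel_measurable (profile_space n)"
    by (rule measurable_compose[OF measurable_prob_algebraD[OF measurable_mechanism]
          nn_integral_measurable_subprob_algebra[OF h]])
  have "(\<integral>\<^sup>+(A, p). g (p i) \<partial>truthful_outcome n (reduction n M) additive_dist) =
      (\<integral>\<^sup>+b. \<integral>\<^sup>+(A, p). g (p i) \<partial>reduction n M b \<partial>(\<Pi>\<^sub>M i\<in>{..<n}. additive_dist))"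
    unfolding truthful_outcome_def by (rule nn_integral_bind[OF h red])
  also have "\<dots> = (\<integral>\<^sup>+b. \<integral>\<^sup>+\<I>. \<integral>\<^sup>+(A, p). g (p i) \<partial>M (\<lambda>i\<in>{..<n}. constrain (\<I> i) (b i))
      \<partial>constraint_profile {..<n} \<partial>(\<Pi>\<^sub>M i\<in>{..<n}. additive_dist))"
  proof (rule nn_integral_cong)
    fix b assume "b \<in> space (\<Pi>\<^sub>M i\<in>{..<n}. additive_dist)"
    then have b: "b \<in> space (profile_space n)" using sets_eq_imp_space_eq[OF PA] by simp
    show "(\<integral>\<^sup>+(A, p). g (p i) \<partial>reduction n M b) =
        (\<integral>\<^sup>+\<I>. \<integral>\<^sup>+(A, p). g (p i) \<partial>M (\<lambda>i\<in>{..<n}. constrain (\<I> i) (b i)) \<partial>constraint_profile {..<n})"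
      unfolding nn_integral_reduction[OF b h]
      by (intro nn_integral_cong) (subst nn_integral_reduction_kernel[OF b _ h], simp_all)
  qed
  also have "\<dots> = (\<integral>\<^sup>+w. \<integral>\<^sup>+(A, p). g (p i) \<partial>M w \<partial>(\<Pi>\<^sub>M i\<in>{..<n}. constrained_dist))"
    by (rule nn_integral_constrain_profile[OF _ Mh]) simp
  also have "\<dots> = (\<integral>\<^sup>+(A, p). g (p i) \<partial>truthful_outcome n M constrained_dist)"
    unfolding truthful_outcome_def by (rule nn_integral_bind[OF h M, symmetric])
  finally show ?thesis .
qed

lemma measurable_update_profile:
  assumes "i < n" "b \<in> space (valuation_space m)"
  shows "(\<lambda>w. w(i := b)) \<in> (\<Pi>\<^sub>M l\<in>{..<n} - {i}. valuation_space m) \<rightarrow>\<^sub>M profile_space n"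
  using assms by (intro measurable_fun_upd[where J = "{..<n} - {i}"] measurable_const) auto

text \<open>Given the constraint \<open>I\<close> drawn for bidder i, the outcome is that of
  \<open>M\<close> when i bids \<open>constrain I b\<close> against truthful constrained bidders,
  except that i gets the favourite part only. Averaging over \<open>I\<close> produces the weights.
  With \<psi> general, all nonnegative functions of the utility are covered at once.\<close>

lemma nn_integral_interim_reduction:
  assumes i: "i < n" and b: "b \<in> space (valuation_space m)"
    and \<psi>: "\<And>S. S \<subseteq> {..<m} \<Longrightarrow> \<psi> S \<in> borel_measurable borel"
  shows "(\<integral>\<^sup>+(A, p). \<psi> (A i) (p i) \<partial>interim_outcome n (reduction n M) additive_dist i b) =
    (\<Sum>I\<in>set_pmf C. (\<integral>\<^sup>+(A, p). \<psi> (favourite I b (A i)) (p i)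
      \<partial>interim_outcome n M constrained_dist i (constrain I b)) * ennreal (pmf C I))"
proof -
  define N where "N = {..<n} - {i}"
  have N: "finite N" "i \<notin> N" and ins: "insert i N = {..<n}" using i by (auto simp: N_def)
  interpret Q: prob_space constraint_dist by (rule prob_space_constraint_dist)
  interpret PQ: product_prob_space "\<lambda>_. constraint_dist" N ..
  define h where "h = (\<lambda>(A :: allocation, p :: payments). \<psi> (A i) (p i))"
  have h: "h \<in> borel_measurable (outcome_space m n)"
    unfolding h_def by (rule measurable_outcome_component[OF \<psi> i])
  define h' where "h' = (\<lambda>I (A :: allocation, p :: payments). \<psi> (favourite I b (A i)) (p i))"
  have h': "h' I \<in> borel_measurable (outcome_space m n)" if I: "I \<in> set_pmf C" for I
    unfolding h'_def
  proof (rule measurable_outcome_component[OF _ i])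
    show "\<psi> (favourite I b S) \<in> borel_measurable borel" if "S \<subseteq> {..<m}" for S
      using favourite_in(1)[OF that empty_feasible[OF I], of b] that by (intro \<psi>) auto
  qed
  define \<phi> where "\<phi> = (\<lambda>I w. \<integral>\<^sup>+x. h' I x \<partial>M (w(i := constrain I b)))"
  have PA: "sets (\<Pi>\<^sub>M l\<in>N. additive_dist) = sets (\<Pi>\<^sub>M l\<in>N. valuation_space m)"
    and PC: "sets (\<Pi>\<^sub>M l\<in>N. constrained_dist) = sets (\<Pi>\<^sub>M l\<in>N. valuation_space m)"
    by (intro sets_PiM_cong; simp)+
  have upd: "(\<lambda>w. w(i := v)) \<in> (\<Pi>\<^sub>M l\<in>N. valuation_space m) \<rightarrow>\<^sub>M profile_space n"
    if "v \<in> space (valuation_space m)" for v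
    unfolding N_def by (rule measurable_update_profile[OF i that])
  have Mupd: "(\<lambda>w. M (w(i := constrain I b))) \<in> (\<Pi>\<^sub>M l\<in>N. valuation_space m) \<rightarrow>\<^sub>M subprob_algebra (outcome_space m n)" for I
    by (rule measurable_compose[OF upd[OF constrain_in_space] measurable_prob_algebraD[OF measurable_mechanism]])
  have \<phi>: "\<phi> I \<in> borel_measurable (\<Pi>\<^sub>M l\<in>N. valuation_space m)" if "I \<in> set_pmf C" for I
    unfolding \<phi>_def
    by (rule measurable_compose[OF Mupd nn_integral_measurable_subprob_algebra[OF h'[OF that]]])
  have \<phi>_zip: "(\<lambda>x. \<phi> I (\<lambda>l\<in>N. constrain (snd x l) (fst x l))) \<in>
      borel_measurable ((\<Pi>\<^sub>M l\<in>N. additive_dist) \<Otimes>\<^sub>M constraint_profile N)" if "I \<in> set_pmf C" for I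
    using measurable_compose[OF measurable_constrain_profile \<phi>[OF that]]
      measurable_cong_sets[OF sets_pair_measure_cong[OF PA refl, of "constraint_profile N"] refl]
    by (simp add: split_beta')
  have red: "(\<lambda>w. reduction n M (w(i := b))) \<in> (\<Pi>\<^sub>M l\<in>N. additive_dist) \<rightarrow>\<^sub>M subprob_algebra (outcome_space m n)"
    using measurable_compose[OF upd[OF b] measurable_prob_algebraD[OF measurable_reduction]]
      measurable_cong_sets[OF PA refl] by blast
  have inner: "(\<integral>\<^sup>+x. h x \<partial>reduction n M (w(i := b))) =
      (\<Sum>I\<in>set_pmf C. (\<integral>\<^sup>+\<I>. \<phi> I (\<lambda>l\<in>N. constrain (\<I> l) (w l)) \<partial>constraint_profile N) * ennreal (pmf C I))"
    if w: "w \<in> space (\<Pi>\<^sub>M l\<in>N. additive_dist)" for w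
  proof -
    have w': "w \<in> space (\<Pi>\<^sub>M l\<in>N. valuation_space m)" using w sets_eq_imp_space_eq[OF PA] by simp
    have wb: "w(i := b) \<in> space (profile_space n)"
      using measurable_space[OF upd[OF b] w'] .
    define G where "G = (\<lambda>\<I>. \<integral>\<^sup>+x. h x \<partial>reduction_kernel n M (w(i := b)) \<I>)"
    have G: "G \<in> borel_measurable (constraint_profile (insert i N))"
      unfolding G_def ins
      by (rule measurable_compose[OF measurable_prob_algebraD[OF measurable_reduction_kernel_snd[OF wb]]
            nn_integral_measurable_subprob_algebra[OF h]])
    have "(\<integral>\<^sup>+x. h x \<partial>reduction n M (w(i := b))) = (\<integral>\<^sup>+\<I>. G \<I> \<partial>constraint_profile (insert i N))"
      unfolding nn_integral_reduction[OF wb h] G_def ins ..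
    also have "\<dots> = (\<integral>\<^sup>+I. \<integral>\<^sup>+\<I>. G (\<I>(i := I)) \<partial>constraint_profile N \<partial>constraint_dist)"
      by (rule PQ.product_nn_integral_insert_rev[OF N G])
    also have "\<dots> = (\<integral>\<^sup>+I. \<integral>\<^sup>+\<I>. \<phi> I (\<lambda>l\<in>N. constrain (\<I> l) (w l)) \<partial>constraint_profile N \<partial>constraint_dist)"
    proof (intro nn_integral_cong)
      fix I \<I> assume I: "I \<in> space constraint_dist" and \<I>: "\<I> \<in> space (constraint_profile N)"
      have "\<I>(i := I) \<in> space (constraint_profile (insert i N))"
        using I \<I> by (auto simp: space_PiM PiE_def extensional_def)
      then have \<I>I: "\<I>(i := I) \<in> space (constraint_profile {..<n})" by (simp add: ins)
      have "(\<lambda>l\<in>{..<n}. constrain ((\<I>(i := I)) l) ((w(i := b)) l)) =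
          (\<lambda>l\<in>N. constrain (\<I> l) (w l))(i := constrain I b)"
        using i by (auto simp: N_def fun_eq_iff)
      then show "G (\<I>(i := I)) = \<phi> I (\<lambda>l\<in>N. constrain (\<I> l) (w l))"
        unfolding G_def \<phi>_def nn_integral_reduction_kernel[OF wb \<I>I h]
        using i by (simp add: h_def h'_def)
    qed
    also have "\<dots> = (\<Sum>I\<in>set_pmf C. (\<integral>\<^sup>+\<I>. \<phi> I (\<lambda>l\<in>N. constrain (\<I> l) (w l)) \<partial>constraint_profile N) * ennreal (pmf C I))"
      by (rule nn_integral_constraint_dist)
    finally show ?thesis .
  qed
  have "(\<integral>\<^sup>+x. h x \<partial>interim_outcome n (reduction n M) additive_dist i b) =
      (\<integral>\<^sup>+w. \<integral>\<^sup>+x. h x \<partial>reduction n M (w(i := b)) \<partial>(\<Pi>\<^sub>M l\<in>N. additive_dist))"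
    unfolding interim_outcome_def N_def[symmetric] by (rule nn_integral_bind[OF h red])
  also have "\<dots> = (\<integral>\<^sup>+w. (\<Sum>I\<in>set_pmf C. (\<integral>\<^sup>+\<I>. \<phi> I (\<lambda>l\<in>N. constrain (\<I> l) (w l)) \<partial>constraint_profile N) * ennreal (pmf C I))
      \<partial>(\<Pi>\<^sub>M l\<in>N. additive_dist))"
    by (intro nn_integral_cong inner)
  also have "\<dots> = (\<Sum>I\<in>set_pmf C. (\<integral>\<^sup>+w. \<integral>\<^sup>+\<I>. \<phi> I (\<lambda>l\<in>N. constrain (\<I> l) (w l)) \<partial>constraint_profile N
      \<partial>(\<Pi>\<^sub>M l\<in>N. additive_dist)) * ennreal (pmf C I))"
  proof -
    have "(\<lambda>w. \<integral>\<^sup>+\<I>. \<phi> I (\<lambda>l\<in>N. constrain (\<I> l) (w l)) \<partial>constraint_profile N) \<in>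
        borel_measurable (\<Pi>\<^sub>M l\<in>N. additive_dist)" if "I \<in> set_pmf C" for I
      using PQ.borel_measurable_nn_integral_fst[OF \<phi>_zip[OF that]] by simp
    then show ?thesis
      by (subst nn_integral_sum) (auto simp: nn_integral_multc)
  qed
  also have "\<dots> = (\<Sum>I\<in>set_pmf C. (\<integral>\<^sup>+w. \<phi> I w \<partial>(\<Pi>\<^sub>M l\<in>N. constrained_dist)) * ennreal (pmf C I))"
    using nn_integral_constrain_profile[OF N(1) \<phi>] by (intro sum.cong) auto
  also have "\<dots> = (\<Sum>I\<in>set_pmf C. (\<integral>\<^sup>+x. h' I x
      \<partial>interim_outcome n M constrained_dist i (constrain I b)) * ennreal (pmf C I))"
  proof (rule sum.cong[OF refl])
    fix I assume I: "I \<in> set_pmf C"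
    have "(\<lambda>w. M (w(i := constrain I b))) \<in> (\<Pi>\<^sub>M l\<in>N. constrained_dist) \<rightarrow>\<^sub>M subprob_algebra (outcome_space m n)"
      using Mupd measurable_cong_sets[OF PC refl] by blast
    from nn_integral_bind[OF h'[OF I] this]
    show "(\<integral>\<^sup>+w. \<phi> I w \<partial>(\<Pi>\<^sub>M l\<in>N. constrained_dist)) * ennreal (pmf C I) =
        (\<integral>\<^sup>+x. h' I x \<partial>interim_outcome n M constrained_dist i (constrain I b)) * ennreal (pmf C I)"
      by (simp add: interim_outcome_def N_def[symmetric] \<phi>_def)
  qed
  finally show ?thesis by (simp add: h_def h'_def)
qed

lemma interim_outcome_constrained:
  assumes i: "i < n" and b: "b \<in> space (valuation_space m)"
  shows sets_interim_constrained: "sets (interim_outcome n M constrained_dist i b) = sets (outcome_space m n)"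
    and prob_space_interim_constrained: "prob_space (interim_outcome n M constrained_dist i b)"
proof -
  define N where "N = {..<n} - {i}"
  have PC: "sets (\<Pi>\<^sub>M l\<in>N. constrained_dist) = sets (\<Pi>\<^sub>M l\<in>N. valuation_space m)"
    by (intro sets_PiM_cong; simp)
  have K: "(\<lambda>w. M (w(i := b))) \<in> (\<Pi>\<^sub>M l\<in>N. constrained_dist) \<rightarrow>\<^sub>M prob_algebra (outcome_space m n)"
    using measurable_compose[OF measurable_update_profile[OF i b] measurable_mechanism]
      measurable_cong_sets[OF PC refl] by (simp add: N_def)
  have "prob_space (\<Pi>\<^sub>M l\<in>N. constrained_dist)"
    using valuations_of_items_constrained by (intro prob_space_PiM) (simp add: valuations_of_items_def)
  then interpret P: prob_space "\<Pi>\<^sub>M l\<in>N. constrained_dist" .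
  show "sets (interim_outcome n M constrained_dist i b) = sets (outcome_space m n)"
    unfolding interim_outcome_def N_def[symmetric]
    using measurable_space[OF K] by (intro sets_bind P.not_empty) (auto simp: space_prob_algebra)
  show "prob_space (interim_outcome n M constrained_dist i b)"
    unfolding interim_outcome_def N_def[symmetric]
    using measurable_space[OF K]
    by (intro P.prob_space_bind[OF _ measurable_prob_algebraD[OF K]] AE_I2) (auto simp: space_prob_algebra)
qed

lemma sets_interim_reduction:
  assumes i: "i < n" and b: "b \<in> space (valuation_space m)"
  shows "sets (interim_outcome n (reduction n M) additive_dist i b) = sets (outcome_space m n)"
proof -
  define N where "N = {..<n} - {i}"
  have PA: "sets (\<Pi>\<^sub>M l\<in>N. additive_dist) = sets (\<Pi>\<^sub>M l\<in>N. valuation_space m)"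
    by (intro sets_PiM_cong; simp)
  have K: "(\<lambda>w. reduction n M (w(i := b))) \<in> (\<Pi>\<^sub>M l\<in>N. additive_dist) \<rightarrow>\<^sub>M prob_algebra (outcome_space m n)"
    using measurable_compose[OF measurable_update_profile[OF i b] measurable_reduction]
      measurable_cong_sets[OF PA refl] by (simp add: N_def)
  have "prob_space (\<Pi>\<^sub>M l\<in>N. additive_dist)"
    using valuations_of_items_additive by (intro prob_space_PiM) (simp add: valuations_of_items_def)
  then interpret P: prob_space "\<Pi>\<^sub>M l\<in>N. additive_dist" .
  show ?thesis
    unfolding interim_outcome_def N_def[symmetric]
    using measurable_space[OF K] by (intro sets_bind P.not_empty) (auto simp: space_prob_algebra)
qed

section \<open>Incentives in the reduction\<close>

context
  assumes expectations: "expectations_exist m n M constrained_dist"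
begin

text \<open>The value part is bounded, as there are finitely many bundles, and the payment is
  integrable by assumption. The function \<open>f\<close> is arbitrary so that it can also be the
  value of the favourite part.\<close>

lemma integrable_interim_utility:
  assumes i: "i < n" and b: "b \<in> space (valuation_space m)"
  shows "integrable (interim_outcome n M constrained_dist i b) (\<lambda>(A, p). f (A i) - p i)"
proof -
  interpret P: prob_space "interim_outcome n M constrained_dist i b"
    by (rule prob_space_interim_constrained[OF i b])
  note S = sets_interim_constrained[OF i b]
  have "(\<lambda>(A, p). f (A i)) \<in> borel_measurable (outcome_space m n)"
    by (rule measurable_outcome_component[OF _ i]) simp
  then have meas: "(\<lambda>(A, p). f (A i)) \<in> borel_measurable (interim_outcome n M constrained_dist i b)"
    using measurable_cong_sets[OF S refl] by blast
  have "norm (case x of (A, p) \<Rightarrow> f (A i)) \<le> Max ((\<lambda>S. \<bar>f S\<bar>) ` Pow {..<m})"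
    if "x \<in> space (interim_outcome n M constrained_dist i b)" for x
    using that allocationsD(1)[of "fst x" m n i] i sets_eq_imp_space_eq[OF S]
    by (auto simp: outcome_space_def space_pair_measure intro!: Max_ge)
  then have "integrable (interim_outcome n M constrained_dist i b) (\<lambda>(A, p). f (A i))"
    by (intro P.integrable_const_bound[OF AE_I2 meas])
  moreover have "integrable (interim_outcome n M constrained_dist i b) (\<lambda>(A, p). p i)"
    using expectations i b by (simp add: expectations_exist_def)
  ultimately show ?thesis
    using Bochner_Integration.integrable_diff by (fastforce simp: split_beta')
qed

lemma integral_interim_reduction:
  assumes i: "i < n" and b: "b \<in> space (valuation_space m)"
  shows integrable_interim_reduction:
      "integrable (interim_outcome n (reduction n M) additive_dist i b) (\<lambda>(A, p). f (A i) - p i)" (is ?int)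
    and integral_interim_reduction_eq:
      "(\<integral>(A, p). f (A i) - p i \<partial>interim_outcome n (reduction n M) additive_dist i b) =
      (\<Sum>I\<in>set_pmf C. (\<integral>(A, p). f (favourite I b (A i)) - p i
        \<partial>interim_outcome n M constrained_dist i (constrain I b)) * pmf C I)" (is ?eq)
proof -
  have "(\<lambda>(A, p). f (A i) - p i) \<in> borel_measurable (outcome_space m n)"
    by (rule measurable_outcome_component[OF _ i, of m "\<lambda>S x. f S - x"]) simp
  then have meas: "(\<lambda>(A, p). f (A i) - p i) \<in>
      borel_measurable (interim_outcome n (reduction n M) additive_dist i b)"
    using measurable_cong_sets[OF sets_interim_reduction[OF i b] refl] by blast
  have mix: "(\<integral>\<^sup>+x. g (case x of (A, p) \<Rightarrow> f (A i) - p i) \<partial>interim_outcome n (reduction n M) additive_dist i b) =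
      (\<Sum>I\<in>set_pmf C. (\<integral>\<^sup>+x. g (case x of (A, p) \<Rightarrow> f (favourite I b (A i)) - p i)
        \<partial>interim_outcome n M constrained_dist i (constrain I b)) * ennreal (pmf C I))"
    if g: "g \<in> borel_measurable borel" for g :: "real \<Rightarrow> ennreal"
  proof -
    have "(\<lambda>x. g (f S - x)) \<in> borel_measurable borel" for S
      by (rule measurable_compose[OF _ g]) simp
    from nn_integral_interim_reduction[OF i b, of "\<lambda>S x. g (f S - x)", OF this]
    show ?thesis by (simp add: split_beta')
  qed
  note mixture = integral_finite_mixture[where Y = "set_pmf C" and c = "pmf C"
      and h = "\<lambda>(A, p). f (A i) - p i" and h' = "\<lambda>I (A, p). f (favourite I b (A i)) - p i"
      and Q = "\<lambda>I. interim_outcome n M constrained_dist i (constrain I b)", OF finite_constraints _ meas _ mix]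
  have "integrable (interim_outcome n M constrained_dist i (constrain I b)) (\<lambda>(A, p). f (favourite I b (A i)) - p i)" for I
    by (rule integrable_interim_utility[OF i constrain_in_space, where f = "\<lambda>S. f (favourite I b S)"])
  then show ?int ?eq
    by (intro mixture; simp)+
qed

text \<open>Whatever the bid b, the part handed over is feasible for \<open>I\<close>, so an
  additive v values it at most as much as \<open>constrain I v\<close> values the whole bundle.
  Hence the bid b is worth at most what the type \<open>constrain I v\<close> gets in
  \<open>M\<close> from bidding \<open>constrain I b\<close>, averaged over
  \<open>I\<close>.\<close>

lemma interim_utility_reduction_le:
  assumes i: "i < n" and b: "b \<in> space (valuation_space m)" and v: "v \<in> valuation_support m additive_dist"
  shows "interim_utility n (reduction n M) additive_dist i v b \<le>
    (\<Sum>I\<in>set_pmf C. interim_utility n M constrained_dist i (constrain I v) (constrain I b) * pmf C I)"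
  unfolding interim_utility_def integral_interim_reduction_eq[OF i b]
proof (intro sum_mono mult_right_mono integral_mono)
  show "integrable (interim_outcome n M constrained_dist i (constrain I b)) (\<lambda>(A, p). v (favourite I b (A i)) - p i)" for I
    by (rule integrable_interim_utility[OF i constrain_in_space, where f = "\<lambda>S. v (favourite I b S)"])
  show "integrable (interim_outcome n M constrained_dist i (constrain I b)) (\<lambda>(A, p). constrain I v (A i) - p i)" for I
    by (rule integrable_interim_utility[OF i constrain_in_space])
  fix I assume I: "I \<in> set_pmf C"
  note S = sets_interim_constrained[OF i constrain_in_space, of I b]
  fix x assume "x \<in> space (interim_outcome n M constrained_dist i (constrain I b))"
  then have "fst x \<in> allocations m n"
    using sets_eq_imp_space_eq[OF S] by (auto simp: outcome_space_def space_pair_measure)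
  then have sub: "fst x i \<subseteq> {..<m}" using allocationsD(1) i by blast
  note fav = favourite_in[OF sub empty_feasible[OF I], of b]
  have "v (favourite I b (fst x i)) = (\<Sum>j\<in>favourite I b (fst x i). v {j})"
    using fav(1) sub by (intro additive_support_additive[OF v]) auto
  also have "\<dots> \<le> constrain I v (fst x i)"
    by (rule sum_le_constrain[OF sub fav])
  finally show "(case x of (A, p) \<Rightarrow> v (favourite I b (A i)) - p i) \<le> (case x of (A, p) \<Rightarrow> constrain I v (A i) - p i)"
    by (simp add: split_beta')
qed simp

text \<open>For the truthful bid the favourite part attains the constrained value of the bundle, so
  the bound on lies becomes an equality.\<close>

lemma interim_utility_reduction_truthful:
  assumes i: "i < n" and v: "v \<in> valuation_support m additive_dist"
  shows "interim_utility n (reduction n M) additive_dist i v v =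
    (\<Sum>I\<in>set_pmf C. interim_utility n M constrained_dist i (constrain I v) (constrain I v) * pmf C I)"
proof -
  have vs: "v \<in> space (valuation_space m)" using v by (simp add: valuation_support_def)
  show ?thesis
    unfolding interim_utility_def integral_interim_reduction_eq[OF i vs]
  proof (intro sum.cong refl arg_cong2[of _ _ _ _ "(*)"] Bochner_Integration.integral_cong)
    fix I assume I: "I \<in> set_pmf C"
    note S = sets_interim_constrained[OF i constrain_in_space, of I v]
    fix x assume "x \<in> space (interim_outcome n M constrained_dist i (constrain I v))"
    then have "fst x \<in> allocations m n"
      using sets_eq_imp_space_eq[OF S] by (auto simp: outcome_space_def space_pair_measure)
    then have sub: "fst x i \<subseteq> {..<m}" using allocationsD(1) i by blast
    note fav = favourite_in[OF sub empty_feasible[OF I], of v]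
    have "v (favourite I v (fst x i)) = (\<Sum>j\<in>favourite I v (fst x i). v {j})"
      using fav(1) sub by (intro additive_support_additive[OF v]) auto
    also have "\<dots> = constrain I v (fst x i)"
      by (rule sum_favourite[OF sub empty_feasible[OF I]])
    finally show "(case x of (A, p) \<Rightarrow> v (favourite I v (A i)) - p i) = (case x of (A, p) \<Rightarrow> constrain I v (A i) - p i)"
      by (simp add: split_beta')
  qed
qed

lemma expectations_exist_reduction: "expectations_exist m n (reduction n M) additive_dist"
  unfolding expectations_exist_def
proof (intro conjI allI impI ballI)
  fix i assume i: "i < n"
  \<comment> \<open>With value function 0 the utility is the negated payment.\<close>
  show "integrable (interim_outcome n (reduction n M) additive_dist i b) (\<lambda>(A, p). p i)"
    if b: "b \<in> space (valuation_space m)" for b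
    using Bochner_Integration.integrable_minus[OF integrable_interim_reduction[OF i b, of "\<lambda>_. 0"]]
    by (simp add: split_beta')
  have "(\<integral>\<^sup>+(A, p). ennreal (- p i) \<partial>truthful_outcome n (reduction n M) additive_dist) =
      (\<integral>\<^sup>+(A, p). ennreal (- p i) \<partial>truthful_outcome n M constrained_dist)"
    using nn_integral_truthful_reduction[OF i, of "\<lambda>x. ennreal (- x)"] by simp
  also have "\<dots> < \<infinity>" using expectations i by (simp add: expectations_exist_def)
  finally show "(\<integral>\<^sup>+(A, p). ennreal (- p i) \<partial>truthful_outcome n (reduction n M) additive_dist) < \<infinity>" .
qed

text \<open>Averages over \<open>I\<close> the incentive constraints of \<open>M\<close> for the
  support type \<open>constrain I v\<close> against the bid \<open>constrain I b\<close>.\<close>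

lemma BIC_reduction:
  assumes "BIC m n M constrained_dist"
  shows "BIC m n (reduction n M) additive_dist"
  unfolding BIC_def
proof (intro allI impI ballI)
  fix i v b assume i: "i < n" and v: "v \<in> valuation_support m additive_dist" and b: "b \<in> space (valuation_space m)"
  have "interim_utility n (reduction n M) additive_dist i v b \<le>
      (\<Sum>I\<in>set_pmf C. interim_utility n M constrained_dist i (constrain I v) (constrain I b) * pmf C I)"
    by (rule interim_utility_reduction_le[OF i b v])
  also have "\<dots> \<le> (\<Sum>I\<in>set_pmf C. interim_utility n M constrained_dist i (constrain I v) (constrain I v) * pmf C I)"
    using assms i constrain_in_support[OF v] constrain_in_space unfolding BIC_def
    by (intro sum_mono mult_right_mono) auto
  also have "\<dots> = interim_utility n (reduction n M) additive_dist i v v"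
    by (rule interim_utility_reduction_truthful[OF i v, symmetric])
  finally show "interim_utility n (reduction n M) additive_dist i v b \<le>
      interim_utility n (reduction n M) additive_dist i v v" .
qed

lemma BIR_reduction:
  assumes "BIR m n M constrained_dist"
  shows "BIR m n (reduction n M) additive_dist"
  unfolding BIR_def
proof (intro allI impI ballI)
  fix i v assume i: "i < n" and v: "v \<in> valuation_support m additive_dist"
  show "0 \<le> interim_utility n (reduction n M) additive_dist i v v"
    unfolding interim_utility_reduction_truthful[OF i v]
    using assms i constrain_in_support[OF v] unfolding BIR_def
    by (intro sum_nonneg mult_nonneg_nonneg) auto
qed

end

lemma revenue_reduction: "revenue n (reduction n M) additive_dist = revenue n M constrained_dist"
  unfolding revenue_def
proof (intro sum.cong refl)
  fix i assume "i \<in> {..<n}"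
  then have i: "i < n" by simp
  show "enn2ereal (\<integral>\<^sup>+(A, p). ennreal (p i) \<partial>truthful_outcome n (reduction n M) additive_dist) -
      enn2ereal (\<integral>\<^sup>+(A, p). ennreal (- p i) \<partial>truthful_outcome n (reduction n M) additive_dist) =
      enn2ereal (\<integral>\<^sup>+(A, p). ennreal (p i) \<partial>truthful_outcome n M constrained_dist) -
      enn2ereal (\<integral>\<^sup>+(A, p). ennreal (- p i) \<partial>truthful_outcome n M constrained_dist)"
    using nn_integral_truthful_reduction[OF i, of ennreal]
      nn_integral_truthful_reduction[OF i, of "\<lambda>x. ennreal (- x)"] by simp
qed

end

section \<open>Comparison of the optimal revenues and of the two auctions\<close>

lemma opt_revenue_constrained_le: "opt_revenue m n constrained_dist \<le> opt_revenue m n additive_dist"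
  unfolding opt_revenue_def
proof (rule SUP_least, elim CollectE conjE)
  fix M assume M: "is_mechanism m n M" "expectations_exist m n M constrained_dist"
    "BIC m n M constrained_dist" "BIR m n M constrained_dist"
  have "is_mechanism m n (reduction n M)"
    unfolding is_mechanism_def by (rule measurable_reduction[OF M(1)])
  then have "reduction n M \<in> {M. is_mechanism m n M \<and> expectations_exist m n M additive_dist \<and>
      BIC m n M additive_dist \<and> BIR m n M additive_dist}"
    using expectations_exist_reduction[OF M(1,2)] BIC_reduction[OF M(1-3)] BIR_reduction[OF M(1,2,4)] by simp
  then have "revenue n (reduction n M) additive_dist \<le>
      (SUP M\<in>{M. is_mechanism m n M \<and> expectations_exist m n M additive_dist \<and>
        BIC m n M additive_dist \<and> BIR m n M additive_dist}. revenue n M additive_dist)"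
    by (rule SUP_upper)
  then show "revenue n M constrained_dist \<le>
      (SUP M\<in>{M. is_mechanism m n M \<and> expectations_exist m n M additive_dist \<and>
        BIC m n M additive_dist \<and> BIR m n M additive_dist}. revenue n M additive_dist)"
    by (simp add: revenue_reduction[OF M(1)])
qed

lemma revenue_VCG_additive_le_VCG_UD:
  assumes "k \<le> K - (m - 1)"
  shows "revenue k (VCG m k) additive_dist \<le> revenue K (VCG_UD m K) constrained_dist"
  using revenue_VCG_le[OF valuations_of_items_additive AE_additive_dist]
    revenue_VCG_UD_ge[OF valuations_of_items_constrained AE_constrained_dist assms] by (rule order_trans)

end

lemma regular_distD:
  assumes "regular_dist D"
  shows "prob_space D" "sets D = sets borel" "AE x in D. 0 \<le> x"
proof -
  obtain f J where f: "prob_space D" "f \<in> borel_measurable borel" "D = density lborel (\<lambda>x. ennreal (f x))"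
      "J \<subseteq> {0..}" "\<And>x. x \<notin> J \<Longrightarrow> f x = 0"
    using assms by (auto simp: regular_dist_def has_interval_density_def)
  show "prob_space D" by fact
  show "sets D = sets borel" using f(3) by simp
  have "0 \<le> x" if "0 < ennreal (f x)" for x
    using f(4) f(5)[of x] that by (cases "x \<in> J") auto
  then show "AE x in D. 0 \<le> x"
    using f(2) by (subst f(3)) (simp add: AE_density)
qed

theorem theorem5p8:
  fixes n m :: nat
  assumes "1 \<le> n" and "1 \<le> m"
  shows "competition_complexity VCG_UD m n (constrained_dists m)
           \<le> competition_complexity VCG m n (additive_dists m) + enat (m - 1)"
proof -
  define X where "X = {c. \<forall>F\<in>additive_dists m. opt_revenue m n F \<le> revenue (n + c) (VCG m (n + c)) F}"
  define Y where "Y = {c. \<forall>F\<in>constrained_dists m. opt_revenue m n F \<le> revenue (n + c) (VCG_UD m (n + c)) F}"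
  have Y: "c + (m - 1) \<in> Y" if c: "c \<in> X" for c
    unfolding Y_def
  proof (intro CollectI ballI)
    fix F assume "F \<in> constrained_dists m"
    then obtain D C where F: "F = distr ((\<Pi>\<^sub>M j\<in>{..<m}. D j) \<Otimes>\<^sub>M measure_pmf C) (valuation_space m)
        (\<lambda>(t, I). constrained_val m I t)"
      and D: "\<And>j. j < m \<Longrightarrow> regular_dist (D j)"
      and C: "\<And>I. I \<in> set_pmf C \<Longrightarrow> downward_closed m I \<and> (\<forall>j<m. {j} \<in> I)"
      unfolding constrained_dists_def by blast
    \<comment> \<open>The locale asks for a distribution at every index; from m on,
      \<open>D 0\<close> serves, which is regular because 1 \<le> m.\<close>
    define D' where "D' = (\<lambda>j. if j < m then D j else D 0)"
    have D': "regular_dist (D' j)" for j using D assms(2) by (simp add: D'_def)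
    interpret constrained_items m D' C
    proof (intro constrained_items.intro item_distributions.intro constrained_items_axioms.intro)
      show "prob_space (D' j)" "sets (D' j) = sets borel" "AE x in D' j. 0 \<le> x" for j
        using regular_distD[OF D'] by blast+
      show "1 \<le> m" by fact
      show "downward_closed m I" if "I \<in> set_pmf C" for I
        using C[OF that] by blast
      show "{j} \<in> I" if "I \<in> set_pmf C" "j < m" for I j
        using C[OF that(1)] that(2) by blast
    qed
    have F_eq: "F = constrained_dist"
    proof -
      have "(\<Pi>\<^sub>M j\<in>{..<m}. D j) = type_dist"
        unfolding type_dist_def by (intro PiM_cong) (auto simp: D'_def)
      then show ?thesis by (simp add: F constrained_dist_def)
    qed
    have "additive_dist \<in> additive_dists m"
      unfolding additive_dists_def additive_dist_def type_dist_def using D'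
      by (intro CollectI exI[of _ D'] conjI refl) simp
    then have opt: "opt_revenue m n additive_dist \<le> revenue (n + c) (VCG m (n + c)) additive_dist"
      using c by (simp add: X_def)
    have "opt_revenue m n F \<le> opt_revenue m n additive_dist"
      unfolding F_eq by (rule opt_revenue_constrained_le)
    also note opt
    \<comment> \<open>The auction on matchings has k + (m - 1) bidders for k = n + c, exactly what
      the comparison of prices asks for.\<close>
    also have "revenue (n + c) (VCG m (n + c)) additive_dist \<le>
        revenue (n + (c + (m - 1))) (VCG_UD m (n + (c + (m - 1)))) F"
      unfolding F_eq by (rule revenue_VCG_additive_le_VCG_UD) simp
    finally show "opt_revenue m n F \<le> revenue (n + (c + (m - 1))) (VCG_UD m (n + (c + (m - 1)))) F" .
  qed
  have eq: "competition_complexity VCG m n (additive_dists m) = Inf (enat ` X)"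
    "competition_complexity VCG_UD m n (constrained_dists m) = Inf (enat ` Y)"
    by (simp_all add: competition_complexity_def X_def Y_def)
  show ?thesis
  proof (cases "X = {}")
    \<comment> \<open>No number of additional bidders suffices for VCG, so the right-hand side is
      infinite.\<close>
    case True
    then show ?thesis by (simp add: eq Inf_enat_def)
  next
    case False
    then have "Inf (enat ` X) \<in> enat ` X"
      unfolding Inf_enat_def using LeastI_ex[of "\<lambda>x. x \<in> enat ` X"] by auto
    then obtain c where c: "c \<in> X" "Inf (enat ` X) = enat c" by auto
    have "Inf (enat ` Y) \<le> enat (c + (m - 1))" using Y[OF c(1)] by (intro Inf_lower) auto
    then show ?thesis by (simp add: eq c(2))
  qed
qed

end
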